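(* Let $S\in\mathbb{R}[x,y]$ be a real polynomial and let $H=\partial_x\partial_y(\partial_x-\partial_y)S$. Let $N\ge 1$ and let $\alpha^{(1)},\dots,\alpha^{(N)}\in\mathbb{N}^2$ be multi-indices such that $$|\partial^{\alpha^{(i)}}H(x,y)|\ge 1\quad\text{for all }1\le i\le N\text{ and all }(x,y)\in[0,1]^2 .$$ Put $d=\min\{|\alpha^{(i)}|:1\le i\le N\}$. Then for each $\varphi\in C_0^\infty(\mathbb{R}^2)$ with $\operatorname{supp}(\varphi)\subseteq[0,1]^2$ there exists a constant $C$, depending only on $\deg S$ and $\varphi$, such that for all real $\lambda\ne 0$ and all $f_1,f_2,f_3\in L^2(\mathbb{R})$, $$|\Lambda_\lambda(f_1,f_2,f_3)|\le C|\lambda|^{-\frac{1}{2(3+d)}}\|f_1\|_2\|f_2\|_2\|f_3\|_2 .$$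
   Context: $\mathbb{N}$ contains $0$. For $\alpha=(\alpha_1,\alpha_2)\in\mathbb{N}^2$, $\partial^{\alpha}H=\partial_x^{\alpha_1}\partial_y^{\alpha_2}H$ and $|\alpha|=\alpha_1+\alpha_2$. The trilinear form is $$\Lambda_\lambda(f_1,f_2,f_3)=\iint_{\mathbb{R}^2}e^{i\lambda S(x,y)}f_1(x)f_2(y)f_3(x+y)\varphi(x,y)\,dx\,dy ,$$ and $\|\cdot\|_2$ is the $L^2(\mathbb{R})$ norm. *)

theory Defs
  imports "HOL-Analysis.Analysis" "HOL-Computational_Algebra.Polynomial"
begin

text \<open>
  An element of \<open>\<real>[x,y]\<close> is rendered as \<open>\<real>[x][y]\<close>: the outer variable is \<open>y\<close>, and
  \<open>coeff (coeff S j) i\<close> is the coefficient of \<open>x\<^sup>i y\<^sup>j\<close>.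
\<close>

type_synonym bipoly = "real poly poly"

definition eval2 :: "bipoly \<Rightarrow> real \<Rightarrow> real \<Rightarrow> real" where
  "eval2 S x y = poly (poly S [:y:]) x"

text \<open>The total degree; the zero polynomial is given degree 0.\<close>

definition total_degree :: "bipoly \<Rightarrow> nat" where
  "total_degree S = Max (insert 0 {i + j | i j. coeff (coeff S j) i \<noteq> 0})"

definition dx :: "bipoly \<Rightarrow> bipoly" where
  "dx S = map_poly pderiv S"

definition dy :: "bipoly \<Rightarrow> bipoly" where
  "dy S = pderiv S"

definition multi_deriv :: "nat \<times> nat \<Rightarrow> bipoly \<Rightarrow> bipoly" where
  "multi_deriv \<alpha> S = (dx ^^ fst \<alpha>) ((dy ^^ snd \<alpha>) S)"

definition multi_order :: "nat \<times> nat \<Rightarrow> nat" where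
  "multi_order \<alpha> = fst \<alpha> + snd \<alpha>"

definition H_of :: "bipoly \<Rightarrow> bipoly" where
  "H_of S = dx (dy (dx S - dy S))"

text \<open>The formal derivatives are the analytic partial derivatives of the evaluation.\<close>

lemma eval2_sum: "eval2 S x y = (\<Sum>j\<le>degree S. poly (coeff S j) x * y ^ j)"
  by (simp add: eval2_def poly_altdef[of S] poly_sum poly_power)

lemma eval2_dx: "((\<lambda>t. eval2 S t y) has_field_derivative eval2 (dx S) x y) (at x)"
proof -
  have "eval2 (dx S) x y = (\<Sum>j\<le>degree S. poly (coeff (dx S) j) x * y ^ j)"
    unfolding eval2_sum
    by (rule sum.mono_neutral_left)
      (auto simp: dx_def coeff_eq_0 map_poly_degree_leq not_le intro: order_trans[OF _ map_poly_degree_leq])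
  also have "\<dots> = (\<Sum>j\<le>degree S. poly (pderiv (coeff S j)) x * y ^ j)"
    by (simp add: dx_def coeff_map_poly)
  finally show ?thesis
    unfolding eval2_sum[of S] by (auto intro!: derivative_eq_intros)
qed

lemma eval2_dy: "((\<lambda>t. eval2 S x t) has_field_derivative eval2 (dy S) x y) (at y)"
proof (induction S)
  case 0
  show ?case by (simp add: eval2_def dy_def)
next
  case (pCons a S)
  have "((\<lambda>t. poly a x + t * eval2 S x t) has_field_derivative
          eval2 S x y + y * eval2 (dy S) x y) (at y)"
    by (auto intro!: derivative_eq_intros pCons.IH)
  moreover have "eval2 (pCons a S) x = (\<lambda>t. poly a x + t * eval2 S x t)"
    by (auto simp: eval2_def)
  moreover have "eval2 (dy (pCons a S)) x y = eval2 S x y + y * eval2 (dy S) x y"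
    by (simp add: eval2_def dy_def pderiv_pCons)
  ultimately show ?case by simp
qed

text \<open>
  \<open>C_k k f\<close>: \<open>f\<close> is \<open>k\<close> times continuously differentiable on the whole space, expressed through
  iterated directional derivatives (intended for finite-dimensional domains, where this is the
  usual notion).
\<close>

primrec C_k :: "nat \<Rightarrow> ('a::euclidean_space \<Rightarrow> 'b::real_normed_vector) \<Rightarrow> bool" where
  "C_k 0 f \<longleftrightarrow> continuous_on UNIV f"
| "C_k (Suc k) f \<longleftrightarrow>
     (\<forall>x. f differentiable (at x)) \<and> (\<forall>v. C_k k (\<lambda>x. frechet_derivative f (at x) v))"

definition supp :: "('a::euclidean_space \<Rightarrow> 'b::real_normed_vector) \<Rightarrow> 'a set" where
  "supp f = closure (support_on UNIV f)"

definition smooth_compactly_supported ::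
    "('a::euclidean_space \<Rightarrow> 'b::real_normed_vector) \<Rightarrow> bool" where
  "smooth_compactly_supported f \<longleftrightarrow> (\<forall>k. C_k k f) \<and> compact (supp f)"

definition in_L2 :: "(real \<Rightarrow> complex) \<Rightarrow> bool" where
  "in_L2 f \<longleftrightarrow> f \<in> borel_measurable lebesgue \<and> integrable lebesgue (\<lambda>x. (cmod (f x))\<^sup>2)"

definition L2_norm :: "(real \<Rightarrow> complex) \<Rightarrow> real" where
  "L2_norm f = sqrt (LINT x|lebesgue. (cmod (f x))\<^sup>2)"

text \<open>
  The integrand below is absolutely integrable for \<open>f\<^sub>1, f\<^sub>2, f\<^sub>3\<close> in \<open>L\<^sup>2\<close> and \<open>\<phi>\<close> bounded with
  compact support, so the Bochner integral is the intended double integral.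
\<close>

definition trilinear_form ::
    "bipoly \<Rightarrow> (real \<times> real \<Rightarrow> complex) \<Rightarrow> real
      \<Rightarrow> (real \<Rightarrow> complex) \<Rightarrow> (real \<Rightarrow> complex) \<Rightarrow> (real \<Rightarrow> complex) \<Rightarrow> complex" where
  "trilinear_form S \<phi> l f\<^sub>1 f\<^sub>2 f\<^sub>3 =
     (LINT (x, y)|lebesgue.
        exp (\<i> * complex_of_real (l * eval2 S x y)) * f\<^sub>1 x * f\<^sub>2 y * f\<^sub>3 (x + y) * \<phi> (x, y))"

end

theory Submission
  imports Defs "HOL-Computational_Algebra.Fundamental_Theorem_Algebra"
begin

text \<open>
  It suffices to use one multi-index of minimal order \<open>d\<close>.  The amplitude is a superposition of
  products of indicator functions of half lines, which can be absorbed into \<open>f\<^sub>1\<close> and \<open>f\<^sub>2\<close>.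

  On a square of side \<open>r\<close> on which \<open>H\<close> has size \<open>m\<close> and is essentially constant, Cauchy--Schwarz in
  \<open>x + y\<close> leaves bilinear forms with phases \<open>S(x,y) - S(x+\<tau>,y-\<tau>)\<close>, whose mixed second derivative is
  the integral of \<open>-H\<close> over a segment; a \<open>TT\<^sup>*\<close> argument for them gives the bound \<open>(|\<lambda>|m)\<^bsup>-1/6\<^esup>\<close> for
  the trilinear form, next to the trivial bound \<open>r\<^bsup>1/2\<^esup>\<close>.

  The unit square is cut into maximal dyadic squares on which \<open>H\<close> is essentially constant.  The
  parent of such a square of side \<open>r\<close> shows that \<open>H\<close> oscillates in \<open>y\<close> (or in \<open>x\<close>) at scale \<open>r\<close>.
  For a fixed \<open>x\<close>, an oscillation in \<open>y\<close> forces a complex root of some \<open>\<partial>\<^sub>x\<^sup>k H(x,\<cdot>)\<close> at distance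
  comparable to \<open>r\<close>; hence, for each dyadic size \<open>m\<close> of \<open>H\<close>, boundedly many such squares lie over each
  \<open>x\<close>, whatever their sides, and Cauchy--Schwarz sums their contributions without loss.  As
  \<open>r\<^sup>d \<lesssim> m\<close>, the sum over \<open>m\<close> of \<open>min(m\<^bsup>1/(2d)\<^esup>, (|\<lambda>|m)\<^bsup>-1/6\<^esup>)\<close> is geometric with the claimed total.
\<close>

subsection \<open>An oscillatory integral with a polynomial bump\<close>

text \<open>Squares near zeros of H may never qualify, so the subdivision is cut off at a generation
  \<open>G\<close> depending on \<lambda>. The bad squares left there have one common side; the
  trivial bound and the same count over lines dispose of them. Oscillation is measured by weighted
  sums of Taylor coefficients instead of suprema: moving the centre by h enlarges the scale by h,
  enlarging the scale by a factor A costs at most A^(2n), and the part with y-derivatives shrinks at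
  least linearly with the scale. No constant then depends on the coefficients of S. The recurring
  multiples of the side come from this calculus: 3 controls jets throughout a box of half-width two
  sides, 7 = 2 * 3 + 1 results from passing to the parent, 11 = 7 + 2 + 2 from meeting at a point
  within two sides of both squares. The count over lines is needed for one function only:
  Cauchy-Schwarz over squares pairs it with the product of the other two, for which a count near
  points is enough. For d > 0 the bounds m^(1/(2d)) and (|\<lambda>|m)^(-1/6) cross at m =
  |\<lambda>|^(-d/(3+d)), where both equal the claimed power of |\<lambda>|.\<close>

lemma oscillatory_bump_bound:
  fixes \<Psi> g g1 g2 :: "real \<Rightarrow> real"
  assumes r: "r > 0" and \<gamma>: "\<gamma> > 0"
    and d\<Psi>: "\<And>y. (\<Psi> has_field_derivative g y) (at y)"
    and dg: "\<And>y. (g has_field_derivative g1 y) (at y)"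
    and dg1: "\<And>y. (g1 has_field_derivative g2 y) (at y)"
    and g: "\<And>y. \<bar>y - y0\<bar> \<le> r \<Longrightarrow> \<gamma> \<le> \<bar>g y\<bar>"
    and g1: "\<And>y. \<bar>y - y0\<bar> \<le> r \<Longrightarrow> \<bar>g1 y\<bar> \<le> 2 * \<gamma> / r"
    and g2: "\<And>y. \<bar>y - y0\<bar> \<le> r \<Longrightarrow> \<bar>g2 y\<bar> \<le> 2 * \<gamma> / r\<^sup>2"
  shows "cmod (integral {y0 - r..y0 + r}
           (\<lambda>y. cis (\<Psi> y) * complex_of_real ((1 - ((y - y0) / r)\<^sup>2)\<^sup>2))) \<le> 92 * r / (\<gamma> * r)\<^sup>2"
proof -
  define t where "t y = (y - y0) / r" for y
  define w where "w y = (1 - (t y)\<^sup>2)\<^sup>2" for y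
  define w1 where "w1 y = - 4 * t y * (1 - (t y)\<^sup>2) / r" for y
  define w2 where "w2 y = (12 * (t y)\<^sup>2 - 4) / r\<^sup>2" for y
  \<comment> \<open>Two integrations by parts rolled into one antiderivative: with
    \<open>b = w / g\<close> and \<open>c = b' / g\<close>, the function \<open>F\<close> satisfies
    F' = cis \<Psi> * (w + c'). The weight has double zeros at both ends, so \<open>F\<close>
    vanishes there and only c' = \<open>c1\<close> remains to be estimated.\<close>
  define b where "b y = w y / g y" for y
  define c where "c y = w1 y / (g y)^2 - w y * g1 y / (g y)^3" for y
  define c1 where "c1 y = w2 y / (g y)^2 - 3 * w1 y * g1 y / (g y)^3 - w y * g2 y / (g y)^3
       + 3 * w y * (g1 y)\<^sup>2 / (g y)^4" for y
  define F where "F y = cis (\<Psi> y) * (complex_of_real (c y) - \<i> * complex_of_real (b y))" for y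
  let ?I = "{y0 - r..y0 + r}"
  have inI: "\<bar>y - y0\<bar> \<le> r" if "y \<in> ?I" for y using that by (auto simp: abs_le_iff)
  have g0: "g y \<noteq> 0" if "y \<in> ?I" for y using g[OF inI[OF that]] \<gamma> by auto
  have dt: "(t has_field_derivative 1 / r) (at y)" for y
    unfolding t_def using r by (auto intro!: derivative_eq_intros)
  have dw: "(w has_field_derivative w1 y) (at y)" for y
    unfolding w_def w1_def by (rule derivative_eq_intros dt refl)+ (use r in \<open>simp add: field_simps\<close>)
  have dw1: "(w1 has_field_derivative w2 y) (at y)" for y
    unfolding w2_def w1_def
    by (rule derivative_eq_intros dt refl)+ (use r in \<open>simp_all add: field_simps power2_eq_square\<close>)
  have db: "(b has_field_derivative w1 y / g y - w y * g1 y / (g y)\<^sup>2) (at y)" if "y \<in> ?I" for y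
    unfolding b_def
    by (rule derivative_eq_intros dw dg g0[OF that] refl)+ (use g0[OF that] in \<open>simp add: field_simps power2_eq_square\<close>)
  have dc: "(c has_field_derivative c1 y) (at y)" if "y \<in> ?I" for y
  proof -
    have gy: "g y \<noteq> 0" by (rule g0[OF that])
    show ?thesis
      unfolding c_def c1_def
      by (rule derivative_eq_intros dw dw1 dg dg1 refl | simp add: gy)+
        (use gy in \<open>simp add: field_simps eval_nat_numeral\<close>)
  qed
  have vr: "((\<lambda>y. complex_of_real (f y)) has_vector_derivative complex_of_real d) (at y)"
    if "(f has_field_derivative d) (at y)" for f d y
    using that by (intro has_vector_derivative_of_real) (simp add: has_real_derivative_iff_has_vector_derivative)
  have dE: "((\<lambda>y. cis (\<Psi> y)) has_vector_derivative \<i> * complex_of_real (g y) * cis (\<Psi> y)) (at y)" for y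
  proof -
    have "((\<lambda>y. exp (\<i> * complex_of_real (\<Psi> y))) has_vector_derivative
            (\<i> * complex_of_real (g y)) * exp (\<i> * complex_of_real (\<Psi> y))) (at y)"
      using field_vector_diff_chain_at[OF has_vector_derivative_mult_right[OF vr[OF d\<Psi>[of y]], of \<i>] DERIV_exp]
      by (simp add: o_def)
    then show ?thesis by (simp add: cis_conv_exp)
  qed
  have dF: "(F has_vector_derivative cis (\<Psi> y) * complex_of_real (w y) + cis (\<Psi> y) * complex_of_real (c1 y)) (at y)"
    if y: "y \<in> ?I" for y
  proof -
    have gy: "g y \<noteq> 0" by (rule g0[OF y])
    have e1: "g y * c y = w1 y / g y - w y * g1 y / (g y)\<^sup>2" and e2: "g y * b y = w y"
      unfolding c_def b_def using gy by (simp_all add: field_simps power2_eq_square power3_eq_cube)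
    have 1: "(F has_vector_derivative
        cis (\<Psi> y) * (complex_of_real (c1 y) - \<i> * complex_of_real (w1 y / g y - w y * g1 y / (g y)\<^sup>2))
        + (\<i> * complex_of_real (g y) * cis (\<Psi> y)) * (complex_of_real (c y) - \<i> * complex_of_real (b y))) (at y)"
      unfolding F_def
      by (intro has_vector_derivative_mult dE has_vector_derivative_diff vr dc y
            has_vector_derivative_mult_right db)
    have 2: "(\<i> * complex_of_real (g y) * cis (\<Psi> y)) * (complex_of_real (c y) - \<i> * complex_of_real (b y))
       = cis (\<Psi> y) * (\<i> * complex_of_real (g y * c y) + complex_of_real (g y * b y))"
      by (simp add: algebra_simps)
    show ?thesis using 1 unfolding 2 e1 e2 by (simp add: algebra_simps)
  qed
  have ends: "F (y0 - r) = 0" "F (y0 + r) = 0"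
    using r by (simp_all add: F_def b_def c_def w_def w1_def t_def)
  have hiF: "((\<lambda>y. cis (\<Psi> y) * complex_of_real (w y) + cis (\<Psi> y) * complex_of_real (c1 y)) has_integral 0) ?I"
    using fundamental_theorem_of_calculus[of "y0 - r" "y0 + r" F] dF ends r
    by (simp add: has_vector_derivative_at_within)
  have contE: "continuous_on ?I (\<lambda>y. cis (\<Psi> y))"
    by (intro continuous_at_imp_continuous_on ballI has_vector_derivative_continuous[OF dE])
  have contw: "continuous_on ?I w"
    by (intro continuous_at_imp_continuous_on ballI DERIV_isCont[OF dw])
  have i1: "(\<lambda>y. cis (\<Psi> y) * complex_of_real (w y)) integrable_on ?I"
    by (intro integrable_continuous_interval continuous_intros contE contw)
  have hi2: "((\<lambda>y. cis (\<Psi> y) * complex_of_real (c1 y)) has_integral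
      (0 - integral ?I (\<lambda>y. cis (\<Psi> y) * complex_of_real (w y)))) ?I"
    using has_integral_diff[OF hiF integrable_integral[OF i1]] by simp
  have bound: "cmod (cis (\<Psi> y) * complex_of_real (c1 y)) \<le> 46 / (\<gamma> * r)\<^sup>2" if y: "y \<in> ?I" for y
  proof -
    let ?G = "\<bar>g y\<bar>"
    have G: "\<gamma> \<le> ?G" using g[OF inI[OF y]] .
    have t1: "\<bar>t y\<bar> \<le> 1" using inI[OF y] r by (simp add: t_def field_simps)
    have t2: "(t y)\<^sup>2 \<le> 1" using t1 by (simp add: abs_square_le_1)
    have wb: "\<bar>w y\<bar> \<le> 1" using t2 unfolding w_def by (auto simp: power_le_one_iff intro!: power_le_one)
    have w1b: "\<bar>w1 y\<bar> \<le> 4 / r"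
    proof -
      have "\<bar>t y * (1 - (t y)\<^sup>2)\<bar> \<le> 1 * 1" unfolding abs_mult using t1 t2 by (intro mult_mono) auto
      then show ?thesis unfolding w1_def using r by (simp add: abs_mult divide_right_mono)
    qed
    have w2b: "\<bar>w2 y\<bar> \<le> 8 / r\<^sup>2"
    proof -
      have "\<bar>12 * (t y)\<^sup>2 - 4\<bar> \<le> 8" using t2 zero_le_power2[of "t y"] by linarith
      then show ?thesis unfolding w2_def using r by (simp add: divide_right_mono)
    qed
    have q1: "\<bar>g1 y\<bar> / ?G \<le> 2 / r"
    proof -
      have "\<bar>g1 y\<bar> \<le> 2 * \<gamma> / r" by (rule g1[OF inI[OF y]])
      also have "\<dots> \<le> 2 * ?G / r" using G r by (simp add: divide_right_mono)
      finally show ?thesis using G \<gamma> r by (simp add: field_simps)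
    qed
    have q2: "\<bar>g2 y\<bar> / ?G \<le> 2 / r\<^sup>2"
    proof -
      have "\<bar>g2 y\<bar> \<le> 2 * \<gamma> / r\<^sup>2" by (rule g2[OF inI[OF y]])
      also have "\<dots> \<le> 2 * ?G / r\<^sup>2" using G r by (simp add: divide_right_mono)
      finally show ?thesis using G \<gamma> r by (simp add: field_simps)
    qed
    have gi: "1 / ?G\<^sup>2 \<le> 1 / \<gamma>\<^sup>2" using G \<gamma> by (intro divide_left_mono power_mono) auto
    have c1e: "c1 y = (w2 y - 3 * w1 y * (g1 y / g y) - w y * (g2 y / g y)
        + 3 * w y * (g1 y / g y)\<^sup>2) * (1 / (g y)\<^sup>2)"
      unfolding c1_def using g0[OF y]
      by (simp add: field_simps power2_eq_square power3_eq_cube power4_eq_xxxx)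
    have a1: "\<bar>w1 y * (g1 y / g y)\<bar> \<le> (4 / r) * (2 / r)"
      unfolding abs_mult abs_divide using w1b q1 r by (intro mult_mono) auto
    have a2: "\<bar>w y * (g2 y / g y)\<bar> \<le> 1 * (2 / r\<^sup>2)"
      unfolding abs_mult abs_divide using wb q2 r by (intro mult_mono) auto
    have a3: "\<bar>w y * (g1 y / g y)\<^sup>2\<bar> \<le> 1 * (2 / r)\<^sup>2"
      unfolding abs_mult power_abs abs_divide using wb q1 r \<gamma> G by (intro mult_mono power_mono) auto
    \<comment> \<open>46 = 8 + 24 + 2 + 12, one summand for each term of \<open>c1\<close>; the
      length 2r of the interval turns it into 92.\<close>
    have s: "\<bar>w2 y - 3 * w1 y * (g1 y / g y) - w y * (g2 y / g y) + 3 * w y * (g1 y / g y)\<^sup>2\<bar> \<le> 46 / r\<^sup>2"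
    proof -
      have "\<bar>w2 y - 3 * w1 y * (g1 y / g y) - w y * (g2 y / g y) + 3 * w y * (g1 y / g y)\<^sup>2\<bar>
        \<le> \<bar>w2 y\<bar> + 3 * \<bar>w1 y * (g1 y / g y)\<bar> + \<bar>w y * (g2 y / g y)\<bar> + 3 * \<bar>w y * (g1 y / g y)\<^sup>2\<bar>"
        unfolding mult.assoc by linarith
      also have "\<dots> \<le> 8 / r\<^sup>2 + 3 * ((4 / r) * (2 / r)) + 1 * (2 / r\<^sup>2) + 3 * (1 * (2 / r)\<^sup>2)"
        by (intro add_mono mult_left_mono w2b a1 a2 a3) auto
      also have "\<dots> = 46 / r\<^sup>2" using r by (simp add: field_simps power2_eq_square)
      finally show ?thesis .
    qed
    have "\<bar>c1 y\<bar> \<le> (46 / r\<^sup>2) * (1 / \<gamma>\<^sup>2)"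
      unfolding c1e abs_mult by (rule mult_mono[OF s]) (use gi in auto)
    then show ?thesis by (simp add: norm_mult power_mult_distrib mult.commute)
  qed
  have "cmod (0 - integral ?I (\<lambda>y. cis (\<Psi> y) * complex_of_real (w y))) \<le> 46 / (\<gamma> * r)\<^sup>2 * measure lborel (cbox (y0 - r) (y0 + r))"
    using hi2 by (intro has_integral_bound) (use bound in auto)
  also have "\<dots> = 92 * r / (\<gamma> * r)\<^sup>2" using r by simp
  finally show ?thesis unfolding w_def t_def by simp
qed

subsection \<open>Weighted norms of Taylor jets\<close>

text \<open>Since the derivatives beyond order n vanish, the Lagrange remainder is zero and Taylor's
  formula is exact for increments of either sign.\<close>

lemma taylor_vanishing:
  fixes f :: "nat \<Rightarrow> real \<Rightarrow> real"
  assumes d: "\<And>i y. (f i has_field_derivative f (Suc i) y) (at y)"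
    and z: "\<And>i y. i > n \<Longrightarrow> f i y = 0"
  shows "f i (y + h) = (\<Sum>e\<in>{i..n}. f e y * h ^ (e - i) / fact (e - i))"
proof -
  define df where "df m t = f (i + m) (y + t)" for m t
  have "\<forall>m t. DERIV (df m) t :> df (Suc m) t"
    unfolding df_def using d by (auto simp: add.commute[of y] simp flip: DERIV_shift)
  from Maclaurin_all_le[of df "df 0" h "Suc n", OF refl this]
  obtain t where t: "df 0 h = (\<Sum>m<Suc n. (df m 0 / fact m) * h ^ m) + (df (Suc n) t / fact (Suc n)) * h ^ Suc n"
    by blast
  have "f i (y + h) = df 0 h" by (simp add: df_def)
  also have "\<dots> = (\<Sum>m<Suc n. f (i + m) y * h ^ m / fact m)"
    using t z[of "i + Suc n"] by (simp add: df_def)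
  also have "\<dots> = (\<Sum>m\<in>{0..n}. f (i + m) y * h ^ m / fact m)"
    by (intro sum.cong) auto
  also have "\<dots> = (\<Sum>m\<in>{m. m \<le> n \<and> i + m \<le> n}. f (i + m) y * h ^ m / fact m)"
    by (rule sum.mono_neutral_right) (use z in auto)
  also have "\<dots> = (\<Sum>e\<in>{i..n}. f e y * h ^ (e - i) / fact (e - i))"
    by (rule sum.reindex_bij_witness[of _ "\<lambda>e. e - i" "\<lambda>m. i + m"]) auto
  finally show ?thesis .
qed

lemma sum_triangle_swap:
  fixes F :: "nat \<Rightarrow> nat \<Rightarrow> real"
  shows "(\<Sum>i\<in>{c..n}. \<Sum>e\<in>{i..n}. F i e) = (\<Sum>e\<in>{c..n}. \<Sum>i\<in>{c..e}. F i e)"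
proof -
  have "(\<Sum>i\<in>{c..n}. \<Sum>e\<in>{i..n}. F i e) = (\<Sum>i\<in>{c..n}. \<Sum>e\<in>{e\<in>{c..n}. i \<le> e}. F i e)"
    by (intro sum.cong) auto
  also have "\<dots> = (\<Sum>e\<in>{c..n}. \<Sum>i\<in>{i\<in>{c..n}. i \<le> e}. F i e)"
    by (rule sum.swap_restrict) auto
  also have "\<dots> = (\<Sum>e\<in>{c..n}. \<Sum>i\<in>{c..e}. F i e)"
    by (intro sum.cong) auto
  finally show ?thesis .
qed

text \<open>Expanding around y and resumming with the binomial theorem turns the products s^i
  h^(e-i) into (s + h)^e. Taylor's formula for order i involves only orders e \<ge> i, so the bound
  survives when the orders below c are left out.\<close>

lemma jet_shift_le:
  fixes f :: "nat \<Rightarrow> real \<Rightarrow> real"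
  assumes d: "\<And>i y. (f i has_field_derivative f (Suc i) y) (at y)"
    and z: "\<And>i y. i > n \<Longrightarrow> f i y = 0"
    and s: "0 \<le> s" and h: "\<bar>y' - y\<bar> \<le> h"
  shows "(\<Sum>i\<in>{c..n}. \<bar>f i y'\<bar> * s ^ i / fact i) \<le> (\<Sum>i\<in>{c..n}. \<bar>f i y\<bar> * (s + h) ^ i / fact i)"
proof -
  define k where "k = y' - y"
  have k: "\<bar>k\<bar> \<le> h" and y': "y' = y + k" using h by (auto simp: k_def)
  have "(\<Sum>i\<in>{c..n}. \<bar>f i y'\<bar> * s ^ i / fact i)
      \<le> (\<Sum>i\<in>{c..n}. \<Sum>e\<in>{i..n}. \<bar>f e y\<bar> * \<bar>k\<bar> ^ (e - i) / fact (e - i) * s ^ i / fact i)"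
  proof (rule sum_mono)
    fix i
    have "\<bar>f i y'\<bar> \<le> (\<Sum>e\<in>{i..n}. \<bar>f e y * k ^ (e - i) / fact (e - i)\<bar>)"
      unfolding y' by (subst taylor_vanishing[where f = f and n = n, OF d z]) (assumption | rule sum_abs)+
    then have "\<bar>f i y'\<bar> * (s ^ i / fact i) \<le> (\<Sum>e\<in>{i..n}. \<bar>f e y * k ^ (e - i) / fact (e - i)\<bar>) * (s ^ i / fact i)"
      using s by (intro mult_right_mono) auto
    then show "\<bar>f i y'\<bar> * s ^ i / fact i \<le> (\<Sum>e\<in>{i..n}. \<bar>f e y\<bar> * \<bar>k\<bar> ^ (e - i) / fact (e - i) * s ^ i / fact i)"
      by (simp add: sum_distrib_right sum_divide_distrib abs_mult power_abs)
  qed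
  also have "\<dots> = (\<Sum>e\<in>{c..n}. \<Sum>i\<in>{c..e}. \<bar>f e y\<bar> * \<bar>k\<bar> ^ (e - i) / fact (e - i) * s ^ i / fact i)"
    by (rule sum_triangle_swap)
  also have "\<dots> \<le> (\<Sum>e\<in>{c..n}. \<bar>f e y\<bar> * (s + h) ^ e / fact e)"
  proof (rule sum_mono)
    fix e
    have "(\<Sum>i\<in>{c..e}. \<bar>f e y\<bar> * \<bar>k\<bar> ^ (e - i) / fact (e - i) * s ^ i / fact i)
        = (\<Sum>i\<in>{c..e}. \<bar>f e y\<bar> / fact e * (of_nat (e choose i) * s ^ i * \<bar>k\<bar> ^ (e - i)))"
      by (intro sum.cong refl) (simp add: binomial_fact ac_simps)
    also have "\<dots> \<le> (\<Sum>i\<le>e. \<bar>f e y\<bar> / fact e * (of_nat (e choose i) * s ^ i * \<bar>k\<bar> ^ (e - i)))"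
      by (rule sum_mono2) (use s in auto)
    also have "\<dots> = \<bar>f e y\<bar> / fact e * (s + \<bar>k\<bar>) ^ e"
      by (simp add: binomial_ring sum_distrib_left)
    also have "\<dots> \<le> \<bar>f e y\<bar> / fact e * (s + h) ^ e"
      using s k by (intro mult_left_mono power_mono) auto
    finally show "(\<Sum>i\<in>{c..e}. \<bar>f e y\<bar> * \<bar>k\<bar> ^ (e - i) / fact (e - i) * s ^ i / fact i)
        \<le> \<bar>f e y\<bar> * (s + h) ^ e / fact e" by simp
  qed
  finally show ?thesis .
qed

text \<open>\<open>D a b\<close> stands for \<open>\<partial>\<^sub>x\<^sup>a\<partial>\<^sub>y\<^sup>b H\<close> with \<open>H\<close> a polynomial of degree at most \<open>n\<close> in each variable.  The
  norm with \<open>c = 1\<close> omits the terms without \<open>y\<close>-derivative and so measures the variation in \<open>y\<close>.\<close>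

definition jet_family :: "nat \<Rightarrow> (nat \<Rightarrow> nat \<Rightarrow> real \<Rightarrow> real \<Rightarrow> real) \<Rightarrow> bool" where
  "jet_family n D \<longleftrightarrow>
     (\<forall>a b x y. ((\<lambda>t. D a b t y) has_field_derivative D (Suc a) b x y) (at x)) \<and>
     (\<forall>a b x y. ((\<lambda>t. D a b x t) has_field_derivative D a (Suc b) x y) (at y)) \<and>
     (\<forall>a b x y. a > n \<or> b > n \<longrightarrow> D a b x y = 0)"

definition jet_norm :: "nat \<Rightarrow> (nat \<Rightarrow> nat \<Rightarrow> real \<Rightarrow> real \<Rightarrow> real) \<Rightarrow> nat \<Rightarrow> real \<Rightarrow> real \<Rightarrow> real \<Rightarrow> real" where
  "jet_norm n D c x y s = (\<Sum>a\<in>{0..n}. \<Sum>b\<in>{c..n}. \<bar>D a b x y\<bar> * s ^ (a + b) / (fact a * fact b))"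

text \<open>Exchange of the two variables, derivative orders included; results on oscillation in y
  then serve for x.\<close>

definition flip :: "('a \<Rightarrow> 'a \<Rightarrow> 'b \<Rightarrow> 'b \<Rightarrow> 'c) \<Rightarrow> 'a \<Rightarrow> 'a \<Rightarrow> 'b \<Rightarrow> 'b \<Rightarrow> 'c" where
  "flip D a b x y = D b a y x"

lemma jet_family_flip: "jet_family n D \<Longrightarrow> jet_family n (flip D)"
  by (auto simp: jet_family_def flip_def)

lemma jet_norm_nonneg: "0 \<le> s \<Longrightarrow> 0 \<le> jet_norm n D c x y s"
  by (auto simp: jet_norm_def intro!: sum_nonneg)

lemma jet_norm_flip_0: "jet_norm n (flip D) 0 y x s = jet_norm n D 0 x y s"
  unfolding jet_norm_def flip_def by (subst sum.swap) (simp add: add.commute mult.commute)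

text \<open>Moves the two coordinates one after the other with \<open>jet_shift_le\<close>,
  exchanging the sums in between.\<close>

lemma jet_norm_shift:
  assumes D: "jet_family n D" and s: "0 \<le> s" and hx: "\<bar>x' - x\<bar> \<le> h" and hy: "\<bar>y' - y\<bar> \<le> h"
  shows "jet_norm n D c x' y' s \<le> jet_norm n D c x y (s + h)"
proof -
  have h: "0 \<le> h" using hx by linarith
  have "jet_norm n D c x' y' s = (\<Sum>a\<in>{0..n}. s ^ a / fact a * (\<Sum>b\<in>{c..n}. \<bar>D a b x' y'\<bar> * s ^ b / fact b))"
    by (simp add: jet_norm_def sum_distrib_left power_add field_simps)
  also have "\<dots> \<le> (\<Sum>a\<in>{0..n}. s ^ a / fact a * (\<Sum>b\<in>{c..n}. \<bar>D a b x' y\<bar> * (s + h) ^ b / fact b))"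
    using D s hy unfolding jet_family_def by (intro sum_mono mult_left_mono jet_shift_le) auto
  also have "\<dots> = (\<Sum>b\<in>{c..n}. (s + h) ^ b / fact b * (\<Sum>a\<in>{0..n}. \<bar>D a b x' y\<bar> * s ^ a / fact a))"
    unfolding sum_distrib_left by (subst sum.swap) (intro sum.cong refl, simp add: ac_simps)
  also have "\<dots> \<le> (\<Sum>b\<in>{c..n}. (s + h) ^ b / fact b * (\<Sum>a\<in>{0..n}. \<bar>D a b x y\<bar> * (s + h) ^ a / fact a))"
    using D s h hx unfolding jet_family_def by (intro sum_mono mult_left_mono jet_shift_le) auto
  also have "\<dots> = jet_norm n D c x y (s + h)"
    unfolding jet_norm_def sum_distrib_left
    by (subst sum.swap) (intro sum.cong refl, simp add: power_add ac_simps)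
  finally show ?thesis .
qed

lemma jet_norm_mono: "0 \<le> s \<Longrightarrow> s \<le> s' \<Longrightarrow> jet_norm n D c x y s \<le> jet_norm n D c x y s'"
  unfolding jet_norm_def by (intro sum_mono divide_right_mono mult_left_mono power_mono) auto

lemma jet_norm_1_le_0: "0 \<le> s \<Longrightarrow> jet_norm n D 1 x y s \<le> jet_norm n D 0 x y s"
  unfolding jet_norm_def by (intro sum_mono sum_mono2) auto

lemma jet_norm_scale_up:
  assumes "0 \<le> s" "1 \<le> A"
  shows "jet_norm n D c x y (A * s) \<le> A ^ (2 * n) * jet_norm n D c x y s"
  unfolding jet_norm_def sum_distrib_left
proof (intro sum_mono)
  fix a b assume ab: "a \<in> {0..n}" "b \<in> {c..n}"
  have "\<bar>D a b x y\<bar> * (A * s) ^ (a + b) / (fact a * fact b)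
      = A ^ (a + b) * (\<bar>D a b x y\<bar> * s ^ (a + b) / (fact a * fact b))"
    by (simp add: power_mult_distrib)
  also have "\<dots> \<le> A ^ (2 * n) * (\<bar>D a b x y\<bar> * s ^ (a + b) / (fact a * fact b))"
    using ab assms by (intro mult_right_mono power_increasing) auto
  finally show "\<bar>D a b x y\<bar> * (A * s) ^ (a + b) / (fact a * fact b)
     \<le> A ^ (2 * n) * (\<bar>D a b x y\<bar> * s ^ (a + b) / (fact a * fact b))" .
qed

text \<open>Every term carries at least one power of s because b \<ge> 1. This linear gain is what
  later keeps squares of very different sides from clustering.\<close>

lemma jet_norm_1_scale_down:
  assumes "0 \<le> s" "0 \<le> \<theta>" "\<theta> \<le> 1"
  shows "jet_norm n D 1 x y (\<theta> * s) \<le> \<theta> * jet_norm n D 1 x y s"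
  unfolding jet_norm_def sum_distrib_left
proof (intro sum_mono)
  fix a b assume ab: "a \<in> {0..n}" "b \<in> {1..n}"
  have "\<theta> ^ (a + b) \<le> \<theta> ^ 1" using ab assms by (intro power_decreasing) auto
  then have "\<theta> ^ (a + b) * (\<bar>D a b x y\<bar> * s ^ (a + b) / (fact a * fact b))
      \<le> \<theta> * (\<bar>D a b x y\<bar> * s ^ (a + b) / (fact a * fact b))"
    using assms by (intro mult_right_mono) auto
  then show "\<bar>D a b x y\<bar> * (\<theta> * s) ^ (a + b) / (fact a * fact b)
     \<le> \<theta> * (\<bar>D a b x y\<bar> * s ^ (a + b) / (fact a * fact b))"
    by (simp add: power_mult_distrib algebra_simps)
qed

lemma jet_norm_term_le:
  assumes "0 \<le> s" "a \<le> n" "c \<le> b" "b \<le> n"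
  shows "\<bar>D a b x y\<bar> * s ^ (a + b) / (fact a * fact b) \<le> jet_norm n D c x y s"
proof -
  have "\<bar>D a b x y\<bar> * s ^ (a + b) / (fact a * fact b)
      \<le> (\<Sum>b\<in>{c..n}. \<bar>D a b x y\<bar> * s ^ (a + b) / (fact a * fact b))"
    by (rule member_le_sum[of b "{c..n}" "\<lambda>b. \<bar>D a b x y\<bar> * s ^ (a + b) / (fact a * fact b)"]) (use assms in auto)
  also have "\<dots> \<le> jet_norm n D c x y s"
    unfolding jet_norm_def
    by (rule member_le_sum[of a "{0..n}" "\<lambda>a. \<Sum>b\<in>{c..n}. \<bar>D a b x y\<bar> * s ^ (a + b) / (fact a * fact b)"])
      (use assms in \<open>auto intro!: sum_nonneg\<close>)
  finally show ?thesis .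
qed

text \<open>Splits off the value and sorts the other terms by whether they contain a y-derivative or
  an x-derivative; mixed terms are counted twice.\<close>

lemma jet_norm_0_le:
  assumes "0 \<le> s"
  shows "jet_norm n D 0 x y s \<le> \<bar>D 0 0 x y\<bar> + jet_norm n D 1 x y s + jet_norm n (flip D) 1 y x s"
proof -
  let ?F = "\<lambda>a b. \<bar>D a b x y\<bar> * s ^ (a + b) / (fact a * fact b)"
  have F: "0 \<le> ?F a b" for a b using assms by auto
  have 1: "jet_norm n D 0 x y s = (\<Sum>a\<in>{0..n}. ?F a 0) + jet_norm n D 1 x y s"
    unfolding jet_norm_def by (simp add: sum.atLeast_Suc_atMost sum.distrib)
  have 2: "(\<Sum>a\<in>{0..n}. ?F a 0) = \<bar>D 0 0 x y\<bar> + (\<Sum>a\<in>{1..n}. ?F a 0)"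
    by (simp add: sum.atLeast_Suc_atMost)
  have 3: "jet_norm n (flip D) 1 y x s = (\<Sum>b\<in>{0..n}. \<Sum>a\<in>{1..n}. ?F a b)"
    unfolding jet_norm_def flip_def by (simp add: add.commute mult.commute)
  have 4: "(\<Sum>a\<in>{1..n}. ?F a 0) \<le> (\<Sum>b\<in>{0..n}. \<Sum>a\<in>{1..n}. ?F a b)"
    by (rule member_le_sum[of 0 "{0..n}" "\<lambda>b. \<Sum>a\<in>{1..n}. ?F a b"]) (use F in \<open>auto intro!: sum_nonneg\<close>)
  show ?thesis using 1 2 3 4 by linarith
qed

subsection \<open>Roots near points of large oscillation\<close>

text \<open>Passing to absolute values replaces each linear factor w + X by |w| + \<rho>; the
  induction multiplies by one factor at a time.\<close>

lemma prod_linear_jet_bound: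
  fixes w :: "nat \<Rightarrow> complex"
  assumes "0 \<le> \<rho>"
  shows "(\<Sum>b\<le>m. cmod (coeff (\<Prod>i<m. [:w i, 1:]) b) * \<rho> ^ b) \<le> (\<Prod>i<m. cmod (w i) + \<rho>)"
proof (induction m)
  case 0
  then show ?case by simp
next
  case (Suc m)
  let ?p = "\<Prod>i<m. [:w i, 1:]"
  have deg: "degree ?p \<le> m"
    by (rule order_trans[OF degree_prod_sum_le]) auto
  have c: "coeff (\<Prod>i<Suc m. [:w i, 1:]) b = w m * coeff ?p b + (case b of 0 \<Rightarrow> 0 | Suc b' \<Rightarrow> coeff ?p b')" for b
    by (simp add: mult.commute[of _ "[:w m, 1:]"] coeff_pCons split: nat.splits)
  have "(\<Sum>b\<le>Suc m. cmod (coeff (\<Prod>i<Suc m. [:w i, 1:]) b) * \<rho> ^ b)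
      \<le> (\<Sum>b\<le>Suc m. cmod (w m) * (cmod (coeff ?p b) * \<rho> ^ b)
           + (case b of 0 \<Rightarrow> 0 | Suc b' \<Rightarrow> \<rho> * (cmod (coeff ?p b') * \<rho> ^ b')))"
  proof (rule sum_mono)
    fix b
    have "cmod (coeff (\<Prod>i<Suc m. [:w i, 1:]) b)
        \<le> cmod (w m) * cmod (coeff ?p b) + (case b of 0 \<Rightarrow> 0 | Suc b' \<Rightarrow> cmod (coeff ?p b'))"
      unfolding c by (rule order_trans[OF norm_triangle_ineq]) (simp add: norm_mult split: nat.splits)
    then have "cmod (coeff (\<Prod>i<Suc m. [:w i, 1:]) b) * \<rho> ^ b
        \<le> (cmod (w m) * cmod (coeff ?p b) + (case b of 0 \<Rightarrow> 0 | Suc b' \<Rightarrow> cmod (coeff ?p b'))) * \<rho> ^ b"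
      using assms by (intro mult_right_mono) auto
    then show "cmod (coeff (\<Prod>i<Suc m. [:w i, 1:]) b) * \<rho> ^ b \<le> cmod (w m) * (cmod (coeff ?p b) * \<rho> ^ b)
           + (case b of 0 \<Rightarrow> 0 | Suc b' \<Rightarrow> \<rho> * (cmod (coeff ?p b') * \<rho> ^ b'))"
      by (simp add: algebra_simps split: nat.splits)
  qed
  also have "\<dots> = cmod (w m) * (\<Sum>b\<le>Suc m. cmod (coeff ?p b) * \<rho> ^ b)
      + (\<Sum>b\<le>Suc m. case b of 0 \<Rightarrow> 0 | Suc b' \<Rightarrow> \<rho> * (cmod (coeff ?p b') * \<rho> ^ b'))"
    by (simp only: sum.distrib sum_distrib_left)
  also have "(\<Sum>b\<le>Suc m. cmod (coeff ?p b) * \<rho> ^ b) = (\<Sum>b\<le>m. cmod (coeff ?p b) * \<rho> ^ b)"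
    using deg by (simp add: coeff_eq_0)
  also have "(\<Sum>b\<le>Suc m. case b of 0 \<Rightarrow> 0 | Suc b' \<Rightarrow> \<rho> * (cmod (coeff ?p b') * \<rho> ^ b'))
      = \<rho> * (\<Sum>b\<le>m. cmod (coeff ?p b) * \<rho> ^ b)"
    by (subst sum.atMost_Suc_shift) (simp add: sum_distrib_left)
  also have "cmod (w m) * (\<Sum>b\<le>m. cmod (coeff ?p b) * \<rho> ^ b) + \<rho> * (\<Sum>b\<le>m. cmod (coeff ?p b) * \<rho> ^ b)
      = (cmod (w m) + \<rho>) * (\<Sum>b\<le>m. cmod (coeff ?p b) * \<rho> ^ b)"
    by (simp add: algebra_simps)
  also have "\<dots> \<le> (cmod (w m) + \<rho>) * (\<Prod>i<m. cmod (w i) + \<rho>)"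
    using Suc.IH assms by (intro mult_left_mono) auto
  finally show ?case by (simp add: mult.commute)
qed

text \<open>The Taylor polynomial at y in the increment, read over the complex numbers so that it
  splits into linear factors.\<close>

definition jet_poly :: "nat \<Rightarrow> (nat \<Rightarrow> real \<Rightarrow> real) \<Rightarrow> real \<Rightarrow> complex poly" where
  "jet_poly n f y = (\<Sum>b\<le>n. monom (complex_of_real (f b y / fact b)) b)"

lemma coeff_jet_poly: "coeff (jet_poly n f y) b = (if b \<le> n then complex_of_real (f b y / fact b) else 0)"
  by (simp add: jet_poly_def coeff_sum)

lemma degree_jet_poly: "degree (jet_poly n f y) \<le> n"
  by (rule degree_le) (auto simp: coeff_jet_poly)

lemma poly_jet_poly: "poly (jet_poly n f y) (complex_of_real h) = complex_of_real (\<Sum>b\<le>n. f b y * h ^ b / fact b)"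
  by (simp add: jet_poly_def poly_sum poly_monom)

text \<open>Both sides take the same values at all real increments, and a nonzero polynomial has
  only finitely many roots.\<close>

lemma jet_poly_shift:
  assumes d: "\<And>i y. (f i has_field_derivative f (Suc i) y) (at y)"
    and z: "\<And>i y. i > n \<Longrightarrow> f i y = 0"
  shows "jet_poly n f y = pcompose (jet_poly n f 0) [:complex_of_real y, 1:]"
proof -
  let ?d = "jet_poly n f y - pcompose (jet_poly n f 0) [:complex_of_real y, 1:]"
  have T: "f 0 (t + h) = (\<Sum>b\<le>n. f b t * h ^ b / fact b)" for t h
    using taylor_vanishing[where f = f and n = n, OF d z, of 0 t h] by (simp add: atLeast0AtMost)
  have "poly ?d (complex_of_real h) = 0" for h
  proof -
    have "poly (pcompose (jet_poly n f 0) [:complex_of_real y, 1:]) (complex_of_real h)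
        = poly (jet_poly n f 0) (complex_of_real (y + h))"
      by (simp add: poly_pcompose)
    also have "\<dots> = complex_of_real (f 0 (y + h))"
      unfolding poly_jet_poly using T[of 0 "y + h"] by simp
    also have "\<dots> = poly (jet_poly n f y) (complex_of_real h)"
      unfolding poly_jet_poly T[of y h] ..
    finally show ?thesis by simp
  qed
  then have "range complex_of_real \<subseteq> {x. poly ?d x = 0}" by auto
  moreover have "infinite (range complex_of_real)"
    using inj_of_real infinite_UNIV_char_0 by (metis finite_imageD)
  ultimately have "infinite {x. poly ?d x = 0}" using finite_subset by blast
  then have "?d = 0" using poly_roots_finite by blast
  then show ?thesis by simp
qed

text \<open>If all roots of a polynomial are far from \<open>y\<close> compared with \<open>\<rho>\<close>, factoring it shows that it is
  nearly constant at scale \<open>\<rho>\<close> around \<open>y\<close>.\<close>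

lemma root_near_of_jet:
  assumes d: "\<And>i y. (f i has_field_derivative f (Suc i) y) (at y)"
    and z: "\<And>i y. i > n \<Longrightarrow> f i y = 0"
    and \<rho>: "0 < \<rho>" and A: "1 \<le> A"
    and big: "(\<Sum>b\<in>{1..n}. \<bar>f b y\<bar> * \<rho> ^ b / fact b) > ((1 + 1 / A) ^ n - 1) * \<bar>f 0 y\<bar>"
  shows "jet_poly n f 0 \<noteq> 0 \<and> (\<exists>w. poly (jet_poly n f 0) w = 0 \<and> cmod (w - complex_of_real y) < A * \<rho>)"
proof
  let ?P = "jet_poly n f 0" and ?Q = "jet_poly n f y"
  have QP: "?Q = pcompose ?P [:complex_of_real y, 1:]" by (rule jet_poly_shift[where f = f and n = n, OF d z])
  have cQ: "\<bar>f b y\<bar> / fact b = cmod (coeff ?Q b)" if "b \<le> n" for b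
    using that by (simp add: coeff_jet_poly norm_divide)
  have V: "(\<Sum>b\<in>{1..n}. \<bar>f b y\<bar> * \<rho> ^ b / fact b) = (\<Sum>b\<in>{1..n}. cmod (coeff ?Q b) * \<rho> ^ b)"
    by (intro sum.cong) (auto simp flip: cQ)
  have f0: "\<bar>f 0 y\<bar> = cmod (coeff ?Q 0)" using cQ[of 0] by simp
  have "?Q \<noteq> 0"
  proof
    assume "?Q = 0"
    with big show False unfolding V f0 by simp
  qed
  then show P0: "?P \<noteq> 0" unfolding QP by auto
  show "\<exists>w. poly ?P w = 0 \<and> cmod (w - complex_of_real y) < A * \<rho>"
  proof (rule ccontr)
    assume "\<not> ?thesis"
    then have far: "A * \<rho> \<le> cmod (w - complex_of_real y)" if "poly ?P w = 0" for w
      using that by (meson not_le)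
    obtain root where root: "smult (lead_coeff ?P) (\<Prod>i<degree ?P. [:-root i, 1:]) = ?P"
      by (rule complex_poly_decompose')
    define m where "m = degree ?P"
    define l where "l = lead_coeff ?P"
    define w where "w i = complex_of_real y - root i" for i
    have mn: "m \<le> n" unfolding m_def by (rule degree_jet_poly)
    have "?Q = pcompose (smult l (\<Prod>i<m. [:-root i, 1:])) [:complex_of_real y, 1:]"
      using root QP by (simp add: m_def l_def)
    then have Q: "?Q = smult l (\<Prod>i<m. [:w i, 1:])"
      by (simp add: pcompose_smult pcompose_prod pcompose_pCons w_def)
    have wi: "A * \<rho> \<le> cmod (w i)" if "i < m" for i
    proof -
      have "poly ?P (root i) = 0"
        by (subst root[symmetric]) (use that in \<open>auto simp: poly_prod m_def\<close>)
      then show ?thesis using far[of "root i"] by (simp add: w_def norm_minus_commute)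
    qed
    have c0: "cmod (coeff (\<Prod>i<m. [:w i, 1:]) 0) = (\<Prod>i<m. cmod (w i))"
      by (simp add: poly_0_coeff_0[symmetric] poly_prod prod_norm)
    \<comment> \<open>Far roots mean \<rho> \<le> |w i| / A, so adding \<rho> to a factor enlarges
      it by at most the ratio 1 + 1/A.\<close>
    have prod_le: "(\<Prod>i<m. cmod (w i) + \<rho>) \<le> (1 + 1 / A) ^ n * (\<Prod>i<m. cmod (w i))"
    proof -
      have "(\<Prod>i<m. cmod (w i) + \<rho>) \<le> (\<Prod>i<m. (1 + 1 / A) * cmod (w i))"
      proof (rule prod_mono)
        fix i assume "i \<in> {..<m}"
        then have "\<rho> \<le> cmod (w i) / A" using wi[of i] A by (simp add: field_simps)
        then show "0 \<le> cmod (w i) + \<rho> \<and> cmod (w i) + \<rho> \<le> (1 + 1 / A) * cmod (w i)"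
          using \<rho> by (simp add: algebra_simps)
      qed
      also have "\<dots> = (1 + 1 / A) ^ m * (\<Prod>i<m. cmod (w i))" by (simp add: prod.distrib)
      also have "\<dots> \<le> (1 + 1 / A) ^ n * (\<Prod>i<m. cmod (w i))"
        using mn A by (intro mult_right_mono power_increasing prod_nonneg) auto
      finally show ?thesis .
    qed
    have "(\<Sum>b\<in>{1..n}. cmod (coeff ?Q b) * \<rho> ^ b) = (\<Sum>b\<in>{1..m}. cmod (coeff ?Q b) * \<rho> ^ b)"
    proof (rule sum.mono_neutral_right)
      show "\<forall>i\<in>{1..n} - {1..m}. cmod (coeff ?Q i) * \<rho> ^ i = 0"
      proof
        fix i assume "i \<in> {1..n} - {1..m}"
        then have "degree (\<Prod>i<m. [:w i, 1:]) < i"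
          by (intro le_less_trans[OF degree_prod_sum_le]) auto
        then show "cmod (coeff ?Q i) * \<rho> ^ i = 0" by (simp add: Q coeff_eq_0)
      qed
    qed (use mn in auto)
    also have "\<dots> = cmod l * (\<Sum>b\<in>{1..m}. cmod (coeff (\<Prod>i<m. [:w i, 1:]) b) * \<rho> ^ b)"
      by (simp add: Q norm_mult sum_distrib_left mult.assoc)
    also have "(\<Sum>b\<in>{1..m}. cmod (coeff (\<Prod>i<m. [:w i, 1:]) b) * \<rho> ^ b)
        = (\<Sum>b\<le>m. cmod (coeff (\<Prod>i<m. [:w i, 1:]) b) * \<rho> ^ b) - (\<Prod>i<m. cmod (w i))"
      by (simp add: atMost_atLeast0 sum.atLeast_Suc_atMost c0)
    \<comment> \<open>The full sum of \<open>prod_linear_jet_bound\<close> minus its constant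
      coefficient: the higher orders amount to at most (1 + 1/A)^n - 1 times the constant one,
      contrary to \<open>big\<close>.\<close>
    also have "cmod l * \<dots> \<le> cmod l * ((1 + 1 / A) ^ n * (\<Prod>i<m. cmod (w i)) - (\<Prod>i<m. cmod (w i)))"
      using prod_linear_jet_bound[where \<rho> = \<rho> and m = m and w = w] prod_le \<rho> by (intro mult_left_mono) auto
    also have "\<dots> = ((1 + 1 / A) ^ n - 1) * cmod (coeff ?Q 0)"
      by (simp add: Q norm_mult c0 algebra_simps)
    finally show False using big unfolding V f0 by simp
  qed
qed

lemma exists_power_near_1:
  assumes "0 < c"
  shows "\<exists>A::real. 1 \<le> A \<and> (1 + 1 / A) ^ n - 1 \<le> c"
proof -
  have "(\<lambda>k. (1 + 1 / real (Suc k)) ^ n - 1) \<longlonglongrightarrow> (1 + 0) ^ n - 1"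
    by (intro tendsto_intros LIMSEQ_Suc[OF lim_1_over_n])
  then have "eventually (\<lambda>k. (1 + 1 / real (Suc k)) ^ n - 1 < c) sequentially"
    using assms by (intro order_tendstoD(2)) auto
  then obtain k where "(1 + 1 / real (Suc k)) ^ n - 1 < c" by (auto simp: eventually_sequentially)
  then show ?thesis by (intro exI[of _ "real (Suc k)"]) auto
qed

subsection \<open>Counting dyadic squares\<close>

text \<open>\<open>(g, a, b)\<close> encodes the dyadic square of side \<open>2\<^bsup>-g\<^esup>\<close> with lower left corner \<open>(a, b) / 2\<^sup>g\<close>.\<close>

type_synonym square = "nat \<times> int \<times> int"

definition side :: "nat \<Rightarrow> real" where "side g = 1 / 2 ^ g"

definition ctr :: "nat \<Rightarrow> int \<Rightarrow> real" where "ctr g a = (of_int a + 1 / 2) / 2 ^ g"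

lemma side_pos [simp]: "0 < side g" by (simp add: side_def)

lemma side_nonneg [simp]: "0 \<le> side g" by (simp add: side_def)

lemma side_le_1: "side g \<le> 1" by (simp add: side_def)

lemma side_mono: "g \<le> g' \<Longrightarrow> side g' \<le> side g"
  by (simp add: side_def frac_le)

lemma ctr_floor: "\<bar>x - ctr g \<lfloor>x * 2 ^ g\<rfloor>\<bar> \<le> side g / 2"
proof -
  have "\<bar>x * 2 ^ g - (of_int \<lfloor>x * 2 ^ g\<rfloor> + 1 / 2)\<bar> \<le> 1 / 2" by linarith
  then have "\<bar>x * 2 ^ g - (of_int \<lfloor>x * 2 ^ g\<rfloor> + 1 / 2)\<bar> / 2 ^ g \<le> (1 / 2) / 2 ^ g"
    by (intro divide_right_mono) auto
  moreover have "\<bar>x * 2 ^ g - (of_int \<lfloor>x * 2 ^ g\<rfloor> + 1 / 2)\<bar> / 2 ^ g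
      = \<bar>(x * 2 ^ g - (of_int \<lfloor>x * 2 ^ g\<rfloor> + 1 / 2)) / 2 ^ g\<bar>" by simp
  moreover have "(x * 2 ^ g - (of_int \<lfloor>x * 2 ^ g\<rfloor> + 1 / 2)) / 2 ^ g = x - ctr g \<lfloor>x * 2 ^ g\<rfloor>"
    by (simp add: ctr_def field_simps)
  ultimately show ?thesis by (simp add: side_def)
qed

lemma ints_near:
  fixes t B :: real
  assumes "0 \<le> B"
  shows "finite {b::int. \<bar>of_int b - t\<bar> \<le> B}" "card {b::int. \<bar>of_int b - t\<bar> \<le> B} \<le> nat \<lceil>2 * B + 1\<rceil>"
proof -
  have sub: "{b::int. \<bar>of_int b - t\<bar> \<le> B} \<subseteq> {\<lceil>t - B\<rceil>..\<lfloor>t + B\<rfloor>}"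
    by (auto simp: abs_le_iff le_floor_iff ceiling_le_iff)
  then show "finite {b::int. \<bar>of_int b - t\<bar> \<le> B}" by (rule finite_subset) simp
  have "card {b::int. \<bar>of_int b - t\<bar> \<le> B} \<le> card {\<lceil>t - B\<rceil>..\<lfloor>t + B\<rfloor>}"
    by (rule card_mono[OF _ sub]) simp
  also have "\<dots> = nat (\<lfloor>t + B\<rfloor> - \<lceil>t - B\<rceil> + 1)" by simp
  also have "\<dots> \<le> nat \<lceil>2 * B + 1\<rceil>" by (intro nat_mono) linarith
  finally show "card {b::int. \<bar>of_int b - t\<bar> \<le> B} \<le> nat \<lceil>2 * B + 1\<rceil>" .
qed

lemma near_ctr:
  assumes "\<bar>t - ctr g b\<bar> \<le> B * side g"
  shows "\<bar>of_int b - (t * 2 ^ g - 1 / 2)\<bar> \<le> B"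
proof -
  have "\<bar>t - ctr g b\<bar> * 2 ^ g \<le> B * side g * 2 ^ g" using assms by (intro mult_right_mono) auto
  also have "B * side g * 2 ^ g = B" by (simp add: side_def)
  also have "\<bar>t - ctr g b\<bar> * 2 ^ g = \<bar>(t - ctr g b) * 2 ^ g\<bar>" by (simp add: abs_mult)
  also have "(t - ctr g b) * 2 ^ g = - (of_int b - (t * 2 ^ g - 1 / 2))" by (simp add: ctr_def field_simps)
  finally show ?thesis by (simp only: abs_minus_cancel)
qed

text \<open>The largest square fixes the range of generations: comparable sides leave at most L + 1
  of them. Within one generation only boundedly many squares lie within B sides of the point (s,
  t).\<close>

lemma card_clustered_squares:
  fixes F :: "square set" and B :: real
  assumes B: "0 \<le> B" and fin: "finite F"
    and comp: "\<And>g a b g' a' b'. (g, a, b) \<in> F \<Longrightarrow> (g', a', b') \<in> F \<Longrightarrow> g < g' \<Longrightarrow> side g \<le> K * side g'"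
    and K: "K \<le> 2 ^ L"
    and near: "\<And>g a b. (g, a, b) \<in> F \<Longrightarrow> \<bar>s - ctr g a\<bar> \<le> B * side g \<and> \<bar>t - ctr g b\<bar> \<le> B * side g"
  shows "card F \<le> (L + 1) * (nat \<lceil>2 * B + 1\<rceil>)\<^sup>2"
proof (cases "F = {}")
  case False
  define g0 where "g0 = Min (fst ` F)"
  let ?R = "\<lambda>g. {a::int. \<bar>of_int a - (s * 2 ^ g - 1 / 2)\<bar> \<le> B} \<times> {b::int. \<bar>of_int b - (t * 2 ^ g - 1 / 2)\<bar> \<le> B}"
  have g0: "g0 \<in> fst ` F" unfolding g0_def using fin False by (intro Min_in) auto
  then obtain a0 b0 where Q0: "(g0, a0, b0) \<in> F" by force
  have sub: "F \<subseteq> (\<Union>g\<in>{g0..g0 + L}. Pair g ` ?R g)"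
  proof
    fix Q assume "Q \<in> F"
    then obtain g a b where Q: "Q = (g, a, b)" "(g, a, b) \<in> F" by (cases Q) auto
    have "g0 \<le> g" unfolding g0_def using fin Q by (intro Min_le) force+
    moreover have "g \<le> g0 + L"
    proof (cases "g = g0")
      case neq: False
      with \<open>g0 \<le> g\<close> have lt: "g0 < g" by simp
      have "side g0 \<le> K * side g" by (rule comp[OF Q0 Q(2) lt])
      also have "\<dots> \<le> 2 ^ L * side g" using K by (intro mult_right_mono) auto
      finally have "(2::real) ^ g \<le> 2 ^ (L + g0)" by (simp add: side_def power_add field_simps)
      then show ?thesis by simp
    qed simp
    moreover have "(a, b) \<in> ?R g" using near[OF Q(2)] by (auto intro!: near_ctr)
    ultimately show "Q \<in> (\<Union>g\<in>{g0..g0 + L}. Pair g ` ?R g)" unfolding Q(1) by auto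
  qed
  have finR: "finite (?R g)" for g using ints_near(1)[OF B] by blast
  have cardR: "card (?R g) \<le> (nat \<lceil>2 * B + 1\<rceil>)\<^sup>2" for g
    unfolding card_cartesian_product power2_eq_square by (intro mult_mono ints_near(2) B) auto
  have "card F \<le> card (\<Union>g\<in>{g0..g0 + L}. Pair g ` ?R g)"
    by (rule card_mono[OF _ sub]) (use finR in blast)
  also have "\<dots> \<le> (\<Sum>g\<in>{g0..g0 + L}. card (Pair g ` ?R g))"
    by (rule card_UN_le) simp
  also have "\<dots> \<le> (\<Sum>g\<in>{g0..g0 + L}. (nat \<lceil>2 * B + 1\<rceil>)\<^sup>2)"
    by (intro sum_mono order_trans[OF card_image_le[OF finR] cardR])
  also have "\<dots> = (L + 1) * (nat \<lceil>2 * B + 1\<rceil>)\<^sup>2" by simp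
  finally show ?thesis .
qed simp

text \<open>The last condition is vacuous for distinct squares of equal side; across generations it forces
  members that oscillate near the same point to have comparable sides.\<close>

definition vertical_family ::
    "nat \<Rightarrow> real \<Rightarrow> (nat \<Rightarrow> nat \<Rightarrow> real \<Rightarrow> real \<Rightarrow> real) \<Rightarrow> square set \<Rightarrow> bool" where
  "vertical_family n C D F \<longleftrightarrow> finite F \<and>
     (\<forall>g a b. (g, a, b) \<in> F \<longrightarrow> 0 < jet_norm n D 1 (ctr g a) (ctr g b) (7 * side g)) \<and>
     (\<forall>g a b g' a' b'. (g, a, b) \<in> F \<longrightarrow> (g', a', b') \<in> F \<longrightarrow> g < g' \<or> (g, a, b) = (g', a', b') \<longrightarrow>
        jet_norm n D 0 (ctr g a) (ctr g b) (11 * side g)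
          \<le> C * jet_norm n D 1 (ctr g' a') (ctr g' b') (7 * side g'))"

text \<open>For g < g' the oscillation of the smaller square, carried over (s, t) to the larger one,
  is at most side g' / side g times the total norm there, by linear scaling;
  \<open>vertical_family\<close> bounds that total norm by C times the same oscillation. Hence the
  sides differ by at most the factor C. The 25 is 5^2 with 5 = 2 * 2 + 1 integers within distance
  2.\<close>

lemma count_near_point:
  assumes D: "jet_family n D" and F: "vertical_family n C D F" and K: "C \<le> 2 ^ L"
  shows "card {(g, a, b). (g, a, b) \<in> F \<and> \<bar>s - ctr g a\<bar> \<le> 2 * side g \<and> \<bar>t - ctr g b\<bar> \<le> 2 * side g}
    \<le> (L + 1) * 25" (is "card ?S \<le> _")
proof -
  have "card ?S \<le> (L + 1) * (nat \<lceil>2 * 2 + 1 :: real\<rceil>)\<^sup>2"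
  proof (rule card_clustered_squares[of 2 ?S C L s t])
    show "finite ?S" by (rule finite_subset[of _ F]) (use F in \<open>auto simp: vertical_family_def\<close>)
  next
    fix g a b g' a' b'
    assume Q: "(g, a, b) \<in> ?S" "(g', a', b') \<in> ?S" and lt: "g < g'"
    let ?V = "jet_norm n D 1 (ctr g' a') (ctr g' b') (7 * side g')"
    have V: "0 < ?V" using F Q by (auto simp: vertical_family_def)
    have T: "jet_norm n D 0 (ctr g a) (ctr g b) (11 * side g) \<le> C * ?V"
      using F Q lt by (auto simp: vertical_family_def)
    have "?V \<le> jet_norm n D 1 s t (7 * side g' + 2 * side g')"
      using Q by (intro jet_norm_shift[OF D]) (auto simp: abs_minus_commute)
    also have "7 * side g' + 2 * side g' = (side g' / side g) * (9 * side g)"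
      using side_pos[of g] by (simp add: field_simps del: side_pos)
    also have "jet_norm n D 1 s t \<dots> \<le> (side g' / side g) * jet_norm n D 1 s t (9 * side g)"
      using side_mono[of g g'] lt by (intro jet_norm_1_scale_down) auto
    also have "\<dots> \<le> (side g' / side g) * jet_norm n D 1 (ctr g a) (ctr g b) (9 * side g + 2 * side g)"
      using Q by (intro mult_left_mono jet_norm_shift[OF D]) auto
    also have "\<dots> \<le> (side g' / side g) * jet_norm n D 0 (ctr g a) (ctr g b) (9 * side g + 2 * side g)"
      by (intro mult_left_mono jet_norm_1_le_0) auto
    also have "9 * side g + 2 * side g = 11 * side g" by simp
    also have "(side g' / side g) * jet_norm n D 0 (ctr g a) (ctr g b) (11 * side g) \<le> (side g' / side g) * (C * ?V)"
      using T by (intro mult_left_mono) auto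
    finally have "?V * 1 \<le> ?V * (side g' / side g * C)" by (simp add: ac_simps)
    then have "1 \<le> side g' / side g * C" using V by (simp only: mult_le_cancel_left_pos)
    then show "side g \<le> C * side g'" using side_pos[of g] by (simp add: field_simps del: side_pos)
  qed (use K in auto)
  then show ?thesis by simp
qed

text \<open>The zero polynomial is assigned no roots, so that the bound n on their number holds
  throughout; \<open>root_near_of_jet\<close> always supplies a nonzero polynomial.\<close>

definition jet_roots :: "nat \<Rightarrow> (nat \<Rightarrow> real \<Rightarrow> real) \<Rightarrow> complex set" where
  "jet_roots n f = (if jet_poly n f 0 = 0 then {} else {w. poly (jet_poly n f 0) w = 0})"

lemma jet_roots_card: "finite (jet_roots n f)" "card (jet_roots n f) \<le> n"
  using card_poly_roots_bound[of "jet_poly n f 0"] degree_jet_poly[of n f 0] poly_roots_finite[of "jet_poly n f 0"]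
  by (auto simp: jet_roots_def)

lemma jet_norm_slices:
  "jet_norm n D c x y s = (\<Sum>k\<in>{0..n}. s ^ k / fact k * (\<Sum>b\<in>{c..n}. \<bar>D k b x y\<bar> * s ^ b / fact b))"
  by (simp add: jet_norm_def sum_distrib_left power_add field_simps)

text \<open>Over a fixed \<open>x\<close>, every square of the family has a root of some \<open>\<partial>\<^sub>x\<^sup>k H(x, \<cdot>)\<close> at a distance
  comparable to its side, and squares sharing \<open>k\<close> and the root have comparable sides.\<close>

lemma count_on_line:
  assumes C: "1 \<le> C"
  shows "\<exists>N::nat. \<forall>D F (x::real). jet_family n D \<longrightarrow> vertical_family n C D F \<longrightarrow>
           card {(g, a, b). (g, a, b) \<in> F \<and> a = \<lfloor>x * 2 ^ g\<rfloor>} \<le> N"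
proof -
  \<comment> \<open>Combines the constant of the family with a pigeonhole over the n + 1 orders k:
    at the chosen k the value is at most 1/c times the oscillation. Using only half of
    \<open>c\<close> makes the inequality for \<open>root_near_of_jet\<close> strict.\<close>
  define c where "c = 1 / (C * (real n + 1))"
  have c: "0 < c" using C by (simp add: c_def)
  obtain A :: real where A: "1 \<le> A" "(1 + 1 / A) ^ n - 1 \<le> c / 2"
    using exists_power_near_1[of "c / 2" n] c by auto
  \<comment> \<open>The power of 1 + 2A pays for moving between two centres near the same root, C (n
    + 1) for the family condition and the pigeonhole.\<close>
  define K where "K = (1 + 2 * A) ^ n * (C * (real n + 1))"
  obtain L :: nat where L: "K \<le> 2 ^ L" using real_arch_pow[of 2 K] by (auto intro: less_imp_le)
  define N where "N = (n + 1) * (n * ((L + 1) * (nat \<lceil>2 * (8 * A) + 1\<rceil>)\<^sup>2))"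
  have "card {(g, a, b). (g, a, b) \<in> F \<and> a = \<lfloor>x * 2 ^ g\<rfloor>} \<le> N"
    if D: "jet_family n D" and F: "vertical_family n C D F" for D F and x :: real
  proof -
    define S where "S = {(g, a, b). (g, a, b) \<in> F \<and> a = \<lfloor>x * 2 ^ g\<rfloor>}"
    have finS: "finite S" unfolding S_def
      by (rule finite_subset[of _ F]) (use F in \<open>auto simp: vertical_family_def\<close>)
    define f where "f k b = D k b x" for k b
    have df: "(f k b has_field_derivative f k (Suc b) y) (at y)" for k b y
      using D by (simp add: f_def jet_family_def)
    have zf: "f k b y = 0" if "b > n" for k b y using D that by (simp add: f_def jet_family_def)
    define v where "v k c y s = (\<Sum>b\<in>{c..n}. \<bar>f k b y\<bar> * s ^ b / fact b)" for k y s and c :: nat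
    define V where "V g a b = jet_norm n D 1 (ctr g a) (ctr g b) (7 * side g)" for g a b
    \<comment> \<open>The distance from x to the centre is absorbed in passing from scale 8 to scale
      11, so a single slice on the line over x is controlled by the norm of the square
      itself.\<close>
    have T_le: "(8 * side g) ^ k / fact k * v k c (ctr g b) (8 * side g) \<le> C * V g' a' b'"
      if Q: "(g, a, b) \<in> S" "(g', a', b') \<in> S" and gg: "g < g' \<or> (g, a, b) = (g', a', b')" and k: "k \<le> n"
        and c: "c \<le> 1" for g a b g' a' b' k c
    proof -
      have xa: "\<bar>x - ctr g a\<bar> \<le> side g / 2" using ctr_floor Q by (auto simp: S_def)
      have "v k c (ctr g b) (8 * side g) \<le> v k 0 (ctr g b) (8 * side g)"
        unfolding v_def by (rule sum_mono2) auto
      then have "(8 * side g) ^ k / fact k * v k c (ctr g b) (8 * side g)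
          \<le> (8 * side g) ^ k / fact k * v k 0 (ctr g b) (8 * side g)"
        by (intro mult_left_mono) auto
      also have "\<dots> \<le> jet_norm n D 0 x (ctr g b) (8 * side g)"
        unfolding jet_norm_slices v_def f_def
        by (rule member_le_sum[of k "{0..n}"]) (use k in \<open>auto intro!: divide_nonneg_nonneg mult_nonneg_nonneg sum_nonneg\<close>)
      also have "\<dots> \<le> jet_norm n D 0 (ctr g a) (ctr g b) (8 * side g + 3 * side g)"
        using xa side_nonneg[of g] by (intro jet_norm_shift[OF D]) (linarith | simp)+
      also have "8 * side g + 3 * side g = 11 * side g" by simp
      also have "jet_norm n D 0 (ctr g a) (ctr g b) (11 * side g) \<le> C * V g' a' b'"
        using F Q gg unfolding vertical_family_def S_def V_def by blast
      finally show ?thesis .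
    qed
    \<comment> \<open>The oscillation is a sum over the order k of x-derivatives. Some k carries a
      share of at least 1/(n + 1); for this k the value is controlled by the oscillation, which
      forces a root nearby.\<close>
    have key: "\<exists>k\<le>n. \<exists>w\<in>jet_roots n (f k). cmod (w - complex_of_real (ctr g b)) < A * (8 * side g) \<and>
        V g a b / (real n + 1) \<le> (8 * side g) ^ k / fact k * v k 1 (ctr g b) (8 * side g)"
      if Q: "(g, a, b) \<in> S" for g a b
    proof -
      let ?w = "\<lambda>k. (8 * side g) ^ k / fact k * v k 1 (ctr g b) (8 * side g)"
      have Vpos: "0 < V g a b" using F Q by (auto simp: vertical_family_def S_def V_def)
      have xa: "\<bar>x - ctr g a\<bar> \<le> side g / 2" using ctr_floor Q by (auto simp: S_def)
      have "V g a b \<le> jet_norm n D 1 x (ctr g b) (7 * side g + side g)"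
        unfolding V_def using xa side_nonneg[of g] by (intro jet_norm_shift[OF D]) (linarith | simp)+
      also have "\<dots> = (\<Sum>k\<in>{0..n}. ?w k)"
        unfolding jet_norm_slices v_def f_def by simp
      finally have sum: "V g a b \<le> (\<Sum>k\<in>{0..n}. ?w k)" .
      have "\<exists>k\<in>{0..n}. V g a b / (real n + 1) \<le> ?w k"
      proof (rule ccontr)
        assume "\<not> ?thesis"
        then have "(\<Sum>k\<in>{0..n}. ?w k) < (\<Sum>k\<in>{0..n}. V g a b / (real n + 1))"
          by (intro sum_strict_mono) (auto simp: not_le)
        also have "\<dots> = V g a b" by (simp add: field_simps)
        finally show False using sum by simp
      qed
      then obtain k where k: "k \<le> n" "V g a b / (real n + 1) \<le> ?w k" by auto
      have wpos: "0 < ?w k" using k Vpos by (intro less_le_trans[OF _ k(2)]) auto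
      have vpos: "0 < v k 1 (ctr g b) (8 * side g)" by (rule zero_less_mult_pos[OF wpos]) simp
      have "\<bar>f k 0 (ctr g b)\<bar> \<le> v k 0 (ctr g b) (8 * side g)"
        unfolding v_def using member_le_sum[of 0 "{0..n}" "\<lambda>b'. \<bar>f k b' (ctr g b)\<bar> * (8 * side g) ^ b' / fact b'"] by auto
      then have "(8 * side g) ^ k / fact k * \<bar>f k 0 (ctr g b)\<bar> \<le> (8 * side g) ^ k / fact k * v k 0 (ctr g b) (8 * side g)"
        by (intro mult_left_mono) auto
      also have "\<dots> \<le> C * V g a b" by (rule T_le[OF Q Q _ k(1)]) auto
      also have "\<dots> \<le> C * ((real n + 1) * ?w k)"
        using k(2) C by (intro mult_left_mono) (auto simp: field_simps)
      also have "\<dots> = (8 * side g) ^ k / fact k * (C * (real n + 1) * v k 1 (ctr g b) (8 * side g))"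
        by (simp add: ac_simps)
      finally have "\<bar>f k 0 (ctr g b)\<bar> \<le> C * (real n + 1) * v k 1 (ctr g b) (8 * side g)"
        by (rule mult_left_le_imp_le) simp
      then have "c * \<bar>f k 0 (ctr g b)\<bar> \<le> v k 1 (ctr g b) (8 * side g)"
        using C by (simp add: c_def pos_divide_le_eq mult.commute)
      then have "((1 + 1 / A) ^ n - 1) * \<bar>f k 0 (ctr g b)\<bar> < v k 1 (ctr g b) (8 * side g)"
        using A(2) vpos mult_right_mono[OF A(2), of "\<bar>f k 0 (ctr g b)\<bar>"] by linarith
      from root_near_of_jet[where f = "f k" and n = n, OF df zf _ A(1) this[unfolded v_def]]
      show ?thesis using k by (auto simp: jet_roots_def intro!: exI[of _ k])
    qed
    \<comment> \<open>Squares that use the same order k and the same root w. The share of the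
      oscillation is recorded along with the proximity because it is needed to compare
      sides.\<close>
    define Fib where "Fib k w = {(g, a, b). (g, a, b) \<in> S \<and> cmod (w - complex_of_real (ctr g b)) < A * (8 * side g) \<and>
        V g a b / (real n + 1) \<le> (8 * side g) ^ k / fact k * v k 1 (ctr g b) (8 * side g)}" for k w
    have FibS: "Fib k w \<subseteq> S" for k w by (auto simp: Fib_def)
    have S_sub: "S \<subseteq> (\<Union>k\<in>{0..n}. \<Union>w\<in>jet_roots n (f k). Fib k w)"
    proof
      fix Q assume "Q \<in> S"
      then obtain g a b where Q: "Q = (g, a, b)" "(g, a, b) \<in> S" by (cases Q) auto
      from key[OF Q(2)] obtain k w where "k \<le> n" "w \<in> jet_roots n (f k)" "(g, a, b) \<in> Fib k w"
        using Q(2) unfolding Fib_def by blast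
      then show "Q \<in> (\<Union>k\<in>{0..n}. \<Union>w\<in>jet_roots n (f k). Fib k w)"
        unfolding Q(1) by force
    qed
    have cardFib: "card (Fib k w) \<le> (L + 1) * (nat \<lceil>2 * (8 * A) + 1\<rceil>)\<^sup>2" if k: "k \<le> n" for k w
    proof (rule card_clustered_squares[of "8 * A" "Fib k w" K L x "Re w"])
      show "finite (Fib k w)" using finite_subset[OF FibS finS] .
      show "0 \<le> 8 * A" using A by simp
    next
      fix g a b g' a' b'
      assume Q: "(g, a, b) \<in> Fib k w" and Q': "(g', a', b') \<in> Fib k w" and lt: "g < g'"
      let ?r = "8 * side g" and ?r' = "8 * side g'"
      have QS: "(g, a, b) \<in> S" "(g', a', b') \<in> S" using Q Q' by (auto simp: Fib_def)
      have Vpos: "0 < V g' a' b'" using F QS by (auto simp: vertical_family_def S_def V_def)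
      have ratio: "0 \<le> side g' / side g" "side g' / side g \<le> 1" using side_mono[of g g'] lt by auto
      have "\<bar>ctr g' b' - ctr g b\<bar> = cmod (complex_of_real (ctr g' b') - complex_of_real (ctr g b))"
        by (simp flip: of_real_diff)
      also have "\<dots> \<le> cmod (w - complex_of_real (ctr g' b')) + cmod (w - complex_of_real (ctr g b))"
        using norm_triangle_ineq4[of "w - complex_of_real (ctr g b)" "w - complex_of_real (ctr g' b')"]
        by (simp add: add.commute)
      also have "\<dots> \<le> A * ?r' + A * ?r" using Q Q' by (auto simp: Fib_def)
      also have "\<dots> \<le> A * ?r + A * ?r"
        using side_mono[of g g'] lt A by (intro add_mono mult_left_mono) auto
      finally have near: "\<bar>ctr g' b' - ctr g b\<bar> \<le> 2 * A * ?r" by simp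
      \<comment> \<open>The comparison used near a point, now in the variable y alone: linear
        shrinking from the larger to the smaller scale, then a move between centres at distance at
        most 2A times the larger scale.\<close>
      have s1: "v k 1 (ctr g' b') ?r' \<le> side g' / side g * v k 1 (ctr g' b') ?r"
        unfolding v_def sum_distrib_left
      proof (rule sum_mono)
        fix i assume i: "i \<in> {1..n}"
        have "?r' = side g' / side g * ?r" by (simp add: side_def)
        then have "?r' ^ i = (side g' / side g) ^ i * ?r ^ i" by (metis power_mult_distrib)
        also have "\<dots> \<le> (side g' / side g) ^ 1 * ?r ^ i"
          using i ratio by (intro mult_right_mono power_decreasing) auto
        finally have "\<bar>f k i (ctr g' b')\<bar> / fact i * ?r' ^ i \<le> \<bar>f k i (ctr g' b')\<bar> / fact i * ((side g' / side g) ^ 1 * ?r ^ i)"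
          by (intro mult_left_mono) auto
        then show "\<bar>f k i (ctr g' b')\<bar> * ?r' ^ i / fact i \<le> side g' / side g * (\<bar>f k i (ctr g' b')\<bar> * ?r ^ i / fact i)"
          by (simp add: ac_simps)
      qed
      have s2: "v k 1 (ctr g' b') ?r \<le> v k 0 (ctr g' b') ?r"
        unfolding v_def by (rule sum_mono2) auto
      have s3: "v k 0 (ctr g' b') ?r \<le> v k 0 (ctr g b) (?r + 2 * A * ?r)"
        unfolding v_def by (rule jet_shift_le[where f = "f k" and n = n, OF df zf _ near]) auto
      have s4: "v k 0 (ctr g b) (?r + 2 * A * ?r) \<le> (1 + 2 * A) ^ n * v k 0 (ctr g b) ?r"
        unfolding v_def sum_distrib_left
      proof (rule sum_mono)
        fix i assume i: "i \<in> {0..n}"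
        have "?r + 2 * A * ?r = (1 + 2 * A) * ?r" by (simp add: algebra_simps)
        then have "(?r + 2 * A * ?r) ^ i = (1 + 2 * A) ^ i * ?r ^ i" by (simp only: power_mult_distrib)
        also have "\<dots> \<le> (1 + 2 * A) ^ n * ?r ^ i"
          using i A by (intro mult_right_mono power_increasing) auto
        finally have "\<bar>f k i (ctr g b)\<bar> / fact i * (?r + 2 * A * ?r) ^ i
            \<le> \<bar>f k i (ctr g b)\<bar> / fact i * ((1 + 2 * A) ^ n * ?r ^ i)"
          by (intro mult_left_mono) auto
        then show "\<bar>f k i (ctr g b)\<bar> * (?r + 2 * A * ?r) ^ i / fact i
            \<le> (1 + 2 * A) ^ n * (\<bar>f k i (ctr g b)\<bar> * ?r ^ i / fact i)" by (simp add: ac_simps)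
      qed
      have "v k 1 (ctr g' b') ?r \<le> (1 + 2 * A) ^ n * v k 0 (ctr g b) ?r" using s2 s3 s4 by linarith
      from order_trans[OF s1 mult_left_mono[OF this ratio(1)]]
      have v_le: "v k 1 (ctr g' b') ?r' \<le> side g' / side g * ((1 + 2 * A) ^ n * v k 0 (ctr g b) ?r)" .
      have "V g' a' b' / (real n + 1) \<le> ?r' ^ k / fact k * v k 1 (ctr g' b') ?r'"
        using Q' by (auto simp: Fib_def)
      also have "\<dots> \<le> ?r ^ k / fact k * v k 1 (ctr g' b') ?r'"
        using side_mono[of g g'] lt unfolding v_def
        by (intro mult_right_mono divide_right_mono power_mono sum_nonneg) auto
      also have "\<dots> \<le> ?r ^ k / fact k * (side g' / side g * ((1 + 2 * A) ^ n * v k 0 (ctr g b) ?r))"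
        using v_le by (intro mult_left_mono) auto
      also have "\<dots> = side g' / side g * ((1 + 2 * A) ^ n * (?r ^ k / fact k * v k 0 (ctr g b) ?r))"
        by (simp add: ac_simps)
      also have "\<dots> \<le> side g' / side g * ((1 + 2 * A) ^ n * (C * V g' a' b'))"
        using T_le[OF QS _ k, of 0] lt A ratio by (intro mult_left_mono) auto
      finally have "V g' a' b' * 1 \<le> V g' a' b' * (side g' / side g * K)"
        by (simp add: K_def field_simps)
      then have "1 \<le> side g' / side g * K" using Vpos by (simp only: mult_le_cancel_left_pos)
      then show "side g \<le> K * side g'" using side_pos[of g] by (simp add: field_simps del: side_pos)
    next
      fix g a b assume Q: "(g, a, b) \<in> Fib k w"
      have "\<bar>x - ctr g a\<bar> \<le> side g / 2" using ctr_floor Q by (auto simp: Fib_def S_def)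
      also have "\<dots> \<le> 8 * A * side g" using mult_right_mono[of "1 / 2" "8 * A" "side g"] A(1) by simp
      finally have 1: "\<bar>x - ctr g a\<bar> \<le> 8 * A * side g" .
      have "\<bar>Re w - ctr g b\<bar> \<le> cmod (w - complex_of_real (ctr g b))"
        using abs_Re_le_cmod[of "w - complex_of_real (ctr g b)"] by simp
      also have "\<dots> \<le> 8 * A * side g" using Q by (auto simp: Fib_def)
      finally show "\<bar>x - ctr g a\<bar> \<le> 8 * A * side g \<and> \<bar>Re w - ctr g b\<bar> \<le> 8 * A * side g" using 1 by simp
    qed (rule L)
    have "card S \<le> card (\<Union>k\<in>{0..n}. \<Union>w\<in>jet_roots n (f k). Fib k w)"
      by (rule card_mono[OF _ S_sub]) (use finite_subset[OF FibS finS] jet_roots_card(1) in blast)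
    also have "\<dots> \<le> (\<Sum>k\<in>{0..n}. card (\<Union>w\<in>jet_roots n (f k). Fib k w))"
      by (rule card_UN_le) simp
    also have "\<dots> \<le> (\<Sum>k\<in>{0..n}. \<Sum>w\<in>jet_roots n (f k). card (Fib k w))"
      by (intro sum_mono card_UN_le jet_roots_card)
    also have "\<dots> \<le> (\<Sum>k\<in>{0..n}. \<Sum>w\<in>jet_roots n (f k). (L + 1) * (nat \<lceil>2 * (8 * A) + 1\<rceil>)\<^sup>2)"
      by (intro sum_mono cardFib) auto
    also have "\<dots> \<le> (\<Sum>k\<in>{0..n}. n * ((L + 1) * (nat \<lceil>2 * (8 * A) + 1\<rceil>)\<^sup>2))"
      by (intro sum_mono) (simp only: sum_constant mult_le_mono1[OF jet_roots_card(2)] of_nat_id)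
    also have "\<dots> = N" by (simp add: N_def)
    finally show ?thesis unfolding S_def .
  qed
  then show ?thesis by blast
qed

subsection \<open>Fubini and the identity behind the \<open>TT\<^sup>*\<close> method\<close>

lemma integrable_bounded_support:
  fixes f :: "'a::euclidean_space \<Rightarrow> 'b::{banach, second_countable_topology}"
  assumes [measurable]: "f \<in> borel_measurable borel"
    and B: "\<And>x. norm (f x) \<le> B" and S: "bounded {x. f x \<noteq> 0}"
  shows "integrable lborel f"
proof -
  obtain r where r: "{x. f x \<noteq> 0} \<subseteq> cball 0 r" using bounded_subset_ballD[OF S, of 0] ball_subset_cball by fast
  show ?thesis
  proof (rule integrableI_bounded_set[where A = "cball 0 r" and B = B])
    show "emeasure lborel (cball (0::'a) r) < \<infinity>" by (rule emeasure_lborel_cball_finite)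
    show "AE x in lborel. x \<in> cball 0 r \<longrightarrow> norm (f x) \<le> B" using B by simp
    show "AE x in lborel. x \<notin> cball 0 r \<longrightarrow> f x = 0" using r by (intro AE_I2) blast
  qed simp_all
qed

lemma Cauchy_Schwarz_integral:
  fixes f g :: "'a \<Rightarrow> real"
  assumes f: "integrable M (\<lambda>x. (f x)\<^sup>2)" "f \<in> borel_measurable M"
    and g: "integrable M (\<lambda>x. (g x)\<^sup>2)" "g \<in> borel_measurable M"
  shows "integrable M (\<lambda>x. f x * g x)"
    and "(LINT x|M. \<bar>f x * g x\<bar>) \<le> sqrt (LINT x|M. (f x)\<^sup>2) * sqrt (LINT x|M. (g x)\<^sup>2)"
proof -
  note [measurable] = f(2) g(2)
  show int: "integrable M (\<lambda>x. f x * g x)"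
  proof (rule Bochner_Integration.integrable_bound[OF Bochner_Integration.integrable_add[OF f(1) g(1)]])
    show "AE x in M. norm (f x * g x) \<le> norm ((f x)\<^sup>2 + (g x)\<^sup>2)"
    proof (rule AE_I2)
      fix x
      have "2 * \<bar>f x\<bar> * \<bar>g x\<bar> \<le> \<bar>f x\<bar>\<^sup>2 + \<bar>g x\<bar>\<^sup>2" by (rule sum_squares_bound)
      moreover have "0 \<le> \<bar>f x\<bar> * \<bar>g x\<bar>" by simp
      ultimately have "\<bar>f x\<bar> * \<bar>g x\<bar> \<le> (f x)\<^sup>2 + (g x)\<^sup>2" unfolding mult.assoc power2_abs by linarith
      then show "norm (f x * g x) \<le> norm ((f x)\<^sup>2 + (g x)\<^sup>2)" by (simp add: abs_mult)
    qed
  qed simp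
  have e1: "(\<integral>\<^sup>+x. ennreal \<bar>f x\<bar> ^ 2 \<partial>M) = ennreal (LINT x|M. (f x)\<^sup>2)"
    using f(1) by (subst nn_integral_eq_integral[symmetric]) (auto simp: ennreal_power)
  have e2: "(\<integral>\<^sup>+x. ennreal \<bar>g x\<bar> ^ 2 \<partial>M) = ennreal (LINT x|M. (g x)\<^sup>2)"
    using g(1) by (subst nn_integral_eq_integral[symmetric]) (auto simp: ennreal_power)
  have e3: "(\<integral>\<^sup>+x. ennreal \<bar>f x\<bar> * ennreal \<bar>g x\<bar> \<partial>M) = ennreal (LINT x|M. \<bar>f x * g x\<bar>)"
    using nn_integral_eq_integral[OF integrable_abs[OF int]] by (simp add: ennreal_mult[symmetric] abs_mult)
  have "(ennreal (LINT x|M. \<bar>f x * g x\<bar>))\<^sup>2 \<le> ennreal (LINT x|M. (f x)\<^sup>2) * ennreal (LINT x|M. (g x)\<^sup>2)"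
    using Cauchy_Schwarz_nn_integral[of "\<lambda>x. ennreal \<bar>f x\<bar>" M "\<lambda>x. ennreal \<bar>g x\<bar>"]
    unfolding e1 e2 e3 by simp
  then have "(LINT x|M. \<bar>f x * g x\<bar>)\<^sup>2 \<le> (LINT x|M. (f x)\<^sup>2) * (LINT x|M. (g x)\<^sup>2)"
    by (simp add: ennreal_power ennreal_mult[symmetric])
  then show "(LINT x|M. \<bar>f x * g x\<bar>) \<le> sqrt (LINT x|M. (f x)\<^sup>2) * sqrt (LINT x|M. (g x)\<^sup>2)"
    by (simp add: real_le_rsqrt flip: real_sqrt_mult)
qed

lemma lborel_fubini:
  fixes f :: "'a::euclidean_space \<times> 'b::euclidean_space \<Rightarrow> 'c::{banach, second_countable_topology}"
  assumes "integrable lborel f"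
  shows "(LINT z|lborel. f z) = (LINT x|lborel. LINT y|lborel. f (x, y))"
    and "(LINT z|lborel. f z) = (LINT y|lborel. LINT x|lborel. f (x, y))"
    and "integrable lborel (\<lambda>x. LINT y|lborel. f (x, y))"
    and "integrable lborel (\<lambda>y. LINT x|lborel. f (x, y))"
proof -
  interpret lborel_pair: pair_sigma_finite "lborel :: 'a measure" "lborel :: 'b measure" ..
  have i: "integrable (lborel \<Otimes>\<^sub>M lborel) (case_prod (\<lambda>x y. f (x, y)))"
    using assms by (simp add: lborel_prod)
  show "(LINT z|lborel. f z) = (LINT x|lborel. LINT y|lborel. f (x, y))"
    using lborel_pair.integral_fst[OF i] by (simp add: lborel_prod)
  show "(LINT z|lborel. f z) = (LINT y|lborel. LINT x|lborel. f (x, y))"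
    using lborel_pair.integral_snd[OF i] by (simp add: lborel_prod)
  show "integrable lborel (\<lambda>x. LINT y|lborel. f (x, y))"
    using lborel_pair.integrable_fst[OF i] by simp
  show "integrable lborel (\<lambda>y. LINT x|lborel. f (x, y))"
    using lborel_pair.integrable_snd[OF i] by simp
qed

lemma lborel_translate:
  fixes f :: "real \<Rightarrow> 'a::{banach, second_countable_topology}"
  shows "(LINT x|lborel. f (x + t)) = (LINT x|lborel. f x)" "(LINT x|lborel. f (t + x)) = (LINT x|lborel. f x)"
  using lborel_integral_real_affine[of 1 f t] by (simp_all add: add.commute)

lemma integrable_translate:
  fixes f :: "real \<Rightarrow> 'a::{banach, second_countable_topology}"
  assumes "integrable lborel f"
  shows "integrable lborel (\<lambda>x. f (x + t))" "integrable lborel (\<lambda>x. f (t + x))"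
  using lborel_integrable_real_affine[OF assms, of 1 t] by (simp_all add: add.commute)

lemma bounded_3_box:
  fixes S :: "(real \<times> real \<times> real) set"
  assumes "\<And>x y z. (x, y, z) \<in> S \<Longrightarrow> \<bar>x\<bar> \<le> A \<and> \<bar>y\<bar> \<le> A \<and> \<bar>z\<bar> \<le> A"
  shows "bounded S"
proof (rule bounded_subset)
  show "S \<subseteq> cbox (- A) A \<times> cbox (- A) A \<times> cbox (- A) A"
  proof
    fix p assume "p \<in> S"
    then show "p \<in> cbox (- A) A \<times> cbox (- A) A \<times> cbox (- A) A"
      using assms[of "fst p" "fst (snd p)" "snd (snd p)"] by (auto simp: mem_Times_iff abs_le_iff)
  qed
  show "bounded (cbox (- A) A \<times> cbox (- A) A \<times> cbox (- A) A)"
    by (intro bounded_Times bounded_cbox)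
qed

lemma bounded_2_box:
  fixes S :: "(real \<times> real) set"
  assumes "\<And>x y. (x, y) \<in> S \<Longrightarrow> \<bar>x\<bar> \<le> A \<and> \<bar>y\<bar> \<le> A"
  shows "bounded S"
proof (rule bounded_subset)
  show "S \<subseteq> cbox (- A) A \<times> cbox (- A) A"
  proof
    fix p assume "p \<in> S"
    then show "p \<in> cbox (- A) A \<times> cbox (- A) A"
      using assms[of "fst p" "snd p"] by (auto simp: mem_Times_iff abs_le_iff)
  qed
  show "bounded (cbox (- A) A \<times> cbox (- A) A)"
    by (intro bounded_Times bounded_cbox)
qed

lemma bounded_1_box:
  fixes S :: "real set"
  assumes "\<And>x. x \<in> S \<Longrightarrow> \<bar>x\<bar> \<le> A"
  shows "bounded S"
  using assms by (auto simp: bounded_iff)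

lemma borel_measurable_cnj [measurable]: "cnj \<in> borel_measurable borel"
  by (intro borel_measurable_continuous_onI continuous_intros)

lemma measurable_curried:
  fixes k :: "real \<Rightarrow> real \<Rightarrow> complex"
  assumes k: "case_prod k \<in> borel_measurable borel"
    and [measurable]: "f \<in> borel_measurable N" "g \<in> borel_measurable N"
  shows "(\<lambda>z. k (f z) (g z)) \<in> borel_measurable N"
  using measurable_compose[of "\<lambda>z. (f z, g z)" N "borel \<Otimes>\<^sub>M borel" "case_prod k" borel] k
  by (simp add: borel_prod)

text \<open>The square is expanded as a double integral in x and x' = x + s, and the order of
  integration is exchanged. It is applied twice: with u = x + y to the trilinear form and with u = y
  to the bilinear forms that result.\<close>

lemma TT_star_identity:
  fixes k :: "real \<Rightarrow> real \<Rightarrow> complex"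
  assumes k: "case_prod k \<in> borel_measurable borel"
    and M: "\<And>x u. cmod (k x u) \<le> M"
    and R_all: "\<forall>x u. k x u \<noteq> 0 \<longrightarrow> \<bar>x\<bar> \<le> R \<and> \<bar>u\<bar> \<le> R"
  shows "complex_of_real (LINT u|lborel. (cmod (LINT x|lborel. k x u))\<^sup>2)
           = (LINT s|lborel. LINT (x, u)|lborel. k x u * cnj (k (x + s) u))" (is ?eq)
    and "integrable lborel (\<lambda>s. LINT (x, u)|lborel. k x u * cnj (k (x + s) u))" (is ?int)
    and "integrable lborel (\<lambda>u. (cmod (LINT x|lborel. k x u))\<^sup>2)" (is ?int2)
proof -
  note R = R_all[rule_format]
  have M0: "0 \<le> M" using M[of 0 0] norm_ge_zero order_trans by blast
  define h where "h = (\<lambda>(s, x, u). k x u * cnj (k (x + s) u))"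
  note km[measurable (raw)] = measurable_curried[OF k]
  have hm[measurable]: "h \<in> borel_measurable borel"
    unfolding h_def by (simp add: borel_prod[symmetric])
  have ih: "integrable lborel h"
  proof (rule integrable_bounded_support[OF hm])
    show "norm (h z) \<le> M * M" for z
      using M M0 by (auto simp: h_def norm_mult split: prod.splits intro!: mult_mono)
    have "\<bar>s\<bar> \<le> \<bar>R\<bar> + \<bar>R\<bar> \<and> \<bar>x\<bar> \<le> \<bar>R\<bar> + \<bar>R\<bar> \<and> \<bar>u\<bar> \<le> \<bar>R\<bar> + \<bar>R\<bar>" if "h (s, x, u) \<noteq> 0" for s x u
      using R[of x u] R[of "x + s" u] that by (auto simp: h_def)
    then show "bounded {z. h z \<noteq> 0}" by (intro bounded_3_box) auto
  qed
  have ik: "integrable lborel (\<lambda>x. k x u)" for u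
  proof (rule integrable_bounded_support)
    show "norm (k x u) \<le> M" for x using M .
    show "bounded {x. k x u \<noteq> 0}" by (rule bounded_1_box[of _ R]) (use R in auto)
  qed simp
  have i2: "integrable lborel (\<lambda>(s, x). k x u * cnj (k (x + s) u))" for u
  proof -
    have m2: "(\<lambda>(s, x). k x u * cnj (k (x + s) u)) \<in> borel_measurable borel"
      by (simp add: borel_prod[symmetric])
    show ?thesis
    proof (rule integrable_bounded_support[OF m2])
      show "norm ((\<lambda>(s, x). k x u * cnj (k (x + s) u)) z) \<le> M * M" for z
        using M M0 by (auto simp: norm_mult split: prod.splits intro!: mult_mono)
      have "\<bar>s\<bar> \<le> \<bar>R\<bar> + \<bar>R\<bar> \<and> \<bar>x\<bar> \<le> \<bar>R\<bar> + \<bar>R\<bar>" if "k x u * cnj (k (x + s) u) \<noteq> 0" for s x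
        using R[of x u] R[of "x + s" u] that by auto
      then show "bounded {z. (\<lambda>(s, x). k x u * cnj (k (x + s) u)) z \<noteq> 0}"
        by (intro bounded_2_box) auto
    qed
  qed
  have sq: "complex_of_real ((cmod (LINT x|lborel. k x u))\<^sup>2)
      = (LINT s|lborel. LINT x|lborel. k x u * cnj (k (x + s) u))" for u
  proof -
    have "complex_of_real ((cmod (LINT x|lborel. k x u))\<^sup>2) = (LINT x|lborel. k x u) * cnj (LINT x|lborel. k x u)"
      by (rule complex_norm_square)
    also have "\<dots> = (LINT x|lborel. k x u * cnj (LINT x'|lborel. k x' u))" by simp
    also have "\<dots> = (LINT x|lborel. k x u * (LINT s|lborel. cnj (k (x + s) u)))"
      by (simp add: lborel_translate(2)[of "\<lambda>x. k x u"] integral_cnj)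
    also have "\<dots> = (LINT x|lborel. LINT s|lborel. k x u * cnj (k (x + s) u))" by simp
    also have "\<dots> = (LINT s|lborel. LINT x|lborel. k x u * cnj (k (x + s) u))"
      using lborel_fubini(1,2)[OF i2[of u]] by simp
    finally show ?thesis .
  qed
  have h1: "(LINT s|lborel. LINT x|lborel. k x u * cnj (k (x + s) u)) = (LINT z|lborel. h' u z)"
    if "h' = (\<lambda>u (s, x). h (s, x, u))" for h' u
  proof -
    show ?thesis using lborel_fubini(1)[OF i2[of u]] by (simp add: that h_def)
  qed
  \<comment> \<open>Regrouped as ((s, x), u) so that Fubini for pairs separates u from the other two
    variables.\<close>
  define h2 where "h2 = (\<lambda>((s, x), u). h (s, x, u))"
  have m2: "h2 \<in> borel_measurable borel"
    unfolding h2_def h_def case_prod_unfold by (simp add: borel_prod[symmetric])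
  have ih2: "integrable lborel h2"
  proof (rule integrable_bounded_support[OF m2])
    show "norm (h2 z) \<le> M * M" for z
      using M M0 by (auto simp: h_def h2_def norm_mult split: prod.splits intro!: mult_mono)
    let ?A = "\<bar>R\<bar> + \<bar>R\<bar>"
    have "{z. h2 z \<noteq> 0} \<subseteq> (cbox (- ?A) ?A \<times> cbox (- ?A) ?A) \<times> cbox (- ?A) ?A"
    proof
      fix z assume z: "z \<in> {z. h2 z \<noteq> 0}"
      obtain s x u where "z = ((s, x), u)" by (metis surj_pair)
      with z show "z \<in> (cbox (- ?A) ?A \<times> cbox (- ?A) ?A) \<times> cbox (- ?A) ?A"
        using R[of x u] R[of "x + s" u] by (auto simp: h2_def h_def)
    qed
    then show "bounded {z. h2 z \<noteq> 0}"
      by (rule bounded_subset[rotated]) (intro bounded_Times bounded_cbox)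
  qed
  have sq': "complex_of_real ((cmod (LINT x|lborel. k x u))\<^sup>2) = (LINT z|lborel. h2 (z, u))" for u
    unfolding sq using h1[OF refl, of u] by (simp add: h2_def case_prod_unfold)
  have "integrable lborel (\<lambda>u. complex_of_real ((cmod (LINT x|lborel. k x u))\<^sup>2))"
    unfolding sq' by (rule lborel_fubini(4)[OF ih2])
  then show int2: ?int2 by (simp only: complex_of_real_integrable_eq)
  have "complex_of_real (LINT u|lborel. (cmod (LINT x|lborel. k x u))\<^sup>2) = (LINT u|lborel. LINT z|lborel. h2 (z, u))"
    unfolding sq'[symmetric] by (rule integral_complex_of_real[symmetric])
  also have "\<dots> = (LINT z|lborel. LINT u|lborel. h2 (z, u))"
    using lborel_fubini(1,2)[OF ih2] by simp
  also have "\<dots> = (LINT s|lborel. LINT x|lborel. LINT u|lborel. h2 ((s, x), u))"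
    by (rule lborel_fubini(1)[OF lborel_fubini(3)[OF ih2]])
  also have "\<dots> = (LINT s|lborel. LINT (x, u)|lborel. k x u * cnj (k (x + s) u))"
  proof (rule Bochner_Integration.integral_cong[OF refl])
    fix s
    have m3: "(\<lambda>(x, u). k x u * cnj (k (x + s) u)) \<in> borel_measurable borel"
      by (simp add: borel_prod[symmetric])
    have i3: "integrable lborel (\<lambda>(x, u). k x u * cnj (k (x + s) u))"
    proof (rule integrable_bounded_support[OF m3])
      show "norm ((\<lambda>(x, u). k x u * cnj (k (x + s) u)) z) \<le> M * M" for z
        using M M0 by (auto simp: norm_mult split: prod.splits intro!: mult_mono)
      have "\<bar>x\<bar> \<le> R \<and> \<bar>u\<bar> \<le> R" if "k x u * cnj (k (x + s) u) \<noteq> 0" for x u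
        using R[of x u] that by auto
      then show "bounded {z. (\<lambda>(x, u). k x u * cnj (k (x + s) u)) z \<noteq> 0}"
        by (intro bounded_2_box) auto
    qed
    show "(LINT x|lborel. LINT u|lborel. h2 ((s, x), u)) = (LINT (x, u)|lborel. k x u * cnj (k (x + s) u))"
      using lborel_fubini(1)[OF i3] by (simp add: h2_def h_def)
  qed
  finally show ?eq .
  show ?int using lborel_fubini(3)[OF ih] by (simp add: h_def case_prod_unfold)
qed

subsection \<open>The oscillatory kernel\<close>

lemma jet_taylor_y:
  assumes "jet_family n D"
  shows "D a b x y = (\<Sum>e\<in>{b..n}. D a e x 0 * y ^ (e - b) / fact (e - b))"
  using taylor_vanishing[where f = "\<lambda>k. D a k x" and n = n and i = b and y = 0 and h = y] assms
  by (auto simp: jet_family_def)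

text \<open>A jet family provides partial derivatives only. Expanding in powers of y, with
  coefficients that are functions of x alone, reduces the chain rule along a curve to products of
  one-variable functions.\<close>

lemma jet_chain:
  assumes D: "jet_family n D"
    and u: "(u has_field_derivative u') (at t)" and v: "(v has_field_derivative v') (at t)"
  shows "((\<lambda>t. D a b (u t) (v t)) has_field_derivative
           D (Suc a) b (u t) (v t) * u' + D a (Suc b) (u t) (v t) * v') (at t)"
proof -
  have Dx: "((\<lambda>s. D a e s 0) has_field_derivative D (Suc a) e s 0) (at s)" for e s
    using D by (simp add: jet_family_def)
  have Dy: "((\<lambda>s. D a b x s) has_field_derivative D a (Suc b) x y) (at y)" for x y
    using D by (simp add: jet_family_def)
  let ?p = "\<lambda>e y. y ^ (e - b) / fact (e - b) :: real"
  let ?p' = "\<lambda>e y. real (e - b) * y ^ (e - b - 1) / fact (e - b) :: real"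
  have p: "(?p e has_field_derivative ?p' e y) (at y)" for e y
    by (auto intro!: derivative_eq_intros)
  have eq: "D a b x y = (\<Sum>e\<in>{b..n}. D a e x 0 * ?p e y)" for x y
    using jet_taylor_y[OF D, of a b x y] by simp
  have eqx: "D (Suc a) b x y = (\<Sum>e\<in>{b..n}. D (Suc a) e x 0 * ?p e y)" for x y
    using jet_taylor_y[OF D, of "Suc a" b x y] by simp
  have eqy: "D a (Suc b) x y = (\<Sum>e\<in>{b..n}. D a e x 0 * ?p' e y)" for x y
  proof (rule DERIV_unique[OF Dy])
    show "((\<lambda>s. D a b x s) has_field_derivative (\<Sum>e\<in>{b..n}. D a e x 0 * ?p' e y)) (at y)"
      unfolding eq by (intro DERIV_sum DERIV_cmult p)
  qed
  have "((\<lambda>t. \<Sum>e\<in>{b..n}. D a e (u t) 0 * ?p e (v t)) has_field_derivative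
      (\<Sum>e\<in>{b..n}. D (Suc a) e (u t) 0 * u' * ?p e (v t) + ?p' e (v t) * v' * D a e (u t) 0)) (at t)"
    by (intro DERIV_sum DERIV_mult DERIV_chain2[OF Dx u] DERIV_chain2[OF p v])
  also have "(\<Sum>e\<in>{b..n}. D (Suc a) e (u t) 0 * u' * ?p e (v t) + ?p' e (v t) * v' * D a e (u t) 0)
      = D (Suc a) b (u t) (v t) * u' + D a (Suc b) (u t) (v t) * v'"
    unfolding eqx eqy sum_distrib_right sum.distrib by (intro arg_cong2[of _ _ _ _ "(+)"] sum.cong refl) auto
  finally show ?thesis unfolding eq .
qed

lemma jet_continuous:
  assumes D: "jet_family n D"
  shows "continuous_on UNIV (\<lambda>z. D a b (fst z) (snd z))"
proof -
  have c: "continuous_on UNIV (\<lambda>s. D a e s 0)" for e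
    using D unfolding jet_family_def by (intro continuous_at_imp_continuous_on ballI) (meson DERIV_isCont)
  have "continuous_on UNIV (\<lambda>z::real \<times> real. D a e (fst z) 0)" for e
    by (rule continuous_on_compose2[OF c]) (auto intro: continuous_intros)
  then show ?thesis
    unfolding jet_taylor_y[OF D, of a b] by (intro continuous_intros) auto
qed

lemma jet_measurable:
  assumes D: "jet_family n D" and [measurable]: "f \<in> borel_measurable M" "g \<in> borel_measurable M"
  shows "(\<lambda>z. D a b (f z) (g z)) \<in> borel_measurable M"
proof -
  have "(\<lambda>z. D a b (fst z) (snd z)) \<in> borel_measurable borel"
    by (rule borel_measurable_continuous_onI[OF jet_continuous[OF D]])
  from measurable_compose[OF _ this, of "\<lambda>z. (f z, g z)" M] show ?thesis
    by (simp add: borel_prod[symmetric])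
qed

text \<open>Phrased with a fraction of \<sigma> so that increments of either sign, and zero, are
  covered at once.\<close>

lemma mvt_theta:
  fixes f f' :: "real \<Rightarrow> real"
  assumes "\<And>x. (f has_field_derivative f' x) (at x)"
  shows "\<exists>\<theta>\<in>{0..1}. f \<sigma> - f 0 = \<sigma> * f' (\<theta> * \<sigma>)"
proof (cases "\<sigma> = 0")
  case False
  have d: "((\<lambda>t. f (t * \<sigma>)) has_field_derivative f' (t * \<sigma>) * \<sigma>) (at t)" for t
    by (rule DERIV_chain2[OF assms]) (auto intro!: derivative_eq_intros)
  obtain z where "0 < z" "z < 1" "f (1 * \<sigma>) - f (0 * \<sigma>) = (1 - 0) * (f' (z * \<sigma>) * \<sigma>)"
    using MVT2[of 0 1 "\<lambda>t. f (t * \<sigma>)" "\<lambda>t. f' (t * \<sigma>) * \<sigma>"] d by auto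
  then show ?thesis by (intro bexI[of _ z]) auto
qed (auto intro: exI[of _ 0])

text \<open>If \<open>P\<close> is the family of derivatives of \<open>S\<close>, then \<open>curv P\<close> is that of \<open>H = \<partial>\<^sub>x\<partial>\<^sub>y(\<partial>\<^sub>x - \<partial>\<^sub>y)S\<close>.\<close>

definition curv :: "(nat \<Rightarrow> nat \<Rightarrow> real \<Rightarrow> real \<Rightarrow> real) \<Rightarrow> nat \<Rightarrow> nat \<Rightarrow> real \<Rightarrow> real \<Rightarrow> real" where
  "curv P a b x y = P (a + 2) (b + 1) x y - P (a + 1) (b + 2) x y"

lemma jet_family_curv: "jet_family n P \<Longrightarrow> jet_family n (curv P)"
  unfolding jet_family_def curv_def
  by (auto intro!: derivative_eq_intros)

text \<open>The phase left after two squarings: the shift by \<tau> along (1, -1) preserves x + y,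
  the shift by \<sigma> along (1, 0) preserves y.\<close>

definition ddiff :: "(real \<Rightarrow> real \<Rightarrow> real) \<Rightarrow> real \<Rightarrow> real \<Rightarrow> real \<Rightarrow> real \<Rightarrow> real" where
  "ddiff f \<sigma> \<tau> x y = (f x y - f (x + \<tau>) (y - \<tau>)) - (f (x + \<sigma>) y - f (x + \<sigma> + \<tau>) (y - \<tau>))"

text \<open>The mean value theorem along (1, 0) contributes d/dx, along (1, -1) it contributes d/dx
  - d/dy, and one of the y-derivatives already present completes H. So the y-derivatives of the
  phase are values of y-derivatives of H at intermediate points.\<close>

lemma ddiff_mvt:
  assumes P: "jet_family n P"
  shows "\<exists>\<theta>\<in>{0..1}. \<exists>\<eta>\<in>{0..1}. ddiff (P 0 (Suc j)) \<sigma> \<tau> x y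
           = \<sigma> * \<tau> * curv P 0 j (x + \<theta> * \<sigma> + \<eta> * \<tau>) (y - \<eta> * \<tau>)"
proof -
  let ?j = "Suc j"
  define h where "h s = P 0 ?j (x + s) y - P 0 ?j (x + s + \<tau>) (y - \<tau>)" for s
  define h' where "h' s = P 1 ?j (x + s) y - P 1 ?j (x + s + \<tau>) (y - \<tau>)" for s
  have "(h has_field_derivative h' s) (at s)" for s
  proof -
    have "((\<lambda>s. P 0 ?j (x + s) y) has_field_derivative P (Suc 0) ?j (x + s) y * 1 + P 0 (Suc ?j) (x + s) y * 0) (at s)"
      by (rule jet_chain[OF P]) (auto intro!: derivative_eq_intros)
    moreover have "((\<lambda>s. P 0 ?j (x + s + \<tau>) (y - \<tau>)) has_field_derivative
        P (Suc 0) ?j (x + s + \<tau>) (y - \<tau>) * 1 + P 0 (Suc ?j) (x + s + \<tau>) (y - \<tau>) * 0) (at s)"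
      by (rule jet_chain[OF P]) (auto intro!: derivative_eq_intros)
    ultimately show ?thesis unfolding h_def h'_def by (auto intro!: derivative_eq_intros)
  qed
  from mvt_theta[where f = h, OF this] obtain \<theta> where \<theta>: "\<theta> \<in> {0..1}" "h \<sigma> - h 0 = \<sigma> * h' (\<theta> * \<sigma>)" by blast
  define e where "e t = P 1 ?j (x + \<theta> * \<sigma> + t) (y - t)" for t
  have "(e has_field_derivative curv P 0 j (x + \<theta> * \<sigma> + t) (y - t)) (at t)" for t
  proof -
    have "((\<lambda>t. P 1 ?j (x + \<theta> * \<sigma> + t) (y - t)) has_field_derivative
        P (Suc 1) ?j (x + \<theta> * \<sigma> + t) (y - t) * 1 + P 1 (Suc ?j) (x + \<theta> * \<sigma> + t) (y - t) * (-1)) (at t)"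
      by (rule jet_chain[OF P]) (auto intro!: derivative_eq_intros)
    then show ?thesis unfolding e_def curv_def by (simp add: numeral_2_eq_2)
  qed
  from mvt_theta[where f = e, OF this] obtain \<eta> where \<eta>: "\<eta> \<in> {0..1}"
    "e \<tau> - e 0 = \<tau> * curv P 0 j (x + \<theta> * \<sigma> + \<eta> * \<tau>) (y - \<eta> * \<tau>)" by blast
  have "ddiff (P 0 ?j) \<sigma> \<tau> x y = - (h \<sigma> - h 0)" by (simp add: ddiff_def h_def)
  also have "\<dots> = \<sigma> * (e \<tau> - e 0)" unfolding \<theta>(2) by (simp add: h'_def e_def algebra_simps)
  also have "\<dots> = \<sigma> * \<tau> * curv P 0 j (x + \<theta> * \<sigma> + \<eta> * \<tau>) (y - \<eta> * \<tau>)" unfolding \<eta>(2) by simp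
  finally show ?thesis using \<theta>(1) \<eta>(1) by blast
qed

lemma ddiff_deriv:
  assumes P: "jet_family n P"
  shows "((\<lambda>y. ddiff (P a b) \<sigma> \<tau> x y) has_field_derivative ddiff (P a (Suc b)) \<sigma> \<tau> x y) (at y)"
proof -
  have c: "((\<lambda>y. P a b u (y + v)) has_field_derivative P a (Suc b) u (y + v)) (at y)" for u v
  proof -
    have "((\<lambda>y. P a b u (y + v)) has_field_derivative P (Suc a) b u (y + v) * 0 + P a (Suc b) u (y + v) * 1) (at y)"
      by (rule jet_chain[OF P]) (auto intro!: derivative_eq_intros)
    then show ?thesis by simp
  qed
  show ?thesis
    unfolding ddiff_def
    using DERIV_diff[OF DERIV_diff[OF c[of x 0] c[of "x + \<tau>" "- \<tau>"]]
        DERIV_diff[OF c[of "x + \<sigma>" 0] c[of "x + \<sigma> + \<tau>" "- \<tau>"]]]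
    by simp
qed

text \<open>Only y-derivatives of H occur because the integration by parts runs in y. The half-width
  2r leaves room for the intermediate points of \<open>ddiff_mvt\<close> when y is within r of the
  centre.\<close>

definition tame_on_box ::
    "(nat \<Rightarrow> nat \<Rightarrow> real \<Rightarrow> real \<Rightarrow> real) \<Rightarrow> real \<Rightarrow> real \<Rightarrow> real \<Rightarrow> real \<Rightarrow> bool" where
  "tame_on_box D p1 p2 r m \<longleftrightarrow> (\<forall>x y. \<bar>x - p1\<bar> \<le> 2 * r \<longrightarrow> \<bar>y - p2\<bar> \<le> 2 * r \<longrightarrow>
     m / 2 \<le> \<bar>D 0 0 x y\<bar> \<and> \<bar>D 0 1 x y\<bar> \<le> m / r \<and> \<bar>D 0 2 x y\<bar> \<le> m / r\<^sup>2)"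

text \<open>Adding the first bound to t^2 times the second gives 2 + 92 = 94. The resulting decay is
  integrable in t, which a decay of first order would not be.\<close>

lemma min_le_lorentzian:
  fixes K t r :: real
  assumes "K \<le> 2 * r" "K \<le> 92 * r / t\<^sup>2" "0 < t"
  shows "K \<le> 94 * r / (1 + t\<^sup>2)"
proof -
  have t2: "0 < t\<^sup>2" using assms(3) by (rule zero_less_power)
  then have "0 < 1 + t\<^sup>2" by linarith
  moreover have "K * t\<^sup>2 \<le> 92 * r" using assms(2) by (simp only: pos_le_divide_eq[OF t2])
  ultimately show ?thesis using assms(1) by (simp add: pos_le_divide_eq distrib_left)
qed

lemma kernel_bound:
  assumes P: "jet_family n P" and r: "r > 0" and m: "m > 0" and l: "l \<noteq> 0"
    and tame: "tame_on_box (curv P) p1 p2 r m"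
    and x: "\<bar>x - p1\<bar> \<le> r / 2" "\<bar>x + \<tau> - p1\<bar> \<le> r / 2" "\<bar>x + \<sigma> - p1\<bar> \<le> r / 2" "\<bar>x + \<sigma> + \<tau> - p1\<bar> \<le> r / 2"
  shows "cmod (integral {p2 - r..p2 + r}
           (\<lambda>y. cis (l * ddiff (P 0 0) \<sigma> \<tau> x y) * complex_of_real ((1 - ((y - p2) / r)\<^sup>2)\<^sup>2)))
         \<le> 94 * r / (1 + (\<bar>l\<bar> * m * \<bar>\<tau>\<bar> * r / 2 * \<sigma>)\<^sup>2)" (is "?K \<le> _")
proof -
  have triv: "?K \<le> 2 * r"
  proof -
    have "?K \<le> 1 * measure lborel (cbox (p2 - r) (p2 + r))"
      unfolding cbox_interval[symmetric]
    proof (rule has_integral_bound[OF _ integrable_integral])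
      fix y assume y: "y \<in> cbox (p2 - r) (p2 + r)"
      have "\<bar>(y - p2) / r\<bar> \<le> 1" using y r by (auto simp: abs_le_iff field_simps)
      then have "((y - p2) / r)\<^sup>2 \<le> 1" unfolding abs_square_le_1 .
      then show "cmod (cis (l * ddiff (P 0 0) \<sigma> \<tau> x y) * complex_of_real ((1 - ((y - p2) / r)\<^sup>2)\<^sup>2)) \<le> 1"
        by (auto simp: norm_mult power_le_one_iff simp del: of_real_power of_real_diff)
    next
      have "continuous_on {p2 - r..p2 + r} (\<lambda>y. ddiff (P 0 0) \<sigma> \<tau> x y)"
        using ddiff_deriv[OF P] by (intro continuous_at_imp_continuous_on ballI DERIV_isCont)
      then show "(\<lambda>y. cis (l * ddiff (P 0 0) \<sigma> \<tau> x y) * complex_of_real ((1 - ((y - p2) / r)\<^sup>2)\<^sup>2))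
          integrable_on cbox (p2 - r) (p2 + r)"
        unfolding cbox_interval using r by (intro integrable_continuous_interval continuous_intros) auto
    qed auto
    then show ?thesis using r by simp
  qed
  define q where "q = \<bar>l\<bar> * \<bar>\<sigma>\<bar> * \<bar>\<tau>\<bar>"
  \<comment> \<open>The lower bound m/2 on |H| times the factor q. In these units the derivative
    bounds m/r and m/r^2 become exactly the 2\<gamma>/r and 2\<gamma>/r^2 of
    \<open>oscillatory_bump_bound\<close>.\<close>
  define \<gamma> where "\<gamma> = q * m / 2"
  have curvb: "\<bar>l * ddiff (P 0 (Suc j)) \<sigma> \<tau> x y\<bar> = q * \<bar>curv P 0 j (x + \<theta> * \<sigma> + \<eta> * \<tau>) (y - \<eta> * \<tau>)\<bar>"
    if "ddiff (P 0 (Suc j)) \<sigma> \<tau> x y = \<sigma> * \<tau> * curv P 0 j (x + \<theta> * \<sigma> + \<eta> * \<tau>) (y - \<eta> * \<tau>)" for j y \<theta> \<eta>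
    using that by (simp add: q_def abs_mult)
  have inbox: "\<exists>u v. \<bar>u - p1\<bar> \<le> 2 * r \<and> \<bar>v - p2\<bar> \<le> 2 * r \<and> \<bar>l * ddiff (P 0 (Suc j)) \<sigma> \<tau> x y\<bar> = q * \<bar>curv P 0 j u v\<bar>"
    if y: "\<bar>y - p2\<bar> \<le> r" for j y
  proof -
    obtain \<theta> \<eta> where th: "\<theta> \<in> {0..1}" "\<eta> \<in> {0..1}"
      and eq: "ddiff (P 0 (Suc j)) \<sigma> \<tau> x y = \<sigma> * \<tau> * curv P 0 j (x + \<theta> * \<sigma> + \<eta> * \<tau>) (y - \<eta> * \<tau>)"
      using ddiff_mvt[OF P] by blast
    have "\<bar>\<sigma>\<bar> \<le> r" "\<bar>\<tau>\<bar> \<le> r" using x by linarith+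
    moreover have "\<bar>\<theta> * \<sigma>\<bar> \<le> 1 * \<bar>\<sigma>\<bar>" "\<bar>\<eta> * \<tau>\<bar> \<le> 1 * \<bar>\<tau>\<bar>"
      unfolding abs_mult using th by (intro mult_right_mono; simp)+
    \<comment> \<open>The point x + \<theta>\<sigma> lies between x and x + \<sigma>, hence within
      r/2 of the centre; adding at most r for \<eta>\<tau> stays inside the box.\<close>
    moreover have "\<bar>x + \<theta> * \<sigma> + \<eta> * \<tau> - p1\<bar> \<le> 2 * r"
    proof -
      have "(0 \<le> \<theta> * \<sigma> \<and> \<theta> * \<sigma> \<le> \<sigma>) \<or> (\<sigma> \<le> \<theta> * \<sigma> \<and> \<theta> * \<sigma> \<le> 0)"
      proof (cases "0 \<le> \<sigma>")
        case True
        then show ?thesis using th mult_left_le_one_le[of \<sigma> \<theta>] by simp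
      next
        case False
        then show ?thesis using th mult_left_le_one_le[of "- \<sigma>" \<theta>] mult_nonneg_nonpos[of \<theta> \<sigma>] by simp
      qed
      then have "\<bar>x + \<theta> * \<sigma> - p1\<bar> \<le> r / 2" using x by linarith
      then show ?thesis using calculation by linarith
    qed
    ultimately have "\<bar>x + \<theta> * \<sigma> + \<eta> * \<tau> - p1\<bar> \<le> 2 * r \<and> \<bar>y - \<eta> * \<tau> - p2\<bar> \<le> 2 * r"
      using y by linarith
    then show ?thesis using curvb[OF eq] by blast
  qed
  show ?thesis
  proof (cases "q = 0")
    \<comment> \<open>If one of the shifts is zero there is no oscillation; the denominator on the
      right is then 1 and the trivial bound suffices.\<close>
    case True
    then have "\<sigma> = 0 \<or> \<tau> = 0" using l by (auto simp: q_def)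
    then have "94 * r / (1 + (\<bar>l\<bar> * m * \<bar>\<tau>\<bar> * r / 2 * \<sigma>)\<^sup>2) = 94 * r" by auto
    then show ?thesis using triv r by simp
  next
    case False
    have q: "0 < q" using False by (simp add: q_def)
    have \<gamma>: "0 < \<gamma>" using q m by (simp add: \<gamma>_def)
    have osc: "?K \<le> 92 * r / (\<gamma> * r)\<^sup>2"
    proof (rule oscillatory_bump_bound[OF r \<gamma>,
          where g = "\<lambda>y. l * ddiff (P 0 1) \<sigma> \<tau> x y" and ?g1.0 = "\<lambda>y. l * ddiff (P 0 2) \<sigma> \<tau> x y"
            and ?g2.0 = "\<lambda>y. l * ddiff (P 0 3) \<sigma> \<tau> x y"])
      fix y assume y: "\<bar>y - p2\<bar> \<le> r"
      obtain u v where uv: "\<bar>u - p1\<bar> \<le> 2 * r" "\<bar>v - p2\<bar> \<le> 2 * r" "\<bar>l * ddiff (P 0 1) \<sigma> \<tau> x y\<bar> = q * \<bar>curv P 0 0 u v\<bar>"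
        using inbox[OF y, of 0] by auto
      have "m / 2 \<le> \<bar>curv P 0 0 u v\<bar>" using tame uv by (simp add: tame_on_box_def)
      then show "\<gamma> \<le> \<bar>l * ddiff (P 0 1) \<sigma> \<tau> x y\<bar>"
        unfolding uv(3) \<gamma>_def using q by (simp add: mult_left_mono field_simps)
    next
      fix y assume y: "\<bar>y - p2\<bar> \<le> r"
      obtain u v where uv: "\<bar>u - p1\<bar> \<le> 2 * r" "\<bar>v - p2\<bar> \<le> 2 * r" "\<bar>l * ddiff (P 0 2) \<sigma> \<tau> x y\<bar> = q * \<bar>curv P 0 1 u v\<bar>"
        using inbox[OF y, of 1] by (auto simp: numeral_2_eq_2)
      have "\<bar>curv P 0 1 u v\<bar> \<le> m / r" using tame uv by (simp add: tame_on_box_def)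
      then have "q * \<bar>curv P 0 1 u v\<bar> \<le> q * (m / r)" using q by (intro mult_left_mono) auto
      then show "\<bar>l * ddiff (P 0 2) \<sigma> \<tau> x y\<bar> \<le> 2 * \<gamma> / r"
        unfolding uv(3) \<gamma>_def by simp
    next
      fix y assume y: "\<bar>y - p2\<bar> \<le> r"
      obtain u v where uv: "\<bar>u - p1\<bar> \<le> 2 * r" "\<bar>v - p2\<bar> \<le> 2 * r" "\<bar>l * ddiff (P 0 3) \<sigma> \<tau> x y\<bar> = q * \<bar>curv P 0 2 u v\<bar>"
        using inbox[OF y, of 2] by (auto simp: numeral_3_eq_3 numeral_2_eq_2)
      have "\<bar>curv P 0 2 u v\<bar> \<le> m / r\<^sup>2" using tame uv by (simp add: tame_on_box_def)
      then have "q * \<bar>curv P 0 2 u v\<bar> \<le> q * (m / r\<^sup>2)" using q by (intro mult_left_mono) auto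
      then show "\<bar>l * ddiff (P 0 3) \<sigma> \<tau> x y\<bar> \<le> 2 * \<gamma> / r\<^sup>2"
        unfolding uv(3) \<gamma>_def by simp
    qed (use ddiff_deriv[OF P, of 0 0] ddiff_deriv[OF P, of 0 1] ddiff_deriv[OF P, of 0 2] in
        \<open>auto intro!: DERIV_cmult simp: numeral_2_eq_2 numeral_3_eq_3\<close>)
    let ?t = "\<gamma> * r"
    have t: "0 < ?t" using \<gamma> r by simp
    have "?K \<le> 94 * r / (1 + ?t\<^sup>2)" by (rule min_le_lorentzian[OF triv osc t])
    also have "?t\<^sup>2 = (\<bar>l\<bar> * m * \<bar>\<tau>\<bar> * r / 2 * \<sigma>)\<^sup>2"
      by (simp add: \<gamma>_def q_def power_mult_distrib power_divide)
    finally show ?thesis .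
  qed
qed

subsection \<open>The bilinear estimate\<close>

text \<open>For bounded Borel functions of bounded support every multiple integral below converges
  absolutely; general square-integrable functions are reached by truncation at the end.\<close>

definition nice :: "(real \<Rightarrow> complex) \<Rightarrow> bool" where
  "nice f \<longleftrightarrow> f \<in> borel_measurable borel \<and> (\<exists>B. \<forall>x. cmod (f x) \<le> B) \<and> (\<exists>R. \<forall>x. f x \<noteq> 0 \<longrightarrow> \<bar>x\<bar> \<le> R)"

definition nrm :: "(real \<Rightarrow> complex) \<Rightarrow> real" where
  "nrm f = sqrt (LINT x|lborel. (cmod (f x))\<^sup>2)"

lemma nrm_nonneg [simp]: "0 \<le> nrm f"
  by (simp add: nrm_def)

lemma nrm_sq: "(nrm f)\<^sup>2 = (LINT x|lborel. (cmod (f x))\<^sup>2)"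
  by (simp add: nrm_def)

lemma nice_meas: "nice f \<Longrightarrow> f \<in> borel_measurable borel"
  by (simp add: nice_def)

lemma nice_bound: "nice f \<Longrightarrow> \<exists>B>0. \<forall>x. cmod (f x) \<le> B"
  unfolding nice_def by (metis less_add_one max.cobounded1 max.cobounded2 le_less_trans order_trans zero_less_one less_le_trans max.strict_coboundedI2)

lemma nice_integrable:
  assumes "nice f"
  shows "integrable lborel f" "integrable lborel (\<lambda>x. cmod (f x))" "integrable lborel (\<lambda>x. (cmod (f x))\<^sup>2)"
proof -
  note [measurable] = nice_meas[OF assms]
  obtain B where B: "\<And>x. cmod (f x) \<le> B" using assms by (auto simp: nice_def)
  obtain R where R: "\<And>x. f x \<noteq> 0 \<Longrightarrow> \<bar>x\<bar> \<le> R" using assms by (auto simp: nice_def)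
  show i: "integrable lborel f"
    by (rule integrable_bounded_support[of f B]) (use B R in \<open>auto intro: bounded_1_box\<close>)
  then show "integrable lborel (\<lambda>x. cmod (f x))" by simp
  show "integrable lborel (\<lambda>x. (cmod (f x))\<^sup>2)"
    by (rule integrable_bounded_support[of _ "B\<^sup>2"]) (use B R in \<open>auto intro: bounded_1_box power_mono\<close>)
qed

lemma nice_shift_product:
  assumes f: "nice f"
  shows "nice (\<lambda>x. f x * cnj (f (x + t)))"
proof -
  note [measurable] = nice_meas[OF f]
  obtain B where B: "\<And>x. cmod (f x) \<le> B" "0 < B" using nice_bound[OF f] by auto
  obtain R where R: "\<And>x. f x \<noteq> 0 \<Longrightarrow> \<bar>x\<bar> \<le> R" using f by (auto simp: nice_def)
  show ?thesis
    unfolding nice_def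
  proof (intro conjI)
    show "\<exists>B. \<forall>x. cmod (f x * cnj (f (x + t))) \<le> B"
      using B by (intro exI[of _ "B * B"]) (auto simp: norm_mult intro!: mult_mono)
  qed (use R in auto)
qed

lemma nrm_shift_product_L1:
  assumes f: "nice f"
  shows "(LINT x|lborel. cmod (f x * cnj (f (x + t)))) \<le> (nrm f)\<^sup>2"
proof -
  note [measurable] = nice_meas[OF f]
  have "(LINT x|lborel. \<bar>cmod (f x) * cmod (f (x + t))\<bar>)
      \<le> sqrt (LINT x|lborel. (cmod (f x))\<^sup>2) * sqrt (LINT x|lborel. (cmod (f (x + t)))\<^sup>2)"
    using nice_integrable(3)[OF f] integrable_translate(1)[OF nice_integrable(3)[OF f]]
    by (intro Cauchy_Schwarz_integral) auto
  also have "(LINT x|lborel. (cmod (f (x + t)))\<^sup>2) = (LINT x|lborel. (cmod (f x))\<^sup>2)"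
    by (rule lborel_translate(1)[of "\<lambda>x. (cmod (f x))\<^sup>2"])
  finally show ?thesis by (simp add: norm_mult nrm_def)
qed

text \<open>Fubini and translation invariance. It allows the bilinear bounds to be summed over all
  shifts by Cauchy-Schwarz with no loss in the side of the square.\<close>

lemma nrm_shift_product_L2:
  assumes f: "nice f"
  shows "integrable lborel (\<lambda>t. (nrm (\<lambda>x. f x * cnj (f (x + t))))\<^sup>2)"
    and "(LINT t|lborel. (nrm (\<lambda>x. f x * cnj (f (x + t))))\<^sup>2) = (nrm f) ^ 4"
proof -
  note [measurable] = nice_meas[OF f]
  obtain B where B: "\<And>x. cmod (f x) \<le> B" "0 < B" using nice_bound[OF f] by auto
  obtain R where R: "\<And>x. f x \<noteq> 0 \<Longrightarrow> \<bar>x\<bar> \<le> R" using f by (auto simp: nice_def)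
  define h where "h = (\<lambda>(t, x). (cmod (f x * cnj (f (x + t))))\<^sup>2)"
  have ih: "integrable lborel h"
  proof (rule integrable_bounded_support)
    show "h \<in> borel_measurable borel" unfolding h_def by (simp add: borel_prod[symmetric])
    show "norm (h z) \<le> (B * B)\<^sup>2" for z
      unfolding h_def using B by (auto simp: norm_mult split: prod.splits intro!: power_mono mult_mono)
    have "\<bar>t\<bar> \<le> \<bar>R\<bar> + \<bar>R\<bar> \<and> \<bar>x\<bar> \<le> \<bar>R\<bar> + \<bar>R\<bar>" if "h (t, x) \<noteq> 0" for t x
      using R[of x] R[of "x + t"] that by (auto simp: h_def)
    then show "bounded {z. h z \<noteq> 0}" by (intro bounded_2_box) auto
  qed
  have e: "(nrm (\<lambda>x. f x * cnj (f (x + t))))\<^sup>2 = (LINT x|lborel. h (t, x))" for t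
    by (simp add: nrm_sq h_def)
  show "integrable lborel (\<lambda>t. (nrm (\<lambda>x. f x * cnj (f (x + t))))\<^sup>2)"
    unfolding e by (rule lborel_fubini(3)[OF ih])
  have "(LINT t|lborel. (nrm (\<lambda>x. f x * cnj (f (x + t))))\<^sup>2) = (LINT x|lborel. LINT t|lborel. h (t, x))"
    unfolding e using lborel_fubini(1,2)[OF ih] by simp
  also have "\<dots> = (LINT x|lborel. (cmod (f x))\<^sup>2 * (nrm f)\<^sup>2)"
  proof (rule Bochner_Integration.integral_cong[OF refl])
    fix x
    have "(LINT t|lborel. h (t, x)) = (LINT t|lborel. (cmod (f x))\<^sup>2 * (cmod (f (x + t)))\<^sup>2)"
      by (simp add: h_def norm_mult power_mult_distrib)
    also have "\<dots> = (cmod (f x))\<^sup>2 * (LINT t|lborel. (cmod (f (x + t)))\<^sup>2)" by simp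
    also have "(LINT t|lborel. (cmod (f (x + t)))\<^sup>2) = (nrm f)\<^sup>2"
      unfolding nrm_sq by (rule lborel_translate(2)[of "\<lambda>x. (cmod (f x))\<^sup>2"])
    finally show "(LINT t|lborel. h (t, x)) = (cmod (f x))\<^sup>2 * (nrm f)\<^sup>2" .
  qed
  also have "\<dots> = (nrm f) ^ 4" by (simp add: nrm_sq[symmetric])
  finally show "(LINT t|lborel. (nrm (\<lambda>x. f x * cnj (f (x + t))))\<^sup>2) = (nrm f) ^ 4" .
qed

lemma lborel_reflect:
  fixes f :: "real \<Rightarrow> 'a::{banach, second_countable_topology}"
  shows "(LINT x|lborel. f (- x)) = (LINT x|lborel. f x)"
  using lborel_integral_real_affine[of "-1" f 0] by simp

lemma integrable_reflect:
  fixes f :: "real \<Rightarrow> 'a::{banach, second_countable_topology}"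
  shows "integrable lborel f \<Longrightarrow> integrable lborel (\<lambda>x. f (- x))"
  using lborel_integrable_real_affine[of f "-1" 0] by simp

lemma integrable_2_bounded:
  fixes f :: "real \<Rightarrow> real \<Rightarrow> 'a::{banach, second_countable_topology}"
  assumes "case_prod f \<in> borel_measurable borel" "\<And>x y. norm (f x y) \<le> B"
    and "\<And>x y. f x y \<noteq> 0 \<Longrightarrow> \<bar>x\<bar> \<le> R \<and> \<bar>y\<bar> \<le> R"
  shows "integrable lborel (case_prod f)"
  by (rule integrable_bounded_support[of _ B]) (use assms in \<open>auto intro!: bounded_2_box[of _ R]\<close>)

lemma borel_measurable_cis [measurable]: "cis \<in> borel_measurable borel"
proof -
  have "cis = (\<lambda>t. exp (\<i> * complex_of_real t))" by (simp add: fun_eq_iff cis_conv_exp)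
  moreover have "(\<lambda>t. exp (\<i> * complex_of_real t)) \<in> borel_measurable borel" by measurable
  ultimately show ?thesis by simp
qed

lemma arctan_kernel_integral:
  fixes \<beta> r :: real
  assumes "\<beta> > 0" "r \<ge> 0"
  shows "integrable lborel (\<lambda>s. indicator {- r..r} s *\<^sub>R (1 / (1 + (\<beta> * s)\<^sup>2)))"
    and "(LINT s|lborel. indicator {- r..r} s *\<^sub>R (1 / (1 + (\<beta> * s)\<^sup>2))) \<le> pi / \<beta>"
proof -
  have pos: "1 + (\<beta> * s)\<^sup>2 > 0" for s by (simp add: add_pos_nonneg)
  have c: "continuous_on {- r..r} (\<lambda>s. 1 / (1 + (\<beta> * s)\<^sup>2))"
    using pos by (intro continuous_intros) (metis less_irrefl)+
  show "integrable lborel (\<lambda>s. indicator {- r..r} s *\<^sub>R (1 / (1 + (\<beta> * s)\<^sup>2)))"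
    by (intro borel_integrable_compact c compact_Icc)
  have "(LINT s|lborel. indicator {- r..r} s *\<^sub>R (1 / (1 + (\<beta> * s)\<^sup>2))) = arctan (\<beta> * r) / \<beta> - arctan (\<beta> * (- r)) / \<beta>"
  proof (rule integral_FTC_atLeastAtMost[OF _ _ c])
    fix x
    have "((\<lambda>s. arctan (\<beta> * s) / \<beta>) has_real_derivative 1 / (1 + (\<beta> * x)\<^sup>2)) (at x)"
      using assms by (auto intro!: derivative_eq_intros simp: inverse_eq_divide)
    then show "((\<lambda>s. arctan (\<beta> * s) / \<beta>) has_vector_derivative 1 / (1 + (\<beta> * x)\<^sup>2)) (at x within {- r..r})"
      by (metis has_real_derivative_iff_has_vector_derivative has_vector_derivative_at_within)
  qed (use assms in auto)
  also have "\<dots> \<le> pi / \<beta>"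
    using arctan_bounded[of "\<beta> * r"] assms by (simp add: arctan_minus field_simps)
  finally show "(LINT s|lborel. indicator {- r..r} s *\<^sub>R (1 / (1 + (\<beta> * s)\<^sup>2))) \<le> pi / \<beta>" .
qed

text \<open>The weight in \<open>y\<close> must be smooth: a sharp cutoff would lose a logarithm in Schur's test.\<close>

lemma bilinear_bound:
  assumes P: "jet_family n P" and r: "r > 0" and m: "m > 0" and l: "l \<noteq> 0" and \<tau>: "\<tau> \<noteq> 0"
    and tame: "tame_on_box (curv P) p1 p2 r m"
    and F: "nice F" "\<And>x. F x \<noteq> 0 \<Longrightarrow> \<bar>x - p1\<bar> \<le> r / 2 \<and> \<bar>x + \<tau> - p1\<bar> \<le> r / 2"
    and G: "nice G" "\<And>y. G y \<noteq> 0 \<Longrightarrow> \<bar>y - p2\<bar> \<le> r / 2"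
  shows "cmod (LINT (x, y)|lborel. cis (l * (P 0 0 x y - P 0 0 (x + \<tau>) (y - \<tau>))) * F x * G y)
         \<le> 37 / sqrt (\<bar>l\<bar> * m * \<bar>\<tau>\<bar>) * nrm F * nrm G"
proof -
  note [measurable] = nice_meas[OF F(1)] nice_meas[OF G(1)] jet_measurable[OF P]
  obtain BF where BF: "\<And>x. cmod (F x) \<le> BF" "0 < BF" using nice_bound[OF F(1)] by auto
  obtain BG where BG: "\<And>x. cmod (G x) \<le> BG" "0 < BG" using nice_bound[OF G(1)] by auto
  define E where "E x y = cis (l * (P 0 0 x y - P 0 0 (x + \<tau>) (y - \<tau>)))" for x y
  have Em: "case_prod E \<in> borel_measurable borel"
    unfolding E_def case_prod_unfold by (simp add: borel_prod[symmetric])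
  note [measurable] = measurable_curried[OF Em]
  \<comment> \<open>It enters \<open>TT_star_identity\<close> twice, and its square is the bump of
    \<open>oscillatory_bump_bound\<close>. On the support of G, where |y - p2| \<le> r/2, it is at
    least 3/4, so inserting it costs a factor 4/3.\<close>
  define w where "w y = (if \<bar>y - p2\<bar> \<le> r then 1 - ((y - p2) / r)\<^sup>2 else 0)" for y
  have [measurable]: "w \<in> borel_measurable borel" unfolding w_def by measurable
  have sqle: "((y - p2) / r)\<^sup>2 \<le> 1" if "\<bar>y - p2\<bar> \<le> r" for y
  proof -
    have "\<bar>(y - p2) / r\<bar> \<le> 1" using that r by (auto simp: abs_le_iff field_simps)
    then show ?thesis unfolding abs_square_le_1 .
  qed
  have w01: "0 \<le> w y" "w y \<le> 1" for y using sqle[of y] by (auto simp: w_def)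
  have w34: "3 / 4 \<le> w y" if "\<bar>y - p2\<bar> \<le> r / 2" for y
  proof -
    have "\<bar>(y - p2) / r\<bar> \<le> 1 / 2" using that r by (auto simp: abs_le_iff field_simps)
    then have "\<bar>(y - p2) / r\<bar>\<^sup>2 \<le> (1 / 2)\<^sup>2" by (intro power_mono) auto
    then have "((y - p2) / r)\<^sup>2 \<le> 1 / 4" by (simp add: power2_eq_square)
    then show ?thesis using that r by (simp add: w_def)
  qed
  define k where "k x y = E x y * F x * complex_of_real (w y)" for x y
  have km: "case_prod k \<in> borel_measurable borel"
    unfolding k_def case_prod_unfold by (simp add: borel_prod[symmetric])
  define R where "R = \<bar>p1\<bar> + \<bar>p2\<bar> + 2 * r"
  have kB: "cmod (k x y) \<le> BF" for x y
  proof -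
    have "cmod (F x) * \<bar>w y\<bar> \<le> BF * 1" using BF w01 by (intro mult_mono) auto
    then show ?thesis by (simp add: k_def E_def norm_mult)
  qed
  have kR: "\<bar>x\<bar> \<le> R \<and> \<bar>y\<bar> \<le> R" if "k x y \<noteq> 0" for x y
  proof -
    have "\<bar>x - p1\<bar> \<le> r / 2" "\<bar>y - p2\<bar> \<le> r"
      using that F(2)[of x] by (auto simp: k_def w_def split: if_splits)
    then show ?thesis unfolding R_def using r by linarith
  qed
  have kR_all: "\<forall>x y. k x y \<noteq> 0 \<longrightarrow> \<bar>x\<bar> \<le> R \<and> \<bar>y\<bar> \<le> R" using kR by blast
  note TT = TT_star_identity[of k BF R, OF km kB kR_all]
  define \<beta> where "\<beta> = \<bar>l\<bar> * m * \<bar>\<tau>\<bar> * r / 2"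
  have \<beta>: "\<beta> > 0" using l m \<tau> r by (simp add: \<beta>_def)
  define X where "X = (LINT y|lborel. (cmod (LINT x|lborel. k x y))\<^sup>2)"
  have X_bound: "X \<le> 188 * pi / (\<bar>l\<bar> * m * \<bar>\<tau>\<bar>) * (nrm F)\<^sup>2"
  proof -
    let ?I = "\<lambda>s. LINT (x, y)|lborel. k x y * cnj (k (x + s) y)"
    have I_le: "cmod (?I s) \<le> indicator {- r..r} s *\<^sub>R (1 / (1 + (\<beta> * s)\<^sup>2)) * (94 * r * (nrm F)\<^sup>2)" for s
    proof (cases "\<bar>s\<bar> \<le> r")
      case False
      have z: "k x y * cnj (k (x + s) y) = 0" for x y
      proof (rule ccontr)
        assume "k x y * cnj (k (x + s) y) \<noteq> 0"
        then have "F x \<noteq> 0" "F (x + s) \<noteq> 0" by (auto simp: k_def)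
        then show False using F(2)[of x] F(2)[of "x + s"] False by linarith
      qed
      have "(\<lambda>(x, y). k x y * cnj (k (x + s) y)) = (\<lambda>_. 0)"
        unfolding case_prod_unfold z ..
      then show ?thesis using r by simp
    next
      case True
      note [measurable] = measurable_curried[OF km]
      have int: "integrable lborel (\<lambda>(x, y). k x y * cnj (k (x + s) y))"
      proof (rule integrable_2_bounded)
        show "(\<lambda>(x, y). k x y * cnj (k (x + s) y)) \<in> borel_measurable borel"
          unfolding case_prod_unfold by (simp add: borel_prod[symmetric])
        show "norm (k x y * cnj (k (x + s) y)) \<le> BF * BF" for x y
          using kB BF by (auto simp: norm_mult intro!: mult_mono)
        show "\<bar>x\<bar> \<le> R \<and> \<bar>y\<bar> \<le> R" if "k x y * cnj (k (x + s) y) \<noteq> 0" for x y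
          using kR[of x y] that by auto
      qed
      \<comment> \<open>For fixed x and s the y-integral is the oscillatory kernel with phase
        \<open>ddiff\<close>; F contributes only a factor that does not depend on y.\<close>
      have inner: "cmod (LINT y|lborel. k x y * cnj (k (x + s) y))
          \<le> cmod (F x * cnj (F (x + s))) * (94 * r / (1 + (\<beta> * s)\<^sup>2))" for x
      proof (cases "F x = 0 \<or> F (x + s) = 0")
        case True
        then show ?thesis by (auto simp: k_def)
      next
        case False
        let ?g = "\<lambda>y. cis (l * ddiff (P 0 0) s \<tau> x y) * complex_of_real ((1 - ((y - p2) / r)\<^sup>2)\<^sup>2)"
        have "k x y * cnj (k (x + s) y)
            = F x * cnj (F (x + s)) * (indicator {p2 - r..p2 + r} y *\<^sub>R ?g y)" for y
        proof -
          have "E x y * cnj (E (x + s) y) = cis (l * ddiff (P 0 0) s \<tau> x y)"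
            by (simp add: E_def ddiff_def cis_cnj cis_mult algebra_simps)
          moreover have "k x y * cnj (k (x + s) y)
              = F x * cnj (F (x + s)) * (E x y * cnj (E (x + s) y)) * complex_of_real ((w y)\<^sup>2)"
            by (simp add: k_def power2_eq_square)
          ultimately show ?thesis
            by (auto simp: w_def indicator_def abs_le_iff)
        qed
        then have "(LINT y|lborel. k x y * cnj (k (x + s) y))
            = (LINT y|lborel. F x * cnj (F (x + s)) * (indicator {p2 - r..p2 + r} y *\<^sub>R ?g y))"
          by (rule Bochner_Integration.integral_cong[OF refl])
        also have "\<dots> = F x * cnj (F (x + s)) * (LINT y|lborel. indicator {p2 - r..p2 + r} y *\<^sub>R ?g y)"
          by (rule integral_mult_right_zero)
        also have "(LINT y|lborel. indicator {p2 - r..p2 + r} y *\<^sub>R ?g y) = integral {p2 - r..p2 + r} ?g"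
        proof -
          have c: "continuous_on {p2 - r..p2 + r} ?g"
          proof -
            have "continuous_on {p2 - r..p2 + r} (\<lambda>y. ddiff (P 0 0) s \<tau> x y)"
              using ddiff_deriv[OF P] by (intro continuous_at_imp_continuous_on ballI DERIV_isCont)
            then show ?thesis using r by (intro continuous_intros) auto
          qed
          show ?thesis
            using set_borel_integral_eq_integral(2)[OF borel_integrable_atLeastAtMost'[OF c]]
            by (simp add: set_lebesgue_integral_def)
        qed
        finally have "cmod (LINT y|lborel. k x y * cnj (k (x + s) y))
            = cmod (F x * cnj (F (x + s))) * cmod (integral {p2 - r..p2 + r} ?g)"
          by (simp add: norm_mult)
        also have "\<dots> \<le> cmod (F x * cnj (F (x + s))) * (94 * r / (1 + (\<bar>l\<bar> * m * \<bar>\<tau>\<bar> * r / 2 * s)\<^sup>2))"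
          using False F(2)[of x] F(2)[of "x + s"]
          by (intro mult_left_mono kernel_bound[OF P r m l tame]) auto
        finally show ?thesis by (simp add: \<beta>_def)
      qed
      have "cmod (?I s) = cmod (LINT x|lborel. LINT y|lborel. k x y * cnj (k (x + s) y))"
        using lborel_fubini(1)[OF int] by simp
      also have "\<dots> \<le> (LINT x|lborel. cmod (F x * cnj (F (x + s))) * (94 * r / (1 + (\<beta> * s)\<^sup>2)))"
      proof (rule Bochner_Integration.integral_norm_bound_integral)
        show "integrable lborel (\<lambda>x. LINT y|lborel. k x y * cnj (k (x + s) y))"
          using lborel_fubini(3)[OF int] by simp
        show "integrable lborel (\<lambda>x. cmod (F x * cnj (F (x + s))) * (94 * r / (1 + (\<beta> * s)\<^sup>2)))"
          by (intro integrable_mult_left nice_integrable(2) nice_shift_product F(1))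
      qed (rule inner)
      also have "\<dots> = (LINT x|lborel. cmod (F x * cnj (F (x + s)))) * (94 * r / (1 + (\<beta> * s)\<^sup>2))" by simp
      also have "\<dots> \<le> (nrm F)\<^sup>2 * (94 * r / (1 + (\<beta> * s)\<^sup>2))"
        using nrm_shift_product_L1[OF F(1)] r by (intro mult_right_mono) auto
      finally show ?thesis using True by (simp add: abs_le_iff mult.commute)
    qed
    have "X = cmod (complex_of_real X)" by (simp add: X_def)
    also have "complex_of_real X = (LINT s|lborel. ?I s)" unfolding X_def by (rule TT(1))
    also have "cmod \<dots> \<le> (LINT s|lborel. indicator {- r..r} s *\<^sub>R (1 / (1 + (\<beta> * s)\<^sup>2)) * (94 * r * (nrm F)\<^sup>2))"
    proof (rule Bochner_Integration.integral_norm_bound_integral[OF TT(2)])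
      show "integrable lborel (\<lambda>s. indicator {- r..r} s *\<^sub>R (1 / (1 + (\<beta> * s)\<^sup>2)) * (94 * r * (nrm F)\<^sup>2))"
        using arctan_kernel_integral(1)[OF \<beta>, of r] r by (intro integrable_mult_left) auto
    qed (rule I_le)
    also have "\<dots> = (LINT s|lborel. indicator {- r..r} s *\<^sub>R (1 / (1 + (\<beta> * s)\<^sup>2))) * (94 * r * (nrm F)\<^sup>2)"
      by (rule integral_mult_left_zero)
    also have "\<dots> \<le> pi / \<beta> * (94 * r * (nrm F)\<^sup>2)"
      using arctan_kernel_integral(2)[OF \<beta>, of r] r by (intro mult_right_mono) auto
    \<comment> \<open>The factor r/2 inside \<open>\<beta>\<close> cancels the r of the kernel, so
      the estimate does not depend on the side.\<close>
    also have "\<dots> = 188 * pi / (\<bar>l\<bar> * m * \<bar>\<tau>\<bar>) * (nrm F)\<^sup>2"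
      using r l m \<tau> by (simp add: \<beta>_def field_simps)
    finally show ?thesis .
  qed
  have int: "integrable lborel (\<lambda>(x, y). E x y * F x * G y)"
  proof (rule integrable_2_bounded)
    show "(\<lambda>(x, y). E x y * F x * G y) \<in> borel_measurable borel"
      unfolding case_prod_unfold by (simp add: borel_prod[symmetric])
    show "norm (E x y * F x * G y) \<le> BF * BG" for x y
      using BF BG by (auto simp: E_def norm_mult intro!: mult_mono)
    show "\<bar>x\<bar> \<le> R \<and> \<bar>y\<bar> \<le> R" if "E x y * F x * G y \<noteq> 0" for x y
    proof -
      have "\<bar>x - p1\<bar> \<le> r / 2" "\<bar>y - p2\<bar> \<le> r / 2" using F(2)[of x] G(2)[of y] that by auto
      then show ?thesis unfolding R_def using r by linarith
    qed
  qed
  have X0: "0 \<le> X" unfolding X_def by (intro integral_nonneg_AE AE_I2) auto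
  have mk: "(\<lambda>y. cmod (LINT x|lborel. k x y)) \<in> borel_measurable lborel"
  proof -
    have "integrable lborel (case_prod k)"
      by (rule integrable_2_bounded[OF km kB kR])
    from borel_measurable_integrable[OF lborel_fubini(4)[OF this]] show ?thesis by simp
  qed
  have "cmod (LINT (x, y)|lborel. E x y * F x * G y) = cmod (LINT y|lborel. LINT x|lborel. E x y * F x * G y)"
    using lborel_fubini(2)[OF int] by simp
  also have "\<dots> \<le> (LINT y|lborel. (4 / 3) * \<bar>cmod (G y) * cmod (LINT x|lborel. k x y)\<bar>)"
  proof (rule Bochner_Integration.integral_norm_bound_integral)
    show "integrable lborel (\<lambda>y. LINT x|lborel. E x y * F x * G y)"
      using lborel_fubini(4)[OF int] by simp
    show "integrable lborel (\<lambda>y. (4 / 3) * \<bar>cmod (G y) * cmod (LINT x|lborel. k x y)\<bar>)"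
      using Cauchy_Schwarz_integral(1)[OF nice_integrable(3)[OF G(1)] _ TT(3) mk] by simp
    fix y
    have "(LINT x|lborel. k x y) = (LINT x|lborel. E x y * F x) * complex_of_real (w y)"
      unfolding k_def by simp
    then have kk: "cmod (LINT x|lborel. k x y) = cmod (LINT x|lborel. E x y * F x) * w y"
      using w01[of y] by (simp add: norm_mult)
    have gg: "(LINT x|lborel. E x y * F x * G y) = (LINT x|lborel. E x y * F x) * G y"
      by (rule integral_mult_left_zero)
    show "norm (LINT x|lborel. E x y * F x * G y) \<le> (4 / 3) * \<bar>cmod (G y) * cmod (LINT x|lborel. k x y)\<bar>"
    proof (cases "G y = 0")
      case False
      then have "1 \<le> (4 / 3) * w y" using w34[OF G(2)[of y]] by simp
      then have "cmod (LINT x|lborel. E x y * F x) * cmod (G y) * 1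
          \<le> cmod (LINT x|lborel. E x y * F x) * cmod (G y) * ((4 / 3) * w y)"
        by (intro mult_left_mono) auto
      moreover have "(4 / 3) * \<bar>cmod (G y) * (cmod (LINT x|lborel. E x y * F x) * w y)\<bar>
          = cmod (LINT x|lborel. E x y * F x) * cmod (G y) * ((4 / 3) * w y)"
        using w01[of y] by (simp add: abs_mult)
      ultimately show ?thesis unfolding gg kk norm_mult by linarith
    qed simp
  qed
  also have "\<dots> = (4 / 3) * (LINT y|lborel. \<bar>cmod (G y) * cmod (LINT x|lborel. k x y)\<bar>)" by simp
  also have "\<dots> \<le> (4 / 3) * (nrm G * sqrt X)"
    using Cauchy_Schwarz_integral(2)[OF nice_integrable(3)[OF G(1)] _ TT(3) mk]
    by (simp add: nrm_def X_def)
  also have "\<dots> \<le> 37 / sqrt (\<bar>l\<bar> * m * \<bar>\<tau>\<bar>) * nrm F * nrm G"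
  proof -
    define q where "q = sqrt (\<bar>l\<bar> * m * \<bar>\<tau>\<bar>)"
    define c where "c = sqrt (188 * pi)"
    have q0: "0 \<le> q" unfolding q_def using m by simp
    \<comment> \<open>27.75 = 37 * 3/4, so that the loss of 4/3 from the weight ends at 37.\<close>
    have "188 * pi \<le> (27.75::real)\<^sup>2" using pi_less_4 by (simp add: power2_eq_square)
    then have "c \<le> 27.75" unfolding c_def by (intro real_le_lsqrt) auto
    then have c: "(4 / 3) * c \<le> 37" by simp
    have "sqrt X \<le> sqrt (188 * pi / (\<bar>l\<bar> * m * \<bar>\<tau>\<bar>) * (nrm F)\<^sup>2)"
      using X_bound by (rule real_sqrt_le_mono)
    also have "\<dots> = c / q * nrm F"
      unfolding c_def q_def by (simp only: real_sqrt_mult real_sqrt_divide real_sqrt_abs abs_of_nonneg[OF nrm_nonneg])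
    finally have "(4 / 3) * (nrm G * sqrt X) \<le> (4 / 3) * (nrm G * (c / q * nrm F))"
      by (intro mult_left_mono) auto
    also have "\<dots> = ((4 / 3) * c) * (nrm F * nrm G / q)" by simp
    also have "\<dots> \<le> 37 * (nrm F * nrm G / q)" using c q0 by (intro mult_right_mono) auto
    also have "\<dots> = 37 / q * nrm F * nrm G" by simp
    finally show ?thesis unfolding q_def .
  qed
  finally show ?thesis unfolding E_def .
qed

subsection \<open>The trilinear form on a square\<close>

definition tform ::
    "real \<Rightarrow> (real \<Rightarrow> real \<Rightarrow> real) \<Rightarrow> (real \<Rightarrow> complex) \<Rightarrow> (real \<Rightarrow> complex) \<Rightarrow> (real \<Rightarrow> complex) \<Rightarrow> complex" where
  "tform l s f1 f2 f3 = (LINT (x, y)|lborel. cis (l * s x y) * f1 x * f2 y * f3 (x + y))"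

lemma trilinear_integrable:
  assumes P: "jet_family n P" and f: "nice f1" "nice f2" "nice f3"
  shows "integrable lborel (\<lambda>(x, y). cis (l * P 0 0 x y) * f1 x * f2 y * f3 (x + y))"
proof -
  note [measurable] = nice_meas[OF f(1)] nice_meas[OF f(2)] nice_meas[OF f(3)] jet_measurable[OF P]
  obtain B1 where B1: "\<And>x. cmod (f1 x) \<le> B1" "0 < B1" using nice_bound[OF f(1)] by auto
  obtain B2 where B2: "\<And>x. cmod (f2 x) \<le> B2" "0 < B2" using nice_bound[OF f(2)] by auto
  obtain B3 where B3: "\<And>x. cmod (f3 x) \<le> B3" "0 < B3" using nice_bound[OF f(3)] by auto
  obtain R1 where R1: "\<And>x. f1 x \<noteq> 0 \<Longrightarrow> \<bar>x\<bar> \<le> R1" using f by (auto simp: nice_def)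
  obtain R2 where R2: "\<And>x. f2 x \<noteq> 0 \<Longrightarrow> \<bar>x\<bar> \<le> R2" using f by (auto simp: nice_def)
  show ?thesis
  proof (rule integrable_2_bounded)
    show "(\<lambda>(x, y). cis (l * P 0 0 x y) * f1 x * f2 y * f3 (x + y)) \<in> borel_measurable borel"
      unfolding case_prod_unfold by (simp add: borel_prod[symmetric])
    show "norm (cis (l * P 0 0 x y) * f1 x * f2 y * f3 (x + y)) \<le> B1 * B2 * B3" for x y
      using B1 B2 B3 by (auto simp: norm_mult intro!: mult_mono)
    show "\<bar>x\<bar> \<le> \<bar>R1\<bar> + \<bar>R2\<bar> \<and> \<bar>y\<bar> \<le> \<bar>R1\<bar> + \<bar>R2\<bar>" if "cis (l * P 0 0 x y) * f1 x * f2 y * f3 (x + y) \<noteq> 0" for x y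
      using R1[of x] R2[of y] that by auto
  qed
qed

text \<open>Cauchy-Schwarz in the plane between f1(x), cut to the strip |y - p2| \<le> r/2, and
  f2(y) f3(x + y). The strip contributes its width r, and a shear turns the second factor into a
  product.\<close>

lemma tform_trivial_bound:
  assumes P: "jet_family n P" and r: "r > 0"
    and f: "nice f1" "nice f2" "nice f3"
    and supp2: "\<And>y. f2 y \<noteq> 0 \<Longrightarrow> \<bar>y - p2\<bar> \<le> r / 2"
  shows "cmod (tform l (P 0 0) f1 f2 f3) \<le> sqrt r * nrm f1 * nrm f2 * nrm f3"
proof -
  note [measurable] = nice_meas[OF f(1)] nice_meas[OF f(2)] nice_meas[OF f(3)] jet_measurable[OF P]
  let ?ind = "indicator {p2 - r / 2..p2 + r / 2} :: real \<Rightarrow> real"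
  let ?a = "\<lambda>z::real \<times> real. cmod (f1 (fst z)) * ?ind (snd z)"
  let ?b = "\<lambda>z::real \<times> real. cmod (f2 (snd z)) * cmod (f3 (fst z + snd z))"
  obtain B1 where B1: "\<And>x. cmod (f1 x) \<le> B1" "0 < B1" using nice_bound[OF f(1)] by auto
  obtain B2 where B2: "\<And>x. cmod (f2 x) \<le> B2" "0 < B2" using nice_bound[OF f(2)] by auto
  obtain B3 where B3: "\<And>x. cmod (f3 x) \<le> B3" "0 < B3" using nice_bound[OF f(3)] by auto
  obtain R1 where R1: "\<And>x. f1 x \<noteq> 0 \<Longrightarrow> \<bar>x\<bar> \<le> R1" using f by (auto simp: nice_def)
  obtain R2 where R2: "\<And>x. f2 x \<noteq> 0 \<Longrightarrow> \<bar>x\<bar> \<le> R2" using f by (auto simp: nice_def)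
  obtain R3 where R3: "\<And>x. f3 x \<noteq> 0 \<Longrightarrow> \<bar>x\<bar> \<le> R3" using f by (auto simp: nice_def)
  have ia: "integrable lborel (\<lambda>(x, y). (cmod (f1 x) * ?ind y)\<^sup>2)"
  proof (rule integrable_2_bounded)
    show "(\<lambda>(x, y). (cmod (f1 x) * ?ind y)\<^sup>2) \<in> borel_measurable borel"
      unfolding case_prod_unfold by (simp add: borel_prod[symmetric])
    show "norm ((cmod (f1 x) * ?ind y)\<^sup>2) \<le> B1\<^sup>2" for x y
      using B1 by (auto simp: indicator_def intro!: power_mono)
    show "\<bar>x\<bar> \<le> \<bar>R1\<bar> + \<bar>p2\<bar> + r \<and> \<bar>y\<bar> \<le> \<bar>R1\<bar> + \<bar>p2\<bar> + r" if "(cmod (f1 x) * ?ind y)\<^sup>2 \<noteq> 0" for x y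
    proof -
      have "f1 x \<noteq> 0" "p2 - r / 2 \<le> y" "y \<le> p2 + r / 2" using that by (auto simp: indicator_def split: if_splits)
      then show ?thesis using R1[of x] r by linarith
    qed
  qed
  have ib: "integrable lborel (\<lambda>(x, y). (cmod (f2 y) * cmod (f3 (x + y)))\<^sup>2)"
  proof (rule integrable_2_bounded)
    show "(\<lambda>(x, y). (cmod (f2 y) * cmod (f3 (x + y)))\<^sup>2) \<in> borel_measurable borel"
      unfolding case_prod_unfold by (simp add: borel_prod[symmetric])
    show "norm ((cmod (f2 y) * cmod (f3 (x + y)))\<^sup>2) \<le> (B2 * B3)\<^sup>2" for x y
      using B2 B3 by (auto intro!: power_mono mult_mono)
    show "\<bar>x\<bar> \<le> \<bar>R2\<bar> + \<bar>R3\<bar> \<and> \<bar>y\<bar> \<le> \<bar>R2\<bar> + \<bar>R3\<bar>" if "(cmod (f2 y) * cmod (f3 (x + y)))\<^sup>2 \<noteq> 0" for x y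
    proof -
      have "f2 y \<noteq> 0" "f3 (x + y) \<noteq> 0" using that by auto
      then show ?thesis using R2[of y] R3[of "x + y"] by linarith
    qed
  qed
  have indic_sq: "(?ind y)\<^sup>2 = ?ind y" for y by (simp add: indicator_def)
  have ea: "(LINT z|lborel. (?a z)\<^sup>2) = r * (nrm f1)\<^sup>2"
  proof -
    have "(LINT z|lborel. (?a z)\<^sup>2) = (LINT x|lborel. LINT y|lborel. (cmod (f1 x))\<^sup>2 * ?ind y)"
      using lborel_fubini(1)[OF ia] by (simp add: case_prod_unfold power_mult_distrib indic_sq)
    also have "\<dots> = (LINT x|lborel. (cmod (f1 x))\<^sup>2 * r)" using r by simp
    also have "\<dots> = r * (nrm f1)\<^sup>2" by (simp add: nrm_sq)
    finally show ?thesis .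
  qed
  have eb: "(LINT z|lborel. (?b z)\<^sup>2) = (nrm f2)\<^sup>2 * (nrm f3)\<^sup>2"
  proof -
    have "(LINT z|lborel. (?b z)\<^sup>2) = (LINT y|lborel. LINT x|lborel. (cmod (f2 y))\<^sup>2 * (cmod (f3 (x + y)))\<^sup>2)"
      using lborel_fubini(2)[OF ib] by (simp add: case_prod_unfold power_mult_distrib)
    also have "\<dots> = (LINT y|lborel. (cmod (f2 y))\<^sup>2 * (nrm f3)\<^sup>2)"
    proof (rule Bochner_Integration.integral_cong[OF refl])
      fix y
      show "(LINT x|lborel. (cmod (f2 y))\<^sup>2 * (cmod (f3 (x + y)))\<^sup>2) = (cmod (f2 y))\<^sup>2 * (nrm f3)\<^sup>2"
        unfolding integral_mult_right_zero nrm_sq lborel_translate(1)[of "\<lambda>x. (cmod (f3 x))\<^sup>2" y] ..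
    qed
    also have "\<dots> = (nrm f2)\<^sup>2 * (nrm f3)\<^sup>2" by (simp add: nrm_sq)
    finally show ?thesis .
  qed
  have ma: "?a \<in> borel_measurable lborel" and mb: "?b \<in> borel_measurable lborel"
    by (simp_all add: borel_prod[symmetric])
  have ia': "integrable lborel (\<lambda>z. (?a z)\<^sup>2)" and ib': "integrable lborel (\<lambda>z. (?b z)\<^sup>2)"
    using ia ib by (simp_all add: case_prod_unfold)
  have "cmod (tform l (P 0 0) f1 f2 f3) \<le> (LINT z|lborel. \<bar>?a z * ?b z\<bar>)"
    unfolding tform_def
  proof (rule Bochner_Integration.integral_norm_bound_integral[OF trilinear_integrable[OF P f]])
    show "integrable lborel (\<lambda>z. \<bar>?a z * ?b z\<bar>)"
      using Cauchy_Schwarz_integral(1)[OF ia' ma ib' mb] by (rule integrable_abs)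
    fix z :: "real \<times> real"
    obtain x y where z: "z = (x, y)" by (cases z)
    show "norm (case z of (x, y) \<Rightarrow> cis (l * P 0 0 x y) * f1 x * f2 y * f3 (x + y)) \<le> \<bar>?a z * ?b z\<bar>"
    proof (cases "f2 y = 0")
      case False
      then have "\<bar>y - p2\<bar> \<le> r / 2" by (rule supp2)
      then have "p2 - r / 2 \<le> y" "y \<le> p2 + r / 2" by linarith+
      then have "y \<in> {p2 - r / 2..p2 + r / 2}" by simp
      then show ?thesis by (simp add: z norm_mult abs_mult)
    qed (simp add: z)
  qed
  also have "\<dots> \<le> sqrt (r * (nrm f1)\<^sup>2) * sqrt ((nrm f2)\<^sup>2 * (nrm f3)\<^sup>2)"
    using Cauchy_Schwarz_integral(2)[OF ia' ma ib' mb] unfolding ea eb .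
  also have "\<dots> = sqrt r * nrm f1 * nrm f2 * nrm f3" by (simp add: real_sqrt_mult)
  finally show ?thesis .
qed

text \<open>Squaring in u = x + y leaves an integral over shifts t of bilinear forms in f1(x) cnj
  f1(x + t) and f2(y) cnj f2(y - t). Shifts up to \<delta> are bounded trivially, larger ones by
  \<open>bilinear_bound\<close>. The choice \<delta> = (|l| m)^(-1/3) balances both parts, and the
  square root of \<delta> gives the exponent -1/6.\<close>

lemma tform_box_bound:
  assumes P: "jet_family n P" and r: "r > 0" and m: "m > 0" and l: "l \<noteq> 0"
    and tame: "tame_on_box (curv P) p1 p2 r m"
    and f: "nice f1" "nice f2" "nice f3"
    and supp1: "\<And>x. f1 x \<noteq> 0 \<Longrightarrow> \<bar>x - p1\<bar> \<le> r / 2"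
    and supp2: "\<And>y. f2 y \<noteq> 0 \<Longrightarrow> \<bar>y - p2\<bar> \<le> r / 2"
  shows "cmod (tform l (P 0 0) f1 f2 f3) \<le> 7 * (\<bar>l\<bar> * m) powr (- 1 / 6) * nrm f1 * nrm f2 * nrm f3"
proof -
  note [measurable] = nice_meas[OF f(1)] nice_meas[OF f(2)] nice_meas[OF f(3)] jet_measurable[OF P]
  obtain B1 where B1: "\<And>x. cmod (f1 x) \<le> B1" "0 < B1" using nice_bound[OF f(1)] by auto
  obtain B2 where B2: "\<And>x. cmod (f2 x) \<le> B2" "0 < B2" using nice_bound[OF f(2)] by auto
  \<comment> \<open>Here u stands for x + y, so that f3 depends on u alone and can be split
    off.\<close>
  define k where "k x u = cis (l * P 0 0 x (u - x)) * f1 x * f2 (u - x)" for x u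
  define k3 where "k3 x u = k x u * f3 u" for x u
  have km: "case_prod k \<in> borel_measurable borel"
    unfolding k_def case_prod_unfold by (simp add: borel_prod[symmetric])
  note [measurable] = measurable_curried[OF km]
  have kB: "cmod (k x u) \<le> B1 * B2" for x u
    unfolding k_def using B1 B2 by (auto simp: norm_mult intro!: mult_mono)
  define R where "R = \<bar>p1\<bar> + \<bar>p2\<bar> + 2 * r"
  have kR: "\<forall>x u. k x u \<noteq> 0 \<longrightarrow> \<bar>x\<bar> \<le> R \<and> \<bar>u\<bar> \<le> R"
  proof (intro allI impI)
    fix x u assume "k x u \<noteq> 0"
    then have "\<bar>x - p1\<bar> \<le> r / 2" "\<bar>(u - x) - p2\<bar> \<le> r / 2" using supp1[of x] supp2[of "u - x"] by (auto simp: k_def)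
    then show "\<bar>x\<bar> \<le> R \<and> \<bar>u\<bar> \<le> R" unfolding R_def using r by linarith
  qed
  note TT = TT_star_identity[of k "B1 * B2" R, OF km kB kR]
  define X where "X = (LINT u|lborel. (cmod (LINT x|lborel. k x u))\<^sup>2)"
  have ik: "integrable lborel (case_prod k)"
    using kR by (intro integrable_2_bounded[OF km kB]) auto
  have mk: "(\<lambda>u. cmod (LINT x|lborel. k x u)) \<in> borel_measurable lborel"
    using borel_measurable_integrable[OF lborel_fubini(4)[OF ik]] by simp
  have T_le: "cmod (tform l (P 0 0) f1 f2 f3) \<le> nrm f3 * sqrt X"
  proof -
    note int = trilinear_integrable[OF P f, of l]
    have "tform l (P 0 0) f1 f2 f3 = (LINT x|lborel. LINT y|lborel. cis (l * P 0 0 x y) * f1 x * f2 y * f3 (x + y))"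
      unfolding tform_def using lborel_fubini(1)[OF int] by simp
    also have "\<dots> = (LINT x|lborel. LINT u|lborel. k3 x u)"
    proof (rule Bochner_Integration.integral_cong[OF refl])
      fix x
      show "(LINT y|lborel. cis (l * P 0 0 x y) * f1 x * f2 y * f3 (x + y)) = (LINT u|lborel. k3 x u)"
        using lborel_translate(1)[of "\<lambda>y. cis (l * P 0 0 x y) * f1 x * f2 y * f3 (x + y)" "- x"]
        by (simp add: k3_def k_def)
    qed
    also have "\<dots> = (LINT u|lborel. LINT x|lborel. k3 x u)"
    proof -
      obtain B3 where B3: "\<And>x. cmod (f3 x) \<le> B3" "0 < B3" using nice_bound[OF f(3)] by auto
      have "integrable lborel (\<lambda>(x, u). k3 x u)"
      proof (rule integrable_2_bounded)
        show "(\<lambda>(x, u). k3 x u) \<in> borel_measurable borel"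
          unfolding k3_def case_prod_unfold by (simp add: borel_prod[symmetric])
        show "norm (k3 x u) \<le> B1 * B2 * B3" for x u
          unfolding k3_def norm_mult using kB B1 B2 B3 by (intro mult_mono) auto
        show "\<bar>x\<bar> \<le> R \<and> \<bar>u\<bar> \<le> R" if "k3 x u \<noteq> 0" for x u
          using kR that by (auto simp: k3_def)
      qed
      from lborel_fubini(1,2)[OF this] show ?thesis by simp
    qed
    also have "\<dots> = (LINT u|lborel. (LINT x|lborel. k x u) * f3 u)"
      unfolding k3_def by (simp only: integral_mult_left_zero)
    finally have "cmod (tform l (P 0 0) f1 f2 f3) \<le> (LINT u|lborel. norm ((LINT x|lborel. k x u) * f3 u))"
      by (simp only: integral_norm_bound)
    also have "\<dots> = (LINT u|lborel. \<bar>cmod (f3 u) * cmod (LINT x|lborel. k x u)\<bar>)"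
      by (simp add: norm_mult abs_mult mult.commute)
    also have "\<dots> \<le> nrm f3 * sqrt X"
      using Cauchy_Schwarz_integral(2)[OF nice_integrable(3)[OF f(3)] _ TT(3) mk]
      by (simp add: nrm_def X_def)
    finally show ?thesis .
  qed
  define F where "F = (\<lambda>t x. f1 x * cnj (f1 (x + t)))"
  define G where "G = (\<lambda>t y. f2 y * cnj (f2 (y + - t)))"
  have nF: "nice (F t)" and nG: "nice (G t)" for t
    unfolding F_def G_def by (intro nice_shift_product f)+
  define A where "A t = (LINT (x, u)|lborel. k x u * cnj (k (x + t) u))" for t
  have A_eq: "A t = (LINT (x, y)|lborel. cis (l * (P 0 0 x y - P 0 0 (x + t) (y - t))) * F t x * G t y)"
    and A_triv: "cmod (A t) \<le> (nrm f1)\<^sup>2 * (nrm f2)\<^sup>2" for t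
  proof -
    let ?B = "\<bar>B1 * B2\<bar> * \<bar>B1 * B2\<bar>"
    let ?e = "\<lambda>x y. cis (l * (P 0 0 x y - P 0 0 (x + t) (y - t))) * F t x * G t y"
    have int1: "integrable lborel (\<lambda>(x, u). k x u * cnj (k (x + t) u))"
    proof (rule integrable_2_bounded)
      show "(\<lambda>(x, u). k x u * cnj (k (x + t) u)) \<in> borel_measurable borel"
        unfolding case_prod_unfold by (simp add: borel_prod[symmetric])
      show "norm (k x u * cnj (k (x + t) u)) \<le> ?B" for x u
        using kB[of x u] kB[of "x + t" u] B1(2) B2(2) by (auto simp: norm_mult intro!: mult_mono)
      show "\<bar>x\<bar> \<le> R \<and> \<bar>u\<bar> \<le> R" if "k x u * cnj (k (x + t) u) \<noteq> 0" for x u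
        using kR that by auto
    qed
    have [measurable]: "F t \<in> borel_measurable borel" "G t \<in> borel_measurable borel"
      by (rule nice_meas[OF nF], rule nice_meas[OF nG])
    obtain BF where BF: "\<And>x. cmod (F t x) \<le> BF" "0 < BF" using nice_bound[OF nF] by blast
    obtain BG where BG: "\<And>x. cmod (G t x) \<le> BG" "0 < BG" using nice_bound[OF nG] by blast
    have FR: "\<bar>x\<bar> \<le> R" if "F t x \<noteq> 0" for x
    proof -
      have "\<bar>x - p1\<bar> \<le> r / 2" using that by (intro supp1) (auto simp: F_def)
      then show ?thesis unfolding R_def using r by linarith
    qed
    have GR: "\<bar>y\<bar> \<le> R" if "G t y \<noteq> 0" for y
    proof -
      have "\<bar>y - p2\<bar> \<le> r / 2" using that by (intro supp2) (auto simp: G_def)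
      then show ?thesis unfolding R_def using r by linarith
    qed
    have int2: "integrable lborel (\<lambda>(x, y). ?e x y)"
    proof (rule integrable_2_bounded)
      show "(\<lambda>(x, y). ?e x y) \<in> borel_measurable borel"
        unfolding case_prod_unfold by (simp add: borel_prod[symmetric])
      show "norm (?e x y) \<le> BF * BG" for x y
        using BF BG by (auto simp: norm_mult intro!: mult_mono)
      show "\<bar>x\<bar> \<le> R \<and> \<bar>y\<bar> \<le> R" if "?e x y \<noteq> 0" for x y
        using FR GR that by auto
    qed
    have int3: "integrable lborel (\<lambda>(x, y). cmod (F t x) * cmod (G t y))"
    proof (rule integrable_2_bounded)
      show "(\<lambda>(x, y). cmod (F t x) * cmod (G t y)) \<in> borel_measurable borel"
        unfolding case_prod_unfold by (simp add: borel_prod[symmetric])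
      show "norm (cmod (F t x) * cmod (G t y)) \<le> BF * BG" for x y
        using BF BG by (auto simp: norm_mult abs_mult intro!: mult_mono)
      show "\<bar>x\<bar> \<le> R \<and> \<bar>y\<bar> \<le> R" if "cmod (F t x) * cmod (G t y) \<noteq> 0" for x y
        using FR GR that by auto
    qed
    have "A t = (LINT x|lborel. LINT u|lborel. k x u * cnj (k (x + t) u))"
      unfolding A_def using lborel_fubini(1)[OF int1] by simp
    also have "\<dots> = (LINT x|lborel. LINT y|lborel. ?e x y)"
    proof (rule Bochner_Integration.integral_cong[OF refl])
      fix x
      have "k x (y + x) * cnj (k (x + t) (y + x)) = ?e x y" for y
        by (simp add: k_def F_def G_def right_diff_distrib cis_divide[symmetric] cis_cnj[symmetric] cis_inverse[symmetric] divide_inverse)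
      then show "(LINT u|lborel. k x u * cnj (k (x + t) u)) = (LINT y|lborel. ?e x y)"
        using lborel_translate(1)[of "\<lambda>u. k x u * cnj (k (x + t) u)" x] by simp
    qed
    also have "\<dots> = (LINT (x, y)|lborel. ?e x y)"
      using lborel_fubini(1)[OF int2] by simp
    finally show "A t = (LINT (x, y)|lborel. ?e x y)" .
    then have "cmod (A t) \<le> (LINT (x, y)|lborel. cmod (F t x) * cmod (G t y))"
      using Bochner_Integration.integral_norm_bound_integral[OF int2 int3] by (auto simp: norm_mult)
    also have "\<dots> = (LINT x|lborel. LINT y|lborel. cmod (F t x) * cmod (G t y))"
      using lborel_fubini(1)[OF int3] by simp
    also have "\<dots> = (LINT x|lborel. cmod (F t x)) * (LINT y|lborel. cmod (G t y))" by simp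
    also have "\<dots> \<le> (nrm f1)\<^sup>2 * (nrm f2)\<^sup>2"
      using nrm_shift_product_L1[OF f(1), of t] nrm_shift_product_L1[OF f(2), of "- t"]
      unfolding F_def G_def by (intro mult_mono) auto
    finally show "cmod (A t) \<le> (nrm f1)\<^sup>2 * (nrm f2)\<^sup>2" .
  qed
  define Y where "Y = \<bar>l\<bar> * m"
  have Y: "Y > 0" using l m by (simp add: Y_def)
  have A_osc: "cmod (A t) \<le> 37 / sqrt (Y * \<bar>t\<bar>) * nrm (F t) * nrm (G t)" if "t \<noteq> 0" for t
    unfolding A_eq Y_def
    by (rule bilinear_bound[OF P r m l that tame nF _ nG])
      (use supp1 supp2 in \<open>auto simp: F_def G_def\<close>)
  define \<delta> where "\<delta> = Y powr (- 1 / 3)"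
  have \<delta>: "\<delta> > 0" using Y by (simp add: \<delta>_def)
  define Z where "Z = 37 / sqrt (Y * \<delta>)"
  have Z0: "0 \<le> Z" using Y \<delta> by (simp add: Z_def)
  have iF: "integrable lborel (\<lambda>t. (nrm (F t))\<^sup>2)" "(LINT t|lborel. (nrm (F t))\<^sup>2) = (nrm f1) ^ 4"
    using nrm_shift_product_L2[OF f(1)] by (simp_all add: F_def)
  have iG: "integrable lborel (\<lambda>t. (nrm (G t))\<^sup>2)" "(LINT t|lborel. (nrm (G t))\<^sup>2) = (nrm f2) ^ 4"
    using integrable_reflect[OF nrm_shift_product_L2(1)[OF f(2)]] nrm_shift_product_L2(2)[OF f(2)]
      lborel_reflect[of "\<lambda>t. (nrm (\<lambda>x. f2 x * cnj (f2 (x + t))))\<^sup>2"]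
    by (simp_all add: G_def)
  have mF: "(\<lambda>t. nrm (F t)) \<in> borel_measurable lborel" and mG: "(\<lambda>t. nrm (G t)) \<in> borel_measurable lborel"
    using measurable_compose[OF borel_measurable_integrable[OF iF(1)] borel_measurable_sqrt]
      measurable_compose[OF borel_measurable_integrable[OF iG(1)] borel_measurable_sqrt] by simp_all
  note CS = Cauchy_Schwarz_integral[OF iF(1) mF iG(1) mG]
  have X_bound: "X \<le> (2 * \<delta> + Z) * ((nrm f1)\<^sup>2 * (nrm f2)\<^sup>2)"
  proof -
    let ?i = "indicator {- \<delta>..\<delta>} :: real \<Rightarrow> real"
    have ii: "integrable lborel ?i"
      using \<delta> by (intro integrable_real_indicator) auto
    have "X = cmod (complex_of_real X)" by (simp add: X_def)
    also have "complex_of_real X = (LINT t|lborel. A t)" unfolding X_def A_def by (rule TT(1))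
    also have "cmod \<dots> \<le> (LINT t|lborel. ?i t * ((nrm f1)\<^sup>2 * (nrm f2)\<^sup>2) + Z * \<bar>nrm (F t) * nrm (G t)\<bar>)"
    proof (rule Bochner_Integration.integral_norm_bound_integral)
      show "integrable lborel A" unfolding A_def by (rule TT(2))
      show "integrable lborel (\<lambda>t. ?i t * ((nrm f1)\<^sup>2 * (nrm f2)\<^sup>2) + Z * \<bar>nrm (F t) * nrm (G t)\<bar>)"
        using CS(1) by (intro Bochner_Integration.integrable_add integrable_mult_left integrable_mult_right integrable_abs ii) auto
      fix t
      show "cmod (A t) \<le> ?i t * ((nrm f1)\<^sup>2 * (nrm f2)\<^sup>2) + Z * \<bar>nrm (F t) * nrm (G t)\<bar>"
      proof (cases "\<bar>t\<bar> \<le> \<delta>")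
        case True
        then have "?i t = 1" by (auto simp: abs_le_iff)
        moreover have "0 \<le> Z * \<bar>nrm (F t) * nrm (G t)\<bar>" using Z0 by simp
        ultimately show ?thesis using A_triv[of t] by simp
      next
        case False
        then have t: "t \<noteq> 0" "\<delta> \<le> \<bar>t\<bar>" using \<delta> by auto
        have "cmod (A t) \<le> 37 / sqrt (Y * \<bar>t\<bar>) * (nrm (F t) * nrm (G t))"
          using A_osc[OF t(1)] by (simp add: mult.assoc)
        also have "\<dots> \<le> Z * (nrm (F t) * nrm (G t))"
          unfolding Z_def using t Y \<delta> by (intro mult_right_mono divide_left_mono mult_left_mono mult_pos_pos) auto
        finally show ?thesis using False by (auto simp: abs_mult indicator_def)
      qed
    qed
    also have "\<dots> = 2 * \<delta> * ((nrm f1)\<^sup>2 * (nrm f2)\<^sup>2) + Z * (LINT t|lborel. \<bar>nrm (F t) * nrm (G t)\<bar>)"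
      using CS(1) \<delta> ii by (subst Bochner_Integration.integral_add) auto
    also have "\<dots> \<le> 2 * \<delta> * ((nrm f1)\<^sup>2 * (nrm f2)\<^sup>2) + Z * (sqrt ((nrm f1) ^ 4) * sqrt ((nrm f2) ^ 4))"
      using CS(2) Z0 unfolding iF iG by (intro add_left_mono mult_left_mono) auto
    also have "\<dots> = (2 * \<delta> + Z) * ((nrm f1)\<^sup>2 * (nrm f2)\<^sup>2)"
    proof -
      have s4: "sqrt (a ^ 4) = a\<^sup>2" if "0 \<le> a" for a :: real
        using that by (intro real_sqrt_unique) (auto simp flip: power_mult)
      show ?thesis by (simp add: s4 algebra_simps)
    qed
    finally show ?thesis .
  qed
  have "sqrt X \<le> 7 * Y powr (- 1 / 6) * (nrm f1 * nrm f2)"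
  proof (rule real_le_lsqrt)
    have "sqrt (Y * \<delta>) = Y powr (1 / 3)"
    proof -
      have "Y * \<delta> = Y powr (2 / 3)" using Y powr_add[of Y 1 "- 1 / 3"] by (simp add: \<delta>_def)
      then show ?thesis using Y by (simp add: powr_half_sqrt[symmetric] powr_powr)
    qed
    moreover have "Y powr (- 1 / 3) = 1 / Y powr (1 / 3)" using powr_minus_divide[of Y "1 / 3"] by simp
    ultimately have "Z = 37 * \<delta>" by (simp add: Z_def \<delta>_def)
    \<comment> \<open>Both ranges of shifts now contribute multiples of \<delta>: 2 + 37 = 39 \<le>
      49 = 7^2.\<close>
    then have "X \<le> 39 * \<delta> * ((nrm f1)\<^sup>2 * (nrm f2)\<^sup>2)" using X_bound by simp
    also have "\<dots> \<le> 49 * \<delta> * ((nrm f1)\<^sup>2 * (nrm f2)\<^sup>2)" using \<delta> by (intro mult_right_mono) auto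
    also have "49 * \<delta> = (7 * Y powr (- 1 / 6))\<^sup>2"
    proof -
      have "\<delta> = Y powr (- 1 / 6) * Y powr (- 1 / 6)" by (simp add: \<delta>_def flip: powr_add)
      then show ?thesis by (simp add: power2_eq_square)
    qed
    finally show "X \<le> (7 * Y powr (- 1 / 6) * (nrm f1 * nrm f2))\<^sup>2"
      by (simp add: power_mult_distrib)
  qed (auto simp: X_def intro!: integral_nonneg_AE)
  then have "nrm f3 * sqrt X \<le> nrm f3 * (7 * Y powr (- 1 / 6) * (nrm f1 * nrm f2))"
    by (intro mult_left_mono) auto
  with T_le show ?thesis unfolding Y_def by (simp add: ac_simps)
qed

subsection \<open>The stopping-time decomposition\<close>

definition restr :: "real set \<Rightarrow> (real \<Rightarrow> complex) \<Rightarrow> real \<Rightarrow> complex" where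
  "restr A f = (\<lambda>x. if x \<in> A then f x else 0)"

lemma restr_supp: "restr A f x \<noteq> 0 \<Longrightarrow> x \<in> A"
  by (auto simp: restr_def split: if_splits)

lemma nice_restr:
  assumes "nice f" and [measurable]: "A \<in> sets borel"
  shows "nice (restr A f)"
proof -
  note [measurable] = nice_meas[OF assms(1)]
  obtain B where B: "\<And>x. cmod (f x) \<le> B" "0 < B" using nice_bound[OF assms(1)] by auto
  obtain R where R: "\<And>x. f x \<noteq> 0 \<Longrightarrow> \<bar>x\<bar> \<le> R" using assms by (auto simp: nice_def)
  have "restr A f \<in> borel_measurable borel" unfolding restr_def by measurable
  moreover have "cmod (restr A f x) \<le> B" for x using B by (auto simp: restr_def intro: less_imp_le)
  moreover have "restr A f x \<noteq> 0 \<Longrightarrow> \<bar>x\<bar> \<le> R" for x using R by (auto simp: restr_def split: if_splits)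
  ultimately show ?thesis unfolding nice_def by blast
qed

text \<open>Integrates the pointwise overlap bound against |f|^2. The weights allow a second
  application in which they carry the local norms of another function.\<close>

lemma weighted_restr_sum:
  fixes w :: "'i \<Rightarrow> real"
  assumes f: "nice f" and F: "finite F" and A: "\<And>i. i \<in> F \<Longrightarrow> A i \<in> sets borel"
    and B: "\<And>x. (\<Sum>i\<in>F. w i * indicator (A i) x) \<le> B"
  shows "(\<Sum>i\<in>F. w i * (nrm (restr (A i) f))\<^sup>2) \<le> B * (nrm f)\<^sup>2"
proof -
  have i: "integrable lborel (\<lambda>x. w i * (cmod (restr (A i) f x))\<^sup>2)" if "i \<in> F" for i
    using nice_integrable(3)[OF nice_restr[OF f A[OF that]]] by simp
  have "(\<Sum>i\<in>F. w i * (nrm (restr (A i) f))\<^sup>2) = (\<Sum>i\<in>F. LINT x|lborel. w i * (cmod (restr (A i) f x))\<^sup>2)"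
    by (simp add: nrm_sq)
  also have "\<dots> = (LINT x|lborel. (\<Sum>i\<in>F. w i * (cmod (restr (A i) f x))\<^sup>2))"
    using i by (rule Bochner_Integration.integral_sum[symmetric])
  also have "\<dots> \<le> (LINT x|lborel. B * (cmod (f x))\<^sup>2)"
  proof (rule integral_mono)
    show "integrable lborel (\<lambda>x. \<Sum>i\<in>F. w i * (cmod (restr (A i) f x))\<^sup>2)"
      using i by (rule Bochner_Integration.integrable_sum)
    show "integrable lborel (\<lambda>x. B * (cmod (f x))\<^sup>2)" using nice_integrable(3)[OF f] by simp
    fix x
    have "(\<Sum>i\<in>F. w i * (cmod (restr (A i) f x))\<^sup>2) = (\<Sum>i\<in>F. w i * indicator (A i) x) * (cmod (f x))\<^sup>2"
      unfolding sum_distrib_right by (intro sum.cong refl) (auto simp: restr_def indicator_def)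
    also have "\<dots> \<le> B * (cmod (f x))\<^sup>2" using B by (intro mult_right_mono) auto
    finally show "(\<Sum>i\<in>F. w i * (cmod (restr (A i) f x))\<^sup>2) \<le> B * (cmod (f x))\<^sup>2" .
  qed
  also have "\<dots> = B * (nrm f)\<^sup>2" by (simp add: nrm_sq)
  finally show ?thesis .
qed

definition ival :: "nat \<Rightarrow> int \<Rightarrow> real set" where
  "ival g a = {x. \<lfloor>x * 2 ^ g\<rfloor> = a}"

text \<open>Contains every x + y with x in \<open>ival g a\<close> and y in
  \<open>ival g b\<close>.\<close>

definition band :: "nat \<Rightarrow> int \<Rightarrow> int \<Rightarrow> real set" where
  "band g a b = {u. \<bar>u - (ctr g a + ctr g b)\<bar> \<le> side g}"

lemma ival_borel [measurable]: "ival g a \<in> sets borel"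
proof -
  have "ival g a = {x. of_int a \<le> x * 2 ^ g \<and> x * 2 ^ g < of_int a + 1}"
    by (auto simp: ival_def floor_eq_iff)
  also have "\<dots> \<in> sets borel" by measurable
  finally show ?thesis .
qed

lemma band_borel [measurable]: "band g a b \<in> sets borel"
  unfolding band_def by measurable

lemma ival_near: "x \<in> ival g a \<Longrightarrow> \<bar>x - ctr g a\<bar> \<le> side g / 2"
  using ctr_floor[of x g] by (auto simp: ival_def)

lemma sum_indicator_le_card:
  assumes "finite F" "card {i \<in> F. P i} \<le> N"
  shows "(\<Sum>i\<in>F. if P i then 1 else 0 :: real) \<le> real N"
  using assms by (simp add: sum.If_cases Int_def)

definition sq_prod ::
    "(real \<Rightarrow> complex) \<Rightarrow> (real \<Rightarrow> complex) \<Rightarrow> (real \<Rightarrow> complex) \<Rightarrow> square \<Rightarrow> real" where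
  "sq_prod f1 f2 f3 = (\<lambda>(g, a, b). nrm (restr (ival g a) f1) * nrm (restr (ival g b) f2) * nrm (restr (band g a b) f3))"

lemma sq_prod_nonneg: "0 \<le> sq_prod f1 f2 f3 Q"
  by (cases Q) (simp add: sq_prod_def)

text \<open>f1 is paired against f2 and f3 together, and its local norms are summed with the count
  over a vertical line. For the pair, the overlap bound is applied in y with the norms of f3 as
  weights, and for fixed y once more in u = x + y; then (u - y, y) is a point near every square
  involved, so the count near points suffices.\<close>

lemma family_sum:
  assumes f: "nice f1" "nice f2" "nice f3" and F: "finite F"
    and line: "\<And>x::real. card {(g, a, b). (g, a, b) \<in> F \<and> a = \<lfloor>x * 2 ^ g\<rfloor>} \<le> N1"
    and pt: "\<And>s t::real. card {(g, a, b). (g, a, b) \<in> F \<and> \<bar>s - ctr g a\<bar> \<le> 2 * side g \<and> \<bar>t - ctr g b\<bar> \<le> 2 * side g} \<le> N2"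
  shows "(\<Sum>Q\<in>F. sq_prod f1 f2 f3 Q) \<le> sqrt (real N1 * real N2) * (nrm f1 * nrm f2 * nrm f3)"
proof -
  define \<alpha> where "\<alpha> = (\<lambda>(g, a, b::int). nrm (restr (ival g a) f1))"
  define \<beta> where "\<beta> = (\<lambda>(g, a::int, b). nrm (restr (ival g b) f2))"
  define \<gamma> where "\<gamma> = (\<lambda>(g, a, b). nrm (restr (band g a b) f3))"
  have s1: "(\<Sum>Q\<in>F. (\<alpha> Q)\<^sup>2) \<le> real N1 * (nrm f1)\<^sup>2"
  proof -
    have "(\<Sum>Q\<in>F. 1 * (nrm (restr (case Q of (g, a, b) \<Rightarrow> ival g a) f1))\<^sup>2) \<le> real N1 * (nrm f1)\<^sup>2"
    proof (rule weighted_restr_sum[OF f(1) F])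
      fix x
      have "(\<Sum>Q\<in>F. 1 * indicator (case Q of (g, a, b) \<Rightarrow> ival g a) x)
          = (\<Sum>Q\<in>F. if (case Q of (g, a, b) \<Rightarrow> a = \<lfloor>x * 2 ^ g\<rfloor>) then 1 else 0 :: real)"
        by (intro sum.cong refl) (auto simp: ival_def indicator_def split: prod.splits)
      also have "\<dots> \<le> real N1"
      proof (rule sum_indicator_le_card[OF F])
        have "{Q \<in> F. case Q of (g, a, b) \<Rightarrow> a = \<lfloor>x * 2 ^ g\<rfloor>} = {(g, a, b). (g, a, b) \<in> F \<and> a = \<lfloor>x * 2 ^ g\<rfloor>}" by auto
        then show "card {Q \<in> F. case Q of (g, a, b) \<Rightarrow> a = \<lfloor>x * 2 ^ g\<rfloor>} \<le> N1" using line[of x] by simp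
      qed
      finally show "(\<Sum>Q\<in>F. 1 * indicator (case Q of (g, a, b) \<Rightarrow> ival g a) x) \<le> real N1" .
    qed (auto split: prod.splits)
    then show ?thesis by (simp add: \<alpha>_def case_prod_unfold)
  qed
  have inner: "(\<Sum>Q\<in>F. (\<gamma> Q)\<^sup>2 * indicator (case Q of (g, a, b) \<Rightarrow> ival g b) y) \<le> real N2 * (nrm f3)\<^sup>2" for y
  proof -
    have "(\<Sum>Q\<in>F. indicator (case Q of (g, a, b) \<Rightarrow> ival g b) y * (nrm (restr (case Q of (g, a, b) \<Rightarrow> band g a b) f3))\<^sup>2)
        \<le> real N2 * (nrm f3)\<^sup>2"
    proof (rule weighted_restr_sum[OF f(3) F])
      fix u
      have "(\<Sum>Q\<in>F. indicator (case Q of (g, a, b) \<Rightarrow> ival g b) y * indicator (case Q of (g, a, b) \<Rightarrow> band g a b) u)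
          \<le> (\<Sum>Q\<in>F. if (case Q of (g, a, b) \<Rightarrow> \<bar>(u - y) - ctr g a\<bar> \<le> 2 * side g \<and> \<bar>y - ctr g b\<bar> \<le> 2 * side g) then 1 else 0 :: real)"
      proof (rule sum_mono)
        fix Q assume "Q \<in> F"
        obtain g a b where Q: "Q = (g, a, b)" by (cases Q) auto
        have "\<bar>(u - y) - ctr g a\<bar> \<le> 2 * side g \<and> \<bar>y - ctr g b\<bar> \<le> 2 * side g" if "y \<in> ival g b" "u \<in> band g a b"
        proof -
          have "\<bar>y - ctr g b\<bar> \<le> side g / 2" "\<bar>u - (ctr g a + ctr g b)\<bar> \<le> side g" "0 \<le> side g"
            using ival_near[OF that(1)] that(2) by (auto simp: band_def)
          then show ?thesis by (intro conjI; linarith)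
        qed
        then show "indicator (case Q of (g, a, b) \<Rightarrow> ival g b) y * indicator (case Q of (g, a, b) \<Rightarrow> band g a b) u
          \<le> (if (case Q of (g, a, b) \<Rightarrow> \<bar>(u - y) - ctr g a\<bar> \<le> 2 * side g \<and> \<bar>y - ctr g b\<bar> \<le> 2 * side g) then 1 else 0 :: real)"
          unfolding Q by (auto simp: indicator_def)
      qed
      also have "\<dots> \<le> real N2"
      proof (rule sum_indicator_le_card[OF F])
        have "{Q \<in> F. case Q of (g, a, b) \<Rightarrow> \<bar>(u - y) - ctr g a\<bar> \<le> 2 * side g \<and> \<bar>y - ctr g b\<bar> \<le> 2 * side g}
          = {(g, a, b). (g, a, b) \<in> F \<and> \<bar>(u - y) - ctr g a\<bar> \<le> 2 * side g \<and> \<bar>y - ctr g b\<bar> \<le> 2 * side g}" by auto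
        then show "card {Q \<in> F. case Q of (g, a, b) \<Rightarrow> \<bar>(u - y) - ctr g a\<bar> \<le> 2 * side g \<and> \<bar>y - ctr g b\<bar> \<le> 2 * side g} \<le> N2"
          using pt[of "u - y" y] by simp
      qed
      finally show "(\<Sum>Q\<in>F. indicator (case Q of (g, a, b) \<Rightarrow> ival g b) y * indicator (case Q of (g, a, b) \<Rightarrow> band g a b) u) \<le> real N2" .
    qed (auto split: prod.splits)
    then show ?thesis by (simp add: \<gamma>_def case_prod_unfold mult.commute)
  qed
  have s2: "(\<Sum>Q\<in>F. (\<beta> Q * \<gamma> Q)\<^sup>2) \<le> real N2 * (nrm f3)\<^sup>2 * (nrm f2)\<^sup>2"
  proof -
    have "(\<Sum>Q\<in>F. (\<gamma> Q)\<^sup>2 * (nrm (restr (case Q of (g, a, b) \<Rightarrow> ival g b) f2))\<^sup>2) \<le> real N2 * (nrm f3)\<^sup>2 * (nrm f2)\<^sup>2"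
      by (rule weighted_restr_sum[OF f(2) F]) (use inner in \<open>auto split: prod.splits\<close>)
    then show ?thesis by (simp add: \<beta>_def case_prod_unfold power_mult_distrib mult.commute)
  qed
  have "(\<Sum>Q\<in>F. sq_prod f1 f2 f3 Q) = (\<Sum>Q\<in>F. \<alpha> Q * (\<beta> Q * \<gamma> Q))"
    by (intro sum.cong refl) (auto simp: sq_prod_def \<alpha>_def \<beta>_def \<gamma>_def)
  also have "\<dots> \<le> sqrt ((\<Sum>Q\<in>F. (\<alpha> Q)\<^sup>2) * (\<Sum>Q\<in>F. (\<beta> Q * \<gamma> Q)\<^sup>2))"
    by (rule real_le_rsqrt) (rule Cauchy_Schwarz_ineq_sum)
  also have "\<dots> \<le> sqrt ((real N1 * (nrm f1)\<^sup>2) * (real N2 * (nrm f3)\<^sup>2 * (nrm f2)\<^sup>2))"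
    using s1 s2 by (intro real_sqrt_le_mono mult_mono) (auto intro!: sum_nonneg)
  also have "(real N1 * (nrm f1)\<^sup>2) * (real N2 * (nrm f3)\<^sup>2 * (nrm f2)\<^sup>2)
      = (real N1 * real N2) * (nrm f1 * nrm f2 * nrm f3)\<^sup>2" by (simp add: power_mult_distrib)
  also have "sqrt \<dots> = sqrt (real N1 * real N2) * (nrm f1 * nrm f2 * nrm f3)"
    unfolding real_sqrt_mult[of _ "_\<^sup>2"] real_sqrt_abs by simp
  finally show ?thesis .
qed

text \<open>The maximal good squares, \<open>a div 2 ^ (g - g')\<close> being the index of the
  ancestor of generation g'. The cap \<open>G\<close> forces termination where no square is good, at
  the price of possibly bad squares of generation \<open>G\<close>.\<close>

definition stopping :: "(nat \<Rightarrow> int \<Rightarrow> int \<Rightarrow> bool) \<Rightarrow> nat \<Rightarrow> square set" where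
  "stopping Good G = {(g, a, b). g \<le> G \<and> 0 \<le> a \<and> a < 2 ^ g \<and> 0 \<le> b \<and> b < 2 ^ g \<and> (Good g a b \<or> g = G) \<and>
     (\<forall>g'<g. \<not> Good g' (a div 2 ^ (g - g')) (b div 2 ^ (g - g')))}"

lemma finite_stopping: "finite (stopping Good G)"
proof (rule finite_subset)
  show "stopping Good G \<subseteq> {..G} \<times> {0..2 ^ G} \<times> {0..2 ^ G}"
  proof
    fix Q assume "Q \<in> stopping Good G"
    then obtain g a b where Q: "Q = (g, a, b)" "g \<le> G" "0 \<le> a" "a < 2 ^ g" "0 \<le> b" "b < 2 ^ g"
      by (auto simp: stopping_def)
    have "(2::int) ^ g \<le> 2 ^ G" using Q by (intro power_increasing) auto
    then have "a \<le> 2 ^ G" "b \<le> 2 ^ G" using Q by linarith+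
    then show "Q \<in> {..G} \<times> {0..2 ^ G} \<times> {0..2 ^ G}" using Q by auto
  qed
qed simp

lemma floor_coarser:
  fixes x :: real
  assumes "g' \<le> g"
  shows "\<lfloor>x * 2 ^ g\<rfloor> div 2 ^ (g - g') = \<lfloor>x * 2 ^ g'\<rfloor>"
proof -
  have "\<lfloor>x * 2 ^ g\<rfloor> div 2 ^ (g - g') = \<lfloor>(x * 2 ^ g) / real_of_int (2 ^ (g - g'))\<rfloor>"
    by (rule floor_divide_real_eq_div[symmetric]) simp
  also have "(x * 2 ^ g) / real_of_int (2 ^ (g - g')) = x * 2 ^ g'"
  proof -
    obtain k where "g = g' + k" using assms le_Suc_ex by blast
    then show ?thesis by (simp add: power_add)
  qed
  finally show ?thesis .
qed

text \<open>In the chain of dyadic squares containing (x, y), the first good one, or else the one of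
  generation \<open>G\<close>, is selected and no other. The intervals are half-open, whence x, y <
  1.\<close>

lemma stopping_covers_once:
  assumes x: "0 \<le> x" "x < 1" and y: "0 \<le> y" "y < (1::real)"
  shows "(\<Sum>(g, a, b)\<in>stopping Good G. if x \<in> ival g a \<and> y \<in> ival g b then 1 else 0 :: complex) = 1"
proof -
  define gd where "gd g = Good g \<lfloor>x * 2 ^ g\<rfloor> \<lfloor>y * 2 ^ g\<rfloor>" for g
  define g0 where "g0 = (LEAST g. gd g \<or> g = G)"
  have g0: "gd g0 \<or> g0 = G" unfolding g0_def by (rule LeastI[of _ G]) simp
  have g0G: "g0 \<le> G" unfolding g0_def by (rule Least_le) simp
  have small: "\<not> gd g \<and> g \<noteq> G" if "g < g0" for g using not_less_Least[OF that[unfolded g0_def]] by simp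
  have fl: "0 \<le> \<lfloor>t * 2 ^ g\<rfloor> \<and> \<lfloor>t * 2 ^ g\<rfloor> < 2 ^ g" if "0 \<le> t" "t < 1" for t :: real and g
    using that by (auto simp: floor_less_iff)
  have mem: "(g, \<lfloor>x * 2 ^ g\<rfloor>, \<lfloor>y * 2 ^ g\<rfloor>) \<in> stopping Good G \<longleftrightarrow> g = g0" for g
  proof -
    have "(g, \<lfloor>x * 2 ^ g\<rfloor>, \<lfloor>y * 2 ^ g\<rfloor>) \<in> stopping Good G \<longleftrightarrow>
        g \<le> G \<and> (gd g \<or> g = G) \<and> (\<forall>g'<g. \<not> gd g')"
      using fl[OF x] fl[OF y] by (auto simp: stopping_def gd_def floor_coarser)
    also have "\<dots> \<longleftrightarrow> g = g0"
    proof
      assume g: "g \<le> G \<and> (gd g \<or> g = G) \<and> (\<forall>g'<g. \<not> gd g')"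
      have "g0 \<le> g" unfolding g0_def by (rule Least_le) (use g in blast)
      moreover have "\<not> g0 < g" using g g0 by auto
      ultimately show "g = g0" by simp
    qed (use g0 g0G small in blast)
    finally show ?thesis .
  qed
  have "(\<Sum>(g, a, b)\<in>stopping Good G. if x \<in> ival g a \<and> y \<in> ival g b then 1 else 0 :: complex)
      = (\<Sum>Q\<in>{(g0, \<lfloor>x * 2 ^ g0\<rfloor>, \<lfloor>y * 2 ^ g0\<rfloor>)}. 1)"
  proof (rule sum.mono_neutral_cong_right[OF finite_stopping])
    show "{(g0, \<lfloor>x * 2 ^ g0\<rfloor>, \<lfloor>y * 2 ^ g0\<rfloor>)} \<subseteq> stopping Good G" using mem[of g0] by simp
    show "\<forall>i\<in>stopping Good G - {(g0, \<lfloor>x * 2 ^ g0\<rfloor>, \<lfloor>y * 2 ^ g0\<rfloor>)}.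
       (case i of (g, a, b) \<Rightarrow> if x \<in> ival g a \<and> y \<in> ival g b then 1 else 0) = (0::complex)"
    proof
      fix Q assume Q: "Q \<in> stopping Good G - {(g0, \<lfloor>x * 2 ^ g0\<rfloor>, \<lfloor>y * 2 ^ g0\<rfloor>)}"
      obtain g a b where e: "Q = (g, a, b)" by (cases Q) auto
      have "\<not> (x \<in> ival g a \<and> y \<in> ival g b)"
      proof
        assume "x \<in> ival g a \<and> y \<in> ival g b"
        then have "a = \<lfloor>x * 2 ^ g\<rfloor>" "b = \<lfloor>y * 2 ^ g\<rfloor>" by (auto simp: ival_def)
        then show False using Q mem[of g] unfolding e by auto
      qed
      then show "(case Q of (g, a, b) \<Rightarrow> if x \<in> ival g a \<and> y \<in> ival g b then 1 else 0) = (0::complex)"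
        unfolding e by simp
    qed
  qed (auto simp: ival_def)
  then show ?thesis by simp
qed

lemma tform_decompose:
  assumes P: "jet_family n P" and f: "nice f1" "nice f2" "nice f3"
    and s1: "\<And>x. f1 x \<noteq> 0 \<Longrightarrow> 0 \<le> x \<and> x < 1" and s2: "\<And>x. f2 x \<noteq> 0 \<Longrightarrow> 0 \<le> x \<and> x < 1"
  shows "tform l (P 0 0) f1 f2 f3 =
    (\<Sum>(g, a, b)\<in>stopping Good G. tform l (P 0 0) (restr (ival g a) f1) (restr (ival g b) f2) (restr (band g a b) f3))"
proof -
  let ?e = "\<lambda>z. cis (l * P 0 0 (fst z) (snd z)) * f1 (fst z) * f2 (snd z) * f3 (fst z + snd z)"
  let ?eQ = "\<lambda>Q z. cis (l * P 0 0 (fst z) (snd z)) * restr (case Q of (g, a, b) \<Rightarrow> ival g a) f1 (fst z)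
     * restr (case Q of (g, a, b) \<Rightarrow> ival g b) f2 (snd z) * restr (case Q of (g, a, b) \<Rightarrow> band g a b) f3 (fst z + snd z)"
  have int: "integrable lborel (?eQ Q)" for Q
  proof -
    obtain g a b where Q: "Q = (g, a, b)" by (cases Q) auto
    show ?thesis
      using trilinear_integrable[OF P nice_restr[OF f(1) ival_borel] nice_restr[OF f(2) ival_borel] nice_restr[OF f(3) band_borel],
          of l g a g b g a b]
      unfolding Q by (simp add: case_prod_unfold)
  qed
  have pw: "?e z = (\<Sum>Q\<in>stopping Good G. ?eQ Q z)" for z
  proof (cases "f1 (fst z) = 0 \<or> f2 (snd z) = 0")
    case True
    then have "?eQ Q z = 0" for Q by (auto simp: restr_def)
    then have "(\<Sum>Q\<in>stopping Good G. ?eQ Q z) = 0" by (intro sum.neutral) blast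
    then show ?thesis using True by auto
  next
    case False
    define x y where "x = fst z" and "y = snd z"
    have xy: "0 \<le> x" "x < 1" "0 \<le> y" "y < 1" using False s1[of x] s2[of y] by (auto simp: x_def y_def)
    have "(\<Sum>Q\<in>stopping Good G. ?eQ Q z)
        = (\<Sum>Q\<in>stopping Good G. ?e z * (case Q of (g, a, b) \<Rightarrow> if x \<in> ival g a \<and> y \<in> ival g b then 1 else 0))"
    proof (rule sum.cong[OF refl])
      fix Q :: square
      obtain g a b where Q: "Q = (g, a, b)" by (cases Q) auto
      \<comment> \<open>Cutting f3 to the band costs nothing, since x + y lies in it automatically,
        and it makes the local norms of f3 summable.\<close>
      have "x + y \<in> band g a b" if "x \<in> ival g a" "y \<in> ival g b"
        using ival_near[OF that(1)] ival_near[OF that(2)] unfolding band_def mem_Collect_eq by linarith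
      then show "?eQ Q z = ?e z * (case Q of (g, a, b) \<Rightarrow> if x \<in> ival g a \<and> y \<in> ival g b then 1 else 0)"
        unfolding Q x_def[symmetric] y_def[symmetric] by (auto simp: restr_def)
    qed
    also have "\<dots> = ?e z"
      unfolding sum_distrib_left[symmetric] using stopping_covers_once[OF xy, of Good G] by simp
    finally show ?thesis by simp
  qed
  have "tform l (P 0 0) f1 f2 f3 = (LINT z|lborel. (\<Sum>Q\<in>stopping Good G. ?eQ Q z))"
    unfolding tform_def case_prod_unfold pw ..
  also have "\<dots> = (\<Sum>Q\<in>stopping Good G. LINT z|lborel. ?eQ Q z)"
    by (rule Bochner_Integration.integral_sum) (rule int)
  also have "\<dots> = (\<Sum>(g, a, b)\<in>stopping Good G. tform l (P 0 0) (restr (ival g a) f1) (restr (ival g b) f2) (restr (band g a b) f3))"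
    by (intro sum.cong refl) (auto simp: tform_def case_prod_unfold)
  finally show ?thesis .
qed

subsection \<open>Good squares and levels\<close>

text \<open>Subtracting the central value leaves a jet family with the same oscillation; its value
  at (x, y) is the norm of scale 0 there, which shifts to scale h at the centre.\<close>

lemma jet_center_close:
  assumes D: "jet_family n D" and q: "\<bar>x - p1\<bar> \<le> h" "\<bar>y - p2\<bar> \<le> h"
  shows "\<bar>D 0 0 x y - D 0 0 p1 p2\<bar> \<le> jet_norm n D 1 p1 p2 h + jet_norm n (flip D) 1 p2 p1 h"
proof -
  have h: "0 \<le> h" using q by linarith
  define D' where "D' = (\<lambda>a b x y. D a b x y - (if a = 0 \<and> b = 0 then D 0 0 p1 p2 else 0))"
  have D': "jet_family n D'"
    using D unfolding jet_family_def D'_def by (auto intro!: derivative_eq_intros)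
  have 1: "jet_norm n D' 1 p1 p2 h = jet_norm n D 1 p1 p2 h"
    unfolding jet_norm_def D'_def by (intro sum.cong refl) auto
  have 2: "jet_norm n (flip D') 1 p2 p1 h = jet_norm n (flip D) 1 p2 p1 h"
    unfolding jet_norm_def D'_def flip_def by (intro sum.cong refl) auto
  have "\<bar>D' 0 0 x y\<bar> \<le> jet_norm n D' 0 x y 0"
    using jet_norm_term_le[of 0 0 n 0 0 D' x y] by simp
  also have "\<dots> \<le> jet_norm n D' 0 p1 p2 (0 + h)" by (rule jet_norm_shift[OF D']) (use q in auto)
  also have "\<dots> \<le> \<bar>D' 0 0 p1 p2\<bar> + jet_norm n D' 1 p1 p2 h + jet_norm n (flip D') 1 p2 p1 h"
    using jet_norm_0_le[OF h, of n D' p1 p2] by simp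
  also have "\<bar>D' 0 0 p1 p2\<bar> = 0" by (simp add: D'_def)
  finally show ?thesis unfolding 1 2 by (simp add: D'_def)
qed

definition osc_norm :: "nat \<Rightarrow> (nat \<Rightarrow> nat \<Rightarrow> real \<Rightarrow> real \<Rightarrow> real) \<Rightarrow> real \<Rightarrow> real \<Rightarrow> real \<Rightarrow> real" where
  "osc_norm n D x y s = jet_norm n D 1 x y s + jet_norm n (flip D) 1 y x s"

text \<open>The scale of three sides leaves room to move the centre by two sides and still control
  jets at scale one side, as \<open>tame_on_box\<close> asks. The factor 2 keeps the value within
  half of the central one.\<close>

definition good :: "nat \<Rightarrow> (nat \<Rightarrow> nat \<Rightarrow> real \<Rightarrow> real \<Rightarrow> real) \<Rightarrow> nat \<Rightarrow> int \<Rightarrow> int \<Rightarrow> bool" where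
  "good n D g a b \<longleftrightarrow> 2 * osc_norm n D (ctr g a) (ctr g b) (3 * side g) \<le> \<bar>D 0 0 (ctr g a) (ctr g b)\<bar>"

lemma osc_norm_shift:
  assumes "jet_family n D" "0 \<le> s" "\<bar>x' - x\<bar> \<le> h" "\<bar>y' - y\<bar> \<le> h"
  shows "osc_norm n D x' y' s \<le> osc_norm n D x y (s + h)"
  unfolding osc_norm_def using assms by (intro add_mono jet_norm_shift jet_family_flip) auto

lemma osc_norm_mono: "0 \<le> s \<Longrightarrow> s \<le> s' \<Longrightarrow> osc_norm n D x y s \<le> osc_norm n D x y s'"
  unfolding osc_norm_def by (intro add_mono jet_norm_mono)

lemma good_close:
  assumes D: "jet_family n D" and gd: "good n D g a b"
    and q: "\<bar>x - ctr g a\<bar> \<le> 2 * side g" "\<bar>y - ctr g b\<bar> \<le> 2 * side g"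
  shows "\<bar>D 0 0 (ctr g a) (ctr g b)\<bar> / 2 \<le> \<bar>D 0 0 x y\<bar>"
proof -
  have "\<bar>D 0 0 x y - D 0 0 (ctr g a) (ctr g b)\<bar> \<le> osc_norm n D (ctr g a) (ctr g b) (2 * side g)"
    unfolding osc_norm_def by (rule jet_center_close[OF D q])
  also have "\<dots> \<le> osc_norm n D (ctr g a) (ctr g b) (3 * side g)" by (rule osc_norm_mono) auto
  finally show ?thesis using gd unfolding good_def by linarith
qed

lemma good_tame:
  assumes D: "jet_family n D" and gd: "good n D g a b"
  shows "tame_on_box D (ctr g a) (ctr g b) (side g) \<bar>D 0 0 (ctr g a) (ctr g b)\<bar>"
  unfolding tame_on_box_def
proof (intro allI impI conjI)
  fix x y assume q: "\<bar>x - ctr g a\<bar> \<le> 2 * side g" "\<bar>y - ctr g b\<bar> \<le> 2 * side g"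
  let ?m = "\<bar>D 0 0 (ctr g a) (ctr g b)\<bar>" and ?r = "side g"
  show "?m / 2 \<le> \<bar>D 0 0 x y\<bar>" by (rule good_close[OF D gd q])
  have "jet_norm n D 1 x y ?r \<le> jet_norm n D 1 (ctr g a) (ctr g b) (?r + 2 * ?r)"
    by (rule jet_norm_shift[OF D]) (use q in auto)
  also have "\<dots> \<le> ?m / 2"
    using gd jet_norm_nonneg[of "3 * ?r" n "flip D" 1 "ctr g b" "ctr g a"]
    unfolding good_def osc_norm_def by simp
  finally have V: "jet_norm n D 1 x y ?r \<le> ?m / 2" .
  have db: "\<bar>D 0 b x y\<bar> * ?r ^ b / fact b \<le> ?m / 2" if "1 \<le> b" for b
  proof (cases "b \<le> n")
    case True
    show ?thesis using order_trans[OF jet_norm_term_le[of ?r 0 n 1 b D x y] V] that True by simp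
  next
    case False
    then have "D 0 b x y = 0" using D by (simp add: jet_family_def)
    then show ?thesis by simp
  qed
  have "\<bar>D 0 1 x y\<bar> * ?r \<le> ?m" using db[of 1] by simp
  then show "\<bar>D 0 1 x y\<bar> \<le> ?m / ?r" by (simp add: pos_le_divide_eq)
  have "\<bar>D 0 2 x y\<bar> * ?r\<^sup>2 \<le> ?m" using db[of 2] by simp
  moreover have "0 < ?r\<^sup>2" by (rule zero_less_power) simp
  ultimately show "\<bar>D 0 2 x y\<bar> \<le> ?m / ?r\<^sup>2" by (simp only: pos_le_divide_eq)
qed

lemma parent_close:
  assumes "1 \<le> g"
  shows "\<bar>ctr (g - 1) (a div 2) - ctr g a\<bar> \<le> side g / 2" "side (g - 1) = 2 * side g"
proof -
  obtain k where k: "g = Suc k" using assms by (cases g) auto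
  show "side (g - 1) = 2 * side g" by (simp add: k side_def)
  have a: "real_of_int a = 2 * real_of_int (a div 2) + real_of_int (a mod 2)"
    by (metis of_int_add of_int_mult of_int_numeral mult_div_mod_eq)
  have "ctr (g - 1) (a div 2) - ctr g a = (1 / 2 - real_of_int (a mod 2)) * side g"
    by (simp add: k ctr_def side_def a field_simps)
  moreover have "\<bar>1 / 2 - real_of_int (a mod 2)\<bar> \<le> 1 / 2"
  proof -
    have "a mod 2 = 0 \<or> a mod 2 = 1" by presburger
    then show ?thesis by auto
  qed
  ultimately show "\<bar>ctr (g - 1) (a div 2) - ctr g a\<bar> \<le> side g / 2"
    using mult_right_mono[of "\<bar>1 / 2 - real_of_int (a mod 2)\<bar>" "1 / 2" "side g"] by (simp add: abs_mult)
qed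

text \<open>The centre of the parent is close enough for the good square to control the value there.
  Badness of the parent speaks about the scale 3 * side (g - 1) = 6 * side g; moving the centre adds
  one side.\<close>

lemma osc_norm_of_bad_parent:
  assumes D: "jet_family n D" and gd: "good n D g a b" and g: "1 \<le> g"
    and bad: "\<not> good n D (g - 1) (a div 2) (b div 2)"
  shows "\<bar>D 0 0 (ctr g a) (ctr g b)\<bar> / 4 \<le> osc_norm n D (ctr g a) (ctr g b) (7 * side g)"
proof -
  let ?x = "ctr (g - 1) (a div 2)" and ?y = "ctr (g - 1) (b div 2)"
  note pc = parent_close(1)[OF g, of a] parent_close(1)[OF g, of b]
  have s: "0 \<le> side g" by simp
  have "\<bar>D 0 0 (ctr g a) (ctr g b)\<bar> / 2 \<le> \<bar>D 0 0 ?x ?y\<bar>"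
    by (rule good_close[OF D gd]) (use pc s in linarith)+
  also have "\<dots> < 2 * osc_norm n D ?x ?y (6 * side g)"
    using bad unfolding good_def parent_close(2)[OF g] by simp
  also have "osc_norm n D ?x ?y (6 * side g) \<le> osc_norm n D (ctr g a) (ctr g b) (6 * side g + side g)"
    by (rule osc_norm_shift[OF D]) (use pc s in \<open>linarith | simp\<close>)+
  finally show ?thesis by simp
qed

text \<open>In base-2 exponents both bounds are linear. They meet at the level X = y, that is m =
  L^(-d/(3+d)), and improve away from it at the rates 1/6 above and 1/(2d) below; \<epsilon> is at
  most either rate. The constant c enters through \<kappa> only.\<close>

lemma level_weight:
  fixes L r m c v :: real and d :: nat
  assumes L: "1 \<le> L" and r: "0 < r" "r \<le> 1" and m: "0 < m" and c: "0 < c" "c \<le> 1"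
    and lower: "c * r ^ d \<le> m" and v1: "v \<le> sqrt r" and v2: "v \<le> 7 * (L * m) powr (- 1 / 6)"
  shows "v \<le> 14 * (2 / c)\<^sup>2 * L powr (- (1 / (2 * (3 + real d)))) *
           2 powr (- (1 / (6 * (real d + 1))) * \<bar>of_int (\<lfloor>log 2 m\<rfloor> - \<lfloor>log 2 (L powr (- real d / (3 + real d)))\<rfloor>)\<bar>)"
proof -
  define \<nu> where "\<nu> = 1 / (2 * (3 + real d))"
  define \<epsilon> where "\<epsilon> = 1 / (6 * (real d + 1))"
  define X where "X = log 2 m"
  define Lam where "Lam = log 2 L"
  define \<rho> where "\<rho> = log 2 r"
  define \<kappa> where "\<kappa> = - log 2 c"
  define y where "y = - 2 * real d * \<nu> * Lam"
  have nu: "2 * (3 + real d) * \<nu> = 1" unfolding \<nu>_def by simp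
  have nu0: "0 < \<nu>" unfolding \<nu>_def by simp
  have eps0: "0 < \<epsilon>" "\<epsilon> \<le> 1 / 6" unfolding \<epsilon>_def by (simp_all add: field_simps)
  have Lam0: "0 \<le> Lam" using L by (simp add: Lam_def)
  have kap0: "0 \<le> \<kappa>" using c by (simp add: \<kappa>_def)
  have yeq: "log 2 (L powr (- real d / (3 + real d))) = y"
  proof -
    have "2 * real d * \<nu> * (3 + real d) = real d * (2 * (3 + real d) * \<nu>)" by simp
    then have "real d / (3 + real d) = 2 * real d * \<nu>" unfolding nu by (simp add: divide_eq_eq)
    then show ?thesis using L by (simp add: log_powr y_def Lam_def)
  qed
  have e: "m = 2 powr X" "L = 2 powr Lam" "r = 2 powr \<rho>" "c = 2 powr (- \<kappa>)"
    using m L r c by (simp_all add: X_def Lam_def \<rho>_def \<kappa>_def)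
  have Ly: "Lam + y = 6 * \<nu> * Lam"
  proof -
    have "Lam * (2 * (3 + real d) * \<nu>) = Lam" unfolding nu by simp
    then show ?thesis unfolding y_def by (simp add: algebra_simps)
  qed
  have w2: "v \<le> 7 * 2 powr (- (Lam + X) / 6)"
  proof -
    have "(L * m) powr (- 1 / 6) = 2 powr ((Lam + X) * (- 1 / 6))"
      unfolding e(1,2) powr_add[symmetric] powr_powr ..
    also have "(Lam + X) * (- 1 / 6) = - (Lam + X) / 6" by (simp only: times_divide_eq_right mult_minus1_right)
    finally have "(L * m) powr (- 1 / 6) = 2 powr (- (Lam + X) / 6)" .
    then show ?thesis using v2 by simp
  qed
  have w1: "v \<le> 7 * 2 powr (\<rho> / 2)"
  proof -
    have "sqrt r = 2 powr (\<rho> / 2)" unfolding e(3) using powr_half_sqrt[of "2 powr \<rho>"] by (simp add: powr_powr)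
    then show ?thesis using v1 powr_gt_zero[of 2 "\<rho> / 2"] by linarith
  qed
  have low: "real d * \<rho> - \<kappa> \<le> X"
  proof -
    have "2 powr (real d * \<rho> - \<kappa>) = c * r ^ d"
      unfolding e(3,4) by (simp add: powr_diff powr_minus_divide powr_power mult.commute)
    also have "\<dots> \<le> 2 powr X" using lower e(1) by simp
    finally show ?thesis by simp
  qed
  have expo: "v \<le> 7 * 2 powr (2 * \<kappa> - \<nu> * Lam - \<epsilon> * \<bar>X - y\<bar>)"
  proof (cases "y \<le> X")
    case True
    have "- (Lam + X) / 6 = - (\<nu> * Lam) - (X - y) / 6" using Ly by (simp add: field_simps)
    also have "\<dots> \<le> 2 * \<kappa> - \<nu> * Lam - \<epsilon> * \<bar>X - y\<bar>"
    proof -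
      have "\<epsilon> * (X - y) \<le> 1 / 6 * (X - y)" using True eps0 by (intro mult_right_mono) auto
      moreover have "\<bar>X - y\<bar> = X - y" using True by simp
      ultimately show ?thesis using kap0 by linarith
    qed
    finally have "2 powr (- (Lam + X) / 6) \<le> 2 powr (2 * \<kappa> - \<nu> * Lam - \<epsilon> * \<bar>X - y\<bar>)" by simp
    then show ?thesis using w2 by linarith
  next
    case False
    show ?thesis
    \<comment> \<open>For d = 0 the lower bound says nothing about r but forces m \<ge> c. Levels
      below y = 0 are then within \<kappa> of it, and the oscillatory bound still serves.\<close>
    proof (cases "d = 0")
      case True
      have y0: "y = 0" using True by (simp add: y_def)
      have "\<nu> = 1 / 6" using True by (simp add: \<nu>_def)
      moreover have "\<epsilon> * \<bar>X\<bar> \<le> 1 / 6 * \<kappa>"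
        using low True False y0 eps0 by (intro mult_mono) auto
      ultimately have "\<nu> * Lam = Lam / 6" "\<epsilon> * \<bar>X - y\<bar> \<le> \<kappa> / 6" "- \<kappa> \<le> X"
        using low True y0 by simp_all
      moreover have "- (Lam + X) / 6 \<le> 2 * \<kappa> - s - t" if "s = Lam / 6" "t \<le> \<kappa> / 6" "- \<kappa> \<le> X" for s t
        using that kap0 by simp
      ultimately have "- (Lam + X) / 6 \<le> 2 * \<kappa> - \<nu> * Lam - \<epsilon> * \<bar>X - y\<bar>" by blast
      then have "2 powr (- (Lam + X) / 6) \<le> 2 powr (2 * \<kappa> - \<nu> * Lam - \<epsilon> * \<bar>X - y\<bar>)" by simp
      then show ?thesis using w2 by linarith
    next
      case dpos: False
      then have d1: "1 \<le> real d" by simp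
      have "\<rho> \<le> (X + \<kappa>) / real d" using low d1 by (simp add: field_simps)
      then have "\<rho> / 2 \<le> (X + \<kappa>) / (2 * real d)" using d1 by (simp add: field_simps)
      also have "\<dots> = y / (2 * real d) - (y - X) / (2 * real d) + \<kappa> / (2 * real d)"
        using d1 by (simp add: field_simps)
      also have "y / (2 * real d) = - (\<nu> * Lam)" using d1 by (simp add: y_def field_simps)
      also have "- (\<nu> * Lam) - (y - X) / (2 * real d) + \<kappa> / (2 * real d) \<le> - (\<nu> * Lam) - \<epsilon> * (y - X) + 2 * \<kappa>"
      proof -
        have "\<epsilon> \<le> 1 / (2 * real d)" unfolding \<epsilon>_def using d1 by (simp add: field_simps)
        then have "\<epsilon> * (y - X) \<le> 1 / (2 * real d) * (y - X)" using False by (intro mult_right_mono) auto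
        moreover have "\<kappa> / (2 * real d) \<le> \<kappa> / 1" using d1 kap0 by (intro divide_left_mono) auto
        ultimately show ?thesis using kap0 by simp
      qed
      also have "\<dots> = 2 * \<kappa> - \<nu> * Lam - \<epsilon> * \<bar>X - y\<bar>" using False by simp
      finally have "2 powr (\<rho> / 2) \<le> 2 powr (2 * \<kappa> - \<nu> * Lam - \<epsilon> * \<bar>X - y\<bar>)" by simp
      then show ?thesis using w1 by linarith
    qed
  qed
  let ?J = "\<bar>of_int (\<lfloor>X\<rfloor> - \<lfloor>y\<rfloor>)\<bar> :: real"
  \<comment> \<open>Rounding to integer levels changes the distance by at most 1; this costs a
    factor 2 at most and turns 7 into 14.\<close>
  have "?J \<le> \<bar>X - y\<bar> + 1" by linarith
  then have "\<epsilon> * ?J \<le> \<epsilon> * (\<bar>X - y\<bar> + 1)" using eps0 by (intro mult_left_mono) auto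
  then have "\<epsilon> * ?J \<le> \<epsilon> * \<bar>X - y\<bar> + 1" using eps0 by (simp add: algebra_simps)
  then have "2 powr (2 * \<kappa> - \<nu> * Lam - \<epsilon> * \<bar>X - y\<bar>) \<le> 2 powr (2 * \<kappa> + 1 + - (\<nu> * Lam) + - (\<epsilon> * ?J))" by simp
  also have "\<dots> = 2 powr (2 * \<kappa>) * 2 * 2 powr (- (\<nu> * Lam)) * 2 powr (- (\<epsilon> * ?J))"
    unfolding powr_add by simp
  also have "2 powr (2 * \<kappa>) = (1 / c)\<^sup>2"
    unfolding e(4) by (simp add: powr_minus_divide powr_power mult.commute)
  also have "2 powr (- (\<nu> * Lam)) = L powr (- \<nu>)" unfolding e(2) powr_powr by (simp add: mult.commute)
  finally have "v \<le> 7 * ((1 / c)\<^sup>2 * 2 * L powr (- \<nu>) * 2 powr (- (\<epsilon> * ?J)))" using expo by linarith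
  also have "\<dots> \<le> 7 * ((2 / c)\<^sup>2 * 2 * L powr (- \<nu>) * 2 powr (- (\<epsilon> * ?J)))"
    using c by (intro mult_left_mono mult_right_mono power_mono divide_right_mono) auto
  finally show ?thesis
    unfolding yeq \<nu>_def[symmetric] \<epsilon>_def[symmetric] X_def[symmetric] by (simp add: ac_simps)
qed

lemma two_sided_geometric:
  fixes q :: real and J :: "int set"
  assumes q: "0 < q" "q < 1" and J: "finite J"
  shows "(\<Sum>j\<in>J. q powr \<bar>of_int (j - j0)\<bar>) \<le> 2 / (1 - q)"
proof -
  have one: "(\<Sum>j\<in>A. q powr \<bar>of_int (j - j0)\<bar>) \<le> 1 / (1 - q)"
    if A: "finite A" and inj: "inj_on (\<lambda>j. nat \<bar>j - j0\<bar>) A" for A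
  proof -
    have "(\<Sum>j\<in>A. q powr \<bar>of_int (j - j0)\<bar>) = (\<Sum>j\<in>A. q ^ nat \<bar>j - j0\<bar>)"
      using q by (intro sum.cong refl) (simp flip: powr_realpow)
    also have "\<dots> = (\<Sum>k\<in>(\<lambda>j. nat \<bar>j - j0\<bar>) ` A. q ^ k)"
      using inj by (simp add: sum.reindex)
    also have "\<dots> \<le> (\<Sum>k. q ^ k)" using q A by (intro sum_le_suminf summable_geometric) auto
    also have "\<dots> = 1 / (1 - q)" using q by (intro suminf_geometric) auto
    finally show ?thesis .
  qed
  have "(\<Sum>j\<in>J. q powr \<bar>of_int (j - j0)\<bar>)
      = (\<Sum>j\<in>{j\<in>J. j0 \<le> j}. q powr \<bar>of_int (j - j0)\<bar>) + (\<Sum>j\<in>{j\<in>J. \<not> j0 \<le> j}. q powr \<bar>of_int (j - j0)\<bar>)"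
    using J by (subst sum.union_disjoint[symmetric]) (auto intro!: sum.cong)
  also have "\<dots> \<le> 1 / (1 - q) + 1 / (1 - q)"
    using J by (intro add_mono one) (auto simp: inj_on_def)
  finally show ?thesis by simp
qed

definition swp :: "square \<Rightarrow> square" where "swp = (\<lambda>(g, a, b). (g, b, a))"

text \<open>A family oscillating in x becomes vertical after exchanging the variables. Then f1 and
  f2 trade roles, while \<open>band\<close> is symmetric in its two indices.\<close>

lemma swp_family_sum:
  assumes f: "nice f1" "nice f2" "nice f3" and D: "jet_family n D"
    and N1: "\<And>D F x. jet_family n D \<Longrightarrow> vertical_family n C D F \<Longrightarrow>
        card {(g, a, b). (g, a, b) \<in> F \<and> a = \<lfloor>(x::real) * 2 ^ g\<rfloor>} \<le> N1"
    and L: "C \<le> 2 ^ L"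
    and F: "vertical_family n C D F \<or> vertical_family n C (flip D) (swp ` F)"
  shows "(\<Sum>Q\<in>F. sq_prod f1 f2 f3 Q) \<le> sqrt (real N1 * real ((L + 1) * 25)) * (nrm f1 * nrm f2 * nrm f3)"
  using F
proof
  assume F: "vertical_family n C D F"
  show ?thesis
    by (rule family_sum[OF f _ N1[OF D F] count_near_point[OF D F L]])
      (use F in \<open>simp add: vertical_family_def\<close>)
next
  assume F: "vertical_family n C (flip D) (swp ` F)"
  have "(\<Sum>Q\<in>swp ` F. sq_prod f2 f1 f3 Q) \<le> sqrt (real N1 * real ((L + 1) * 25)) * (nrm f2 * nrm f1 * nrm f3)"
    by (rule family_sum[OF f(2,1,3) _ N1[OF jet_family_flip[OF D] F] count_near_point[OF jet_family_flip[OF D] F L]])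
      (use F in \<open>simp add: vertical_family_def\<close>)
  also have "(\<Sum>Q\<in>swp ` F. sq_prod f2 f1 f3 Q) = (\<Sum>Q\<in>F. sq_prod f1 f2 f3 Q)"
  proof (subst sum.reindex)
    show "inj_on swp F" by (auto simp: inj_on_def swp_def)
    have "sq_prod f2 f1 f3 (swp Q) = sq_prod f1 f2 f3 Q" for Q
      by (cases Q) (simp add: sq_prod_def swp_def band_def add.commute)
    then show "sum (sq_prod f2 f1 f3 \<circ> swp) F = sum (sq_prod f1 f2 f3) F" by (simp add: o_def)
  qed
  finally show ?thesis by (simp add: mult.commute mult.left_commute)
qed

subsection \<open>The trilinear form without amplitude\<close>

text \<open>Distinct squares of one generation are not compared, so each has to dominate only its
  own norm. The power of 11/3 rescales from 3 sides to 11; 24 is larger than the 6 obtained so as to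
  agree with \<open>vertical_family_level\<close>.\<close>

lemma vertical_family_terminal:
  assumes F: "finite F" and g: "\<And>g a b. (g, a, b) \<in> F \<Longrightarrow> g = G"
    and T: "\<And>g a b. (g, a, b) \<in> F \<Longrightarrow> 0 < jet_norm n E 0 (ctr g a) (ctr g b) (3 * side g) \<and>
      jet_norm n E 0 (ctr g a) (ctr g b) (3 * side g) \<le> 6 * jet_norm n E 1 (ctr g a) (ctr g b) (3 * side g)"
  shows "vertical_family n (24 * (11 / 3) ^ (2 * n)) E F"
  unfolding vertical_family_def
proof (intro conjI allI impI)
  fix g a b assume Q: "(g, a, b) \<in> F"
  have mono: "jet_norm n E 1 (ctr g a) (ctr g b) (3 * side g) \<le> jet_norm n E 1 (ctr g a) (ctr g b) (7 * side g)"
    by (rule jet_norm_mono) auto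
  show "0 < jet_norm n E 1 (ctr g a) (ctr g b) (7 * side g)" using T[OF Q] mono by linarith
  fix g' a' b' assume Q': "(g', a', b') \<in> F" and "g < g' \<or> (g, a, b) = (g', a', b')"
  then have eq: "g' = g" "a' = a" "b' = b" using g[OF Q] g[OF Q'] by auto
  have "jet_norm n E 0 (ctr g a) (ctr g b) (11 * side g) = jet_norm n E 0 (ctr g a) (ctr g b) (11 / 3 * (3 * side g))" by simp
  also have "\<dots> \<le> (11 / 3) ^ (2 * n) * jet_norm n E 0 (ctr g a) (ctr g b) (3 * side g)"
    by (rule jet_norm_scale_up) auto
  also have "\<dots> \<le> (11 / 3) ^ (2 * n) * (24 * jet_norm n E 1 (ctr g a) (ctr g b) (7 * side g))"
    using T[OF Q] mono by (intro mult_left_mono) auto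
  finally show "jet_norm n E 0 (ctr g a) (ctr g b) (11 * side g)
      \<le> 24 * (11 / 3) ^ (2 * n) * jet_norm n E 1 (ctr g' a') (ctr g' b') (7 * side g')"
    unfolding eq by simp
qed (rule F)

text \<open>All norms are compared with the same M, whatever the sides, so any two squares satisfy
  the family condition; 24 = 3 * 8.\<close>

lemma vertical_family_level:
  assumes F: "finite F" and M: "0 < M"
    and T: "\<And>g a b. (g, a, b) \<in> F \<Longrightarrow> jet_norm n E 0 (ctr g a) (ctr g b) (3 * side g) \<le> 3 * M"
    and V: "\<And>g a b. (g, a, b) \<in> F \<Longrightarrow> M / 8 \<le> jet_norm n E 1 (ctr g a) (ctr g b) (7 * side g)"
  shows "vertical_family n (24 * (11 / 3) ^ (2 * n)) E F"
  unfolding vertical_family_def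
proof (intro conjI allI impI)
  fix g a b assume Q: "(g, a, b) \<in> F"
  show "0 < jet_norm n E 1 (ctr g a) (ctr g b) (7 * side g)" using V[OF Q] M by linarith
  fix g' a' b' assume Q': "(g', a', b') \<in> F"
  have "jet_norm n E 0 (ctr g a) (ctr g b) (11 * side g) = jet_norm n E 0 (ctr g a) (ctr g b) (11 / 3 * (3 * side g))" by simp
  also have "\<dots> \<le> (11 / 3) ^ (2 * n) * jet_norm n E 0 (ctr g a) (ctr g b) (3 * side g)"
    by (rule jet_norm_scale_up) auto
  also have "\<dots> \<le> (11 / 3) ^ (2 * n) * (24 * jet_norm n E 1 (ctr g' a') (ctr g' b') (7 * side g'))"
    using T[OF Q] V[OF Q'] by (intro mult_left_mono) auto
  finally show "jet_norm n E 0 (ctr g a) (ctr g b) (11 * side g)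
      \<le> 24 * (11 / 3) ^ (2 * n) * jet_norm n E 1 (ctr g' a') (ctr g' b') (7 * side g')"
    by simp
qed (rule F)

lemma nrm_restr_le:
  assumes "nice f" "A \<in> sets borel"
  shows "nrm (restr A f) \<le> nrm f"
proof -
  have "(\<Sum>i\<in>{()}. 1 * (nrm (restr A f))\<^sup>2) \<le> 1 * (nrm f)\<^sup>2"
    by (rule weighted_restr_sum) (use assms in \<open>auto simp: indicator_def\<close>)
  then show ?thesis by (simp add: power2_le_iff_abs_le)
qed

lemma sum_cover_le:
  fixes v :: "'a \<Rightarrow> real"
  assumes X: "finite X" and v: "\<And>Q. 0 \<le> v Q"
    and cover: "X \<subseteq> A \<union> B \<union> C \<union> D \<union> E" and sub: "A \<subseteq> X" "B \<subseteq> X" "C \<subseteq> X" "D \<subseteq> X" "E \<subseteq> X"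
  shows "sum v X \<le> sum v A + sum v B + sum v C + sum v D + sum v E"
proof -
  have fin: "finite A" "finite B" "finite C" "finite D" "finite E"
    using sub X by (auto intro: finite_subset)
  have un: "sum v (S \<union> T) \<le> sum v S + sum v T" if "finite S" "finite T" for S T
    using sum_Un[OF that, of v] sum_nonneg[of "S \<inter> T" v] v by simp
  have "sum v X \<le> sum v (A \<union> B \<union> C \<union> D \<union> E)"
    by (rule sum_mono2) (use fin cover v in auto)
  also have "\<dots> \<le> sum v (A \<union> B \<union> C \<union> D) + sum v E" by (rule un) (use fin in auto)
  also have "sum v (A \<union> B \<union> C \<union> D) \<le> sum v (A \<union> B \<union> C) + sum v D" by (rule un) (use fin in auto)
  also have "sum v (A \<union> B \<union> C) \<le> sum v (A \<union> B) + sum v C" by (rule un) (use fin in auto)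
  also have "sum v (A \<union> B) \<le> sum v A + sum v B" by (rule un) (use fin in auto)
  finally show ?thesis by simp
qed

text \<open>Fixes the order of quantifiers: the constant comes before the polynomial, the
  multi-index and \<lambda>, and knows only the degree bound n and the order d.\<close>

definition uniform_const :: "nat \<Rightarrow> nat \<Rightarrow> real \<Rightarrow> bool" where
  "uniform_const n d C \<longleftrightarrow> C \<ge> 0 \<and> (\<forall>P \<alpha>1 \<alpha>2 l f1 f2 f3. jet_family n P \<longrightarrow> \<alpha>1 + \<alpha>2 = d \<longrightarrow>
     (\<forall>x\<in>{0..1}. \<forall>y\<in>{0..1}. 1 \<le> \<bar>curv P \<alpha>1 \<alpha>2 x y\<bar>) \<longrightarrow> l \<noteq> 0 \<longrightarrow>
     nice f1 \<longrightarrow> nice f2 \<longrightarrow> nice f3 \<longrightarrow>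
     (\<forall>x. f1 x \<noteq> 0 \<longrightarrow> 0 \<le> x \<and> x < 1) \<longrightarrow> (\<forall>x. f2 x \<noteq> 0 \<longrightarrow> 0 \<le> x \<and> x < 1) \<longrightarrow>
     cmod (tform l (P 0 0) f1 f2 f3) \<le> C * \<bar>l\<bar> powr (- (1 / (2 * (3 + real d)))) * (nrm f1 * nrm f2 * nrm f3))"

lemma tform_bound: "\<exists>C. uniform_const n d C"
proof -
  define C0 :: real where "C0 = 24 * (11 / 3) ^ (2 * n)"
  have C0: "1 \<le> C0"
  proof -
    have "1 \<le> (11 / 3 :: real) ^ (2 * n)" by (rule one_le_power) simp
    then show ?thesis unfolding C0_def by linarith
  qed
  obtain N1 where N1: "\<And>D F x. jet_family n D \<Longrightarrow> vertical_family n C0 D F \<Longrightarrow>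
        card {(g, a, b). (g, a, b) \<in> F \<and> a = \<lfloor>(x::real) * 2 ^ g\<rfloor>} \<le> N1"
    using count_on_line[OF C0, of n] by blast
  obtain L2 :: nat where L2: "C0 \<le> 2 ^ L2" using real_arch_pow[of 2 C0] by (auto intro: less_imp_le)
  define K where "K = sqrt (real N1 * real ((L2 + 1) * 25))"
  \<comment> \<open>On a good square the jet norm at scale three sides is at least side^d / (n!)^2
    and at most 3/2 times the central value of |H|; the quotient gives 2 / (3 (n!)^2).\<close>
  define c :: real where "c = 2 / (3 * (fact n)\<^sup>2)"
  define \<nu> where "\<nu> = 1 / (2 * (3 + real d))"
  define q where "q = 2 powr (- (1 / (6 * (real d + 1))))"
  define W where "W = 14 * (2 / c)\<^sup>2"
  \<comment> \<open>The leading 1 handles |l| < 1; the other summands belong in turn to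
    \<open>R\<close>, \<open>TV\<close>, \<open>TH\<close>, \<open>GV\<close> and
    \<open>GH\<close>.\<close>
  define Ctot where "Ctot = 1 + W + K + K + K * W * (2 / (1 - q)) + K * W * (2 / (1 - q))"
  have K0: "0 \<le> K" by (simp add: K_def)
  have fact1: "1 \<le> (fact n :: real)" by (rule fact_ge_1)
  have c: "0 < c" "c \<le> 1"
  proof -
    have "1 \<le> (fact n :: real)\<^sup>2" using fact1 by (rule one_le_power)
    then have "2 \<le> 3 * (fact n :: real)\<^sup>2" by linarith
    then show "0 < c" "c \<le> 1" by (simp_all add: c_def divide_le_eq_1)
  qed
  have q: "0 < q" "q < 1" unfolding q_def by (simp_all add: powr_less_one)
  have W0: "0 \<le> W" by (simp add: W_def)
  have Ct0: "0 \<le> Ctot" "1 \<le> Ctot" unfolding Ctot_def using K0 W0 q by (auto intro!: add_nonneg_nonneg mult_nonneg_nonneg divide_nonneg_nonneg)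
  have main: "cmod (tform l (P 0 0) f1 f2 f3) \<le> Ctot * \<bar>l\<bar> powr (- \<nu>) * (nrm f1 * nrm f2 * nrm f3)"
    if P: "jet_family n P" and \<alpha>: "\<alpha>1 + \<alpha>2 = d"
      and low: "\<forall>x\<in>{0..1}. \<forall>y\<in>{0..1}. 1 \<le> \<bar>curv P \<alpha>1 \<alpha>2 x y\<bar>" and l: "l \<noteq> 0"
      and f: "nice f1" "nice f2" "nice f3"
      and s1: "\<forall>x. f1 x \<noteq> 0 \<longrightarrow> 0 \<le> x \<and> x < 1" and s2: "\<forall>x. f2 x \<noteq> 0 \<longrightarrow> 0 \<le> x \<and> x < 1"
    for P \<alpha>1 \<alpha>2 l f1 f2 f3
  proof -
    define M where "M = nrm f1 * nrm f2 * nrm f3"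
    have M0: "0 \<le> M" by (simp add: M_def)
    have nu0: "0 < \<nu>" by (simp add: \<nu>_def)
    show ?thesis
    proof (cases "\<bar>l\<bar> < 1")
      case True
      have "cmod (tform l (P 0 0) f1 f2 f3) \<le> sqrt 1 * nrm f1 * nrm f2 * nrm f3"
      proof (rule tform_trivial_bound[OF P _ f, where r = 1 and ?p2.0 = "1 / 2"])
        fix y assume "f2 y \<noteq> 0"
        then have "0 \<le> y \<and> y < 1" using s2 by blast
        then show "\<bar>y - 1 / 2\<bar> \<le> 1 / 2" by linarith
      qed simp
      then have "cmod (tform l (P 0 0) f1 f2 f3) \<le> 1 * 1 * M" by (simp add: M_def)
      also have "\<dots> \<le> Ctot * \<bar>l\<bar> powr (- \<nu>) * M"
      proof -
        have "\<bar>l\<bar> powr 0 \<le> \<bar>l\<bar> powr (- \<nu>)" using True l nu0 by (intro powr_mono') auto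
        then show ?thesis using Ct0 l M0 by (intro mult_right_mono mult_mono) auto
      qed
      finally show ?thesis unfolding M_def .
    next
      case False
      define L where "L = \<bar>l\<bar>"
      have L: "1 \<le> L" using False by (simp add: L_def)
      define D where "D = curv P"
      have D: "jet_family n D" unfolding D_def by (rule jet_family_curv[OF P])
      have \<alpha>n: "\<alpha>1 \<le> n" "\<alpha>2 \<le> n"
      proof -
        have "D \<alpha>1 \<alpha>2 0 0 \<noteq> 0" using low unfolding D_def by force
        then show "\<alpha>1 \<le> n" "\<alpha>2 \<le> n" using D unfolding jet_family_def by (meson not_le)+
      qed
      \<comment> \<open>Deep enough that the trivial bound on a square of generation
        \<open>G\<close> already has the required power of |l|.\<close>
      obtain G where G: "sqrt (side G) \<le> L powr (- \<nu>)"
      proof -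
        have "0 < (L powr (- \<nu>))\<^sup>2" using L by (intro zero_less_power) auto
        then obtain G where "(1 / 2) ^ G < (L powr (- \<nu>))\<^sup>2" using real_arch_pow_inv[of "(L powr (- \<nu>))\<^sup>2" "1 / 2"] by auto
        then have "side G \<le> (L powr (- \<nu>))\<^sup>2" by (simp add: side_def power_one_over)
        then have "sqrt (side G) \<le> L powr (- \<nu>)" by (intro real_le_lsqrt) auto
        then show thesis by (rule that)
      qed
      define X where "X = stopping (good n D) G"
      define v where "v = (\<lambda>(g, a, b). cmod (tform l (P 0 0) (restr (ival g a) f1) (restr (ival g b) f2) (restr (band g a b) f3)))"
      define m where "m = (\<lambda>(g, a, b). \<bar>D 0 0 (ctr g a) (ctr g b)\<bar>)"
      define lev where "lev Q = \<lfloor>log 2 (m Q)\<rfloor>" for Q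
      define j0 where "j0 = \<lfloor>log 2 (L powr (- real d / (3 + real d)))\<rfloor>"
      define SQ where "SQ = sq_prod f1 f2 f3"
      have SQ0: "0 \<le> SQ Q" for Q unfolding SQ_def by (rule sq_prod_nonneg)
      have v0: "0 \<le> v Q" for Q by (cases Q) (simp add: v_def)
      have finX: "finite X" unfolding X_def by (rule finite_stopping)
      have nr: "nice (restr (ival g a) f1)" "nice (restr (ival g a) f2)" "nice (restr (band g a b) f3)" for g a b
        using f by (auto intro: nice_restr)
      have SQM: "SQ Q \<le> M" for Q
        unfolding SQ_def M_def sq_prod_def using f
        by (cases Q) (auto intro!: mult_mono nrm_restr_le)
      have triv: "v (g, a, b) \<le> sqrt (side g) * SQ (g, a, b)" for g a b
      proof -
        have "cmod (tform l (P 0 0) (restr (ival g a) f1) (restr (ival g b) f2) (restr (band g a b) f3))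
          \<le> sqrt (side g) * nrm (restr (ival g a) f1) * nrm (restr (ival g b) f2) * nrm (restr (band g a b) f3)"
          by (rule tform_trivial_bound[OF P _ nr(1) nr(2) nr(3), where ?p2.0 = "ctr g b"])
            (rule side_pos, erule ival_near[OF restr_supp])
        then show ?thesis by (simp add: v_def SQ_def sq_prod_def mult.assoc)
      qed
      \<comment> \<open>The lower bound on the chosen derivative enters through its single Taylor
        term at the centre of the square.\<close>
      have Tlow: "side g ^ d / (fact n)\<^sup>2 \<le> jet_norm n D 0 (ctr g a) (ctr g b) (3 * side g)"
        if Q: "(g, a, b) \<in> X" for g a b
      proof -
        have ab: "0 \<le> a" "a < 2 ^ g" "0 \<le> b" "b < 2 ^ g" using Q by (auto simp: X_def stopping_def)
        have ctr01: "ctr g e \<in> {0..1}" if "0 \<le> e" "e < 2 ^ g" for e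
        proof -
          have "e + 1 \<le> 2 ^ g" using that by simp
          then have "real_of_int (e + 1) \<le> real_of_int (2 ^ g)" by (simp only: of_int_le_iff)
          then have "of_int e + 1 / 2 \<le> (2::real) ^ g" by simp
          then show ?thesis using that by (simp add: ctr_def)
        qed
        have "1 \<le> \<bar>D \<alpha>1 \<alpha>2 (ctr g a) (ctr g b)\<bar>" using low ctr01 ab unfolding D_def by blast
        have "side g ^ d / (fact n)\<^sup>2 \<le> \<bar>D \<alpha>1 \<alpha>2 (ctr g a) (ctr g b)\<bar> * (3 * side g) ^ (\<alpha>1 + \<alpha>2) / (fact \<alpha>1 * fact \<alpha>2)"
        proof (rule frac_le)
          have "side g ^ d \<le> (3 * side g) ^ d" by (intro power_mono) auto
          then have "1 * side g ^ d \<le> \<bar>D \<alpha>1 \<alpha>2 (ctr g a) (ctr g b)\<bar> * (3 * side g) ^ d"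
            using \<open>1 \<le> \<bar>D \<alpha>1 \<alpha>2 (ctr g a) (ctr g b)\<bar>\<close> by (intro mult_mono) auto
          then show "side g ^ d \<le> \<bar>D \<alpha>1 \<alpha>2 (ctr g a) (ctr g b)\<bar> * (3 * side g) ^ (\<alpha>1 + \<alpha>2)" by (simp add: \<alpha>)
          show "fact \<alpha>1 * fact \<alpha>2 \<le> ((fact n)\<^sup>2 :: real)"
            unfolding power2_eq_square using \<alpha>n by (intro mult_mono fact_mono) auto
        qed auto
        also have "\<dots> \<le> jet_norm n D 0 (ctr g a) (ctr g b) (3 * side g)"
          using \<alpha>n by (intro jet_norm_term_le) auto
        finally show ?thesis .
      qed
      have Tpos: "0 < jet_norm n D 0 (ctr g a) (ctr g b) (3 * side g)" if Q: "(g, a, b) \<in> X" for g a b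
        by (rule less_le_trans[OF _ Tlow[OF Q]]) (simp add: zero_less_power)
      have Tle: "jet_norm n D 0 (ctr g a) (ctr g b) (3 * side g)
          \<le> m (g, a, b) + osc_norm n D (ctr g a) (ctr g b) (3 * side g)" for g a b
        using jet_norm_0_le[of "3 * side g" n D "ctr g a" "ctr g b"] by (simp add: m_def osc_norm_def)
      have good_T: "jet_norm n D 0 (ctr g a) (ctr g b) (3 * side g) \<le> 3 / 2 * m (g, a, b)"
        if "good n D g a b" for g a b
        using Tle[of g a b] that unfolding good_def by (simp add: m_def)
      have good_low: "c * side g ^ d \<le> m (g, a, b)" if "(g, a, b) \<in> X" "good n D g a b" for g a b
      proof -
        have "c * side g ^ d = 2 / 3 * (side g ^ d / (fact n)\<^sup>2)" by (simp add: c_def)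
        then show ?thesis using Tlow[OF that(1)] good_T[OF that(2)] by linarith
      qed
      have good_pos: "0 < m (g, a, b)" if "(g, a, b) \<in> X" "good n D g a b" for g a b
        using Tpos[OF that(1)] good_T[OF that(2)] by linarith
      have weight: "v Q \<le> W * L powr (- \<nu>) * q powr \<bar>of_int (lev Q - j0)\<bar> * SQ Q"
        if QX: "Q \<in> X" and gd: "case Q of (g, a, b) \<Rightarrow> good n D g a b" for Q
      \<comment> \<open>If a local norm vanishes, the trivial bound already gives zero; otherwise
        division by \<open>SQ Q\<close> reduces the claim to an inequality between numbers.\<close>
      proof (cases "SQ Q = 0")
        case True
        obtain g a b where Q: "Q = (g, a, b)" by (cases Q) auto
        show ?thesis using triv[of g a b] True by (simp add: Q)
      next
        case False
        then have SQpos: "0 < SQ Q" using SQ0[of Q] by simp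
        obtain g a b where Q: "Q = (g, a, b)" by (cases Q) auto
        have gd: "good n D g a b" using gd by (simp add: Q)
        have mp: "0 < m (g, a, b)" using good_pos QX gd by (simp add: Q)
        have osc: "v Q \<le> 7 * (L * m Q) powr (- 1 / 6) * SQ Q"
        proof -
          have "cmod (tform l (P 0 0) (restr (ival g a) f1) (restr (ival g b) f2) (restr (band g a b) f3))
            \<le> 7 * (\<bar>l\<bar> * m (g, a, b)) powr (- 1 / 6) * nrm (restr (ival g a) f1) * nrm (restr (ival g b) f2) * nrm (restr (band g a b) f3)"
          proof (rule tform_box_bound[OF P _ mp l _ nr(1) nr(2) nr(3)])
            show "tame_on_box (curv P) (ctr g a) (ctr g b) (side g) (m (g, a, b))"
              using good_tame[OF D gd] by (simp add: D_def m_def)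
          qed (rule side_pos, (erule ival_near[OF restr_supp])+)
          then show ?thesis by (simp add: Q v_def SQ_def sq_prod_def L_def mult.assoc)
        qed
        have "v Q / SQ Q \<le> 14 * (2 / c)\<^sup>2 * L powr (- (1 / (2 * (3 + real d)))) *
           2 powr (- (1 / (6 * (real d + 1))) * \<bar>of_int (\<lfloor>log 2 (m Q)\<rfloor> - \<lfloor>log 2 (L powr (- real d / (3 + real d)))\<rfloor>)\<bar>)"
        proof (rule level_weight[OF L _ side_le_1 _ c])
          show "0 < side g" by simp
          show "0 < m Q" using mp by (simp add: Q)
          show "c * side g ^ d \<le> m Q" using good_low QX gd by (simp add: Q)
          show "v Q / SQ Q \<le> sqrt (side g)" using triv[of g a b] SQpos by (simp add: Q pos_divide_le_eq)
          show "v Q / SQ Q \<le> 7 * (L * m Q) powr (- 1 / 6)" using osc SQpos by (simp add: pos_divide_le_eq)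
        qed
        then have "v Q / SQ Q \<le> W * L powr (- \<nu>) * q powr \<bar>of_int (lev Q - j0)\<bar>"
          unfolding W_def \<nu>_def q_def lev_def j0_def powr_powr .
        then show ?thesis using SQpos by (simp add: pos_divide_le_eq)
      qed
      let ?gd = "\<lambda>Q. case Q of (g, a, b) \<Rightarrow> good n D g a b"
      let ?V = "\<lambda>Q s. case Q of (g, a, b) \<Rightarrow> jet_norm n D 1 (ctr g a) (ctr g b) (s * side g)"
      let ?U = "\<lambda>Q s. case Q of (g, a, b) \<Rightarrow> jet_norm n (flip D) 1 (ctr g b) (ctr g a) (s * side g)"
      \<comment> \<open>The square of generation 0 has no parent and stands apart. Bad squares are
        terminal and are sorted by the variable in which the oscillation dominates; a good square
        with a bad parent oscillates in y, or else in x.\<close>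
      define R where "R = {Q \<in> X. fst Q = 0 \<and> ?gd Q}"
      define TV where "TV = {Q \<in> X. \<not> ?gd Q \<and> ?U Q 3 \<le> ?V Q 3}"
      define TH where "TH = {Q \<in> X. \<not> ?gd Q \<and> \<not> ?U Q 3 \<le> ?V Q 3}"
      define GV where "GV = {Q \<in> X. ?gd Q \<and> fst Q \<noteq> 0 \<and> m Q / 8 \<le> ?V Q 7}"
      define GH where "GH = {Q \<in> X. ?gd Q \<and> fst Q \<noteq> 0 \<and> \<not> m Q / 8 \<le> ?V Q 7}"
      note fam = swp_family_sum[OF f D N1 L2, folded K_def M_def SQ_def]
      have sumR: "sum v R \<le> W * L powr (- \<nu>) * M"
      proof -
        have sub: "R \<subseteq> {(0, 0, 0)}" unfolding R_def X_def stopping_def by auto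
        show ?thesis
        proof (cases "R = {}")
          case True
          then show ?thesis using W0 M0 by simp
        next
          case False
          then have R: "R = {(0, 0, 0)}" using sub by blast
          then have "(0, 0, 0) \<in> R" by blast
          then have "(0, 0, 0) \<in> X" "?gd (0, 0, 0)" unfolding R_def by blast+
          then have "v (0, 0, 0) \<le> W * L powr (- \<nu>) * q powr \<bar>of_int (lev (0, 0, 0) - j0)\<bar> * SQ (0, 0, 0)"
            by (rule weight)
          also have "\<dots> \<le> W * L powr (- \<nu>) * 1 * M"
            using q W0 SQM SQ0 by (intro mult_mono mult_nonneg_nonneg) (auto intro: powr_le1)
          finally show ?thesis using R by simp
        qed
      qed
      \<comment> \<open>Badness means m < 2 osc, so the full norm, at most m + osc, is below 3
        osc.\<close>
      have term_T: "fst Q = G \<and> (case Q of (g, a, b) \<Rightarrow> jet_norm n D 0 (ctr g a) (ctr g b) (3 * side g)) \<le> 3 * (?V Q 3 + ?U Q 3)"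
        if "Q \<in> X" "\<not> ?gd Q" for Q
      proof -
        obtain g a b where Q: "Q = (g, a, b)" by (cases Q) auto
        have "g = G" using that unfolding Q X_def stopping_def by auto
        moreover have "m (g, a, b) < 2 * osc_norm n D (ctr g a) (ctr g b) (3 * side g)"
          using that unfolding Q good_def m_def by auto
        ultimately show ?thesis using Tle[of g a b] unfolding Q osc_norm_def by simp
      qed
      have term_sum: "sum v F \<le> K * L powr (- \<nu>) * M"
        if F: "F \<subseteq> X" "\<And>Q. Q \<in> F \<Longrightarrow> \<not> ?gd Q"
          and vf: "vertical_family n C0 D F \<or> vertical_family n C0 (flip D) (swp ` F)" for F
      proof -
        have "sum v F \<le> (\<Sum>Q\<in>F. L powr (- \<nu>) * SQ Q)"
        proof (rule sum_mono)
          fix Q assume Q: "Q \<in> F"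
          obtain g a b where e: "Q = (g, a, b)" by (cases Q) auto
          have "g = G" using term_T[of Q] F Q unfolding e by auto
          then have "v Q \<le> sqrt (side G) * SQ Q" using triv[of g a b] unfolding e by simp
          also have "\<dots> \<le> L powr (- \<nu>) * SQ Q" using G SQ0 by (intro mult_right_mono) auto
          finally show "v Q \<le> L powr (- \<nu>) * SQ Q" .
        qed
        also have "\<dots> = L powr (- \<nu>) * sum SQ F" by (simp add: sum_distrib_left)
        also have "\<dots> \<le> L powr (- \<nu>) * (K * M)" using fam[OF _ _ vf] by (intro mult_left_mono) auto
        finally show ?thesis by (simp add: ac_simps)
      qed
      have six: "0 < x \<and> x \<le> 6 * y" if "x \<le> 3 * (y + z)" "0 < x" "z \<le> y" for x y z :: real
        using that by simp
      have sumTV: "sum v TV \<le> K * L powr (- \<nu>) * M"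
      proof (rule term_sum)
        have "vertical_family n C0 D TV"
          unfolding C0_def
        proof (rule vertical_family_terminal[where G = G])
          show "finite TV" using finX unfolding TV_def by simp
          fix g a b assume Q: "(g, a, b) \<in> TV"
          then have QX: "(g, a, b) \<in> X" "\<not> ?gd (g, a, b)" "?U (g, a, b) 3 \<le> ?V (g, a, b) 3" unfolding TV_def by blast+
          show "g = G" using term_T[OF QX(1,2)] by simp
          show "0 < jet_norm n D 0 (ctr g a) (ctr g b) (3 * side g) \<and>
            jet_norm n D 0 (ctr g a) (ctr g b) (3 * side g) \<le> 6 * jet_norm n D 1 (ctr g a) (ctr g b) (3 * side g)"
            by (rule six[OF conjunct2[OF term_T[OF QX(1,2)], unfolded prod.case] Tpos[OF QX(1)] QX(3)[unfolded prod.case]])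
        qed
        then show "vertical_family n C0 D TV \<or> vertical_family n C0 (flip D) (swp ` TV)" ..
      qed (auto simp: TV_def)
      have sumTH: "sum v TH \<le> K * L powr (- \<nu>) * M"
      proof (rule term_sum)
        have "vertical_family n C0 (flip D) (swp ` TH)"
          unfolding C0_def
        proof (rule vertical_family_terminal[where G = G])
          show "finite (swp ` TH)" using finX unfolding TH_def by simp
          fix g a b assume "(g, a, b) \<in> swp ` TH"
          then have Q: "(g, b, a) \<in> TH" by (auto simp: swp_def)
          then have QX: "(g, b, a) \<in> X" "\<not> ?gd (g, b, a)" "\<not> ?U (g, b, a) 3 \<le> ?V (g, b, a) 3" unfolding TH_def by blast+
          show "g = G" using term_T[OF QX(1,2)] by simp
          show "0 < jet_norm n (flip D) 0 (ctr g a) (ctr g b) (3 * side g) \<and>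
            jet_norm n (flip D) 0 (ctr g a) (ctr g b) (3 * side g) \<le> 6 * jet_norm n (flip D) 1 (ctr g a) (ctr g b) (3 * side g)"
            unfolding jet_norm_flip_0
            by (rule six[OF conjunct2[OF term_T[OF QX(1,2)], unfolded prod.case add.commute[of "jet_norm n D 1 _ _ _"]]
                  Tpos[OF QX(1)] less_imp_le[OF QX(3)[unfolded prod.case not_le]]])
        qed
        then show "vertical_family n C0 D TH \<or> vertical_family n C0 (flip D) (swp ` TH)" ..
      qed (auto simp: TH_def)
      \<comment> \<open>On one level the weight is constant and the family sum is at most K M,
        however many generations occur; the levels then form a geometric series around
        \<open>j0\<close>.\<close>
      have level_sum: "sum v F \<le> K * W * (2 / (1 - q)) * L powr (- \<nu>) * M"
        if F: "F \<subseteq> X" "\<And>Q. Q \<in> F \<Longrightarrow> ?gd Q"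
          and vf: "\<And>j. vertical_family n C0 D {Q \<in> F. lev Q = j} \<or> vertical_family n C0 (flip D) (swp ` {Q \<in> F. lev Q = j})" for F
      proof -
        have finF: "finite F" using F finX by (auto intro: finite_subset)
        have "sum v F = (\<Sum>j\<in>lev ` F. \<Sum>Q\<in>{Q \<in> F. lev Q = j}. v Q)"
          by (rule sum.group[symmetric]) (use finF in auto)
        also have "\<dots> \<le> (\<Sum>j\<in>lev ` F. W * L powr (- \<nu>) * (K * M) * q powr \<bar>of_int (j - j0)\<bar>)"
        proof (rule sum_mono)
          fix j
          have "(\<Sum>Q\<in>{Q \<in> F. lev Q = j}. v Q) \<le> (\<Sum>Q\<in>{Q \<in> F. lev Q = j}. W * L powr (- \<nu>) * q powr \<bar>of_int (j - j0)\<bar> * SQ Q)"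
          proof (rule sum_mono)
            fix Q assume "Q \<in> {Q \<in> F. lev Q = j}"
            then show "v Q \<le> W * L powr (- \<nu>) * q powr \<bar>of_int (j - j0)\<bar> * SQ Q"
              using weight[of Q] F by auto
          qed
          also have "\<dots> = W * L powr (- \<nu>) * q powr \<bar>of_int (j - j0)\<bar> * sum SQ {Q \<in> F. lev Q = j}"
            by (simp add: sum_distrib_left)
          also have "\<dots> \<le> W * L powr (- \<nu>) * q powr \<bar>of_int (j - j0)\<bar> * (K * M)"
            using fam[OF _ _ vf[of j]] W0 by (intro mult_left_mono) auto
          finally show "(\<Sum>Q\<in>{Q \<in> F. lev Q = j}. v Q) \<le> W * L powr (- \<nu>) * (K * M) * q powr \<bar>of_int (j - j0)\<bar>"
            by (simp add: ac_simps)
        qed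
        also have "\<dots> = W * L powr (- \<nu>) * (K * M) * (\<Sum>j\<in>lev ` F. q powr \<bar>of_int (j - j0)\<bar>)"
          by (simp add: sum_distrib_left)
        also have "\<dots> \<le> W * L powr (- \<nu>) * (K * M) * (2 / (1 - q))"
          using finF q W0 K0 M0 by (intro mult_left_mono two_sided_geometric) auto
        finally show ?thesis by (simp add: ac_simps)
      qed
      have lev_m: "2 powr of_int (lev (g, a, b)) \<le> m (g, a, b) \<and> m (g, a, b) < 2 * 2 powr of_int (lev (g, a, b))"
        if Q: "(g, a, b) \<in> X" "good n D g a b" for g a b
      proof -
        have mp: "0 < m (g, a, b)" by (rule good_pos[OF Q])
        have e: "m (g, a, b) = 2 powr log 2 (m (g, a, b))" using mp by simp
        have "2 powr of_int (lev (g, a, b)) \<le> 2 powr log 2 (m (g, a, b))"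
          unfolding lev_def by simp
        moreover have "2 powr log 2 (m (g, a, b)) < 2 powr (of_int (lev (g, a, b)) + 1)"
          unfolding lev_def by simp
        ultimately show ?thesis using e by (simp add: powr_add)
      qed
      have sumGV: "sum v GV \<le> K * W * (2 / (1 - q)) * L powr (- \<nu>) * M"
      proof (rule level_sum)
        fix j
        have "vertical_family n C0 D {Q \<in> GV. lev Q = j}"
          unfolding C0_def
        proof (rule vertical_family_level)
          show "finite {Q \<in> GV. lev Q = j}" using finX unfolding GV_def by simp
          show "0 < (2::real) powr of_int j" by simp
          fix g a b assume "(g, a, b) \<in> {Q \<in> GV. lev Q = j}"
          then have Q: "(g, a, b) \<in> X" "good n D g a b" "lev (g, a, b) = j" "m (g, a, b) / 8 \<le> ?V (g, a, b) 7"
            unfolding GV_def by auto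
          note lm = lev_m[OF Q(1,2), unfolded Q(3)]
          show "jet_norm n D 0 (ctr g a) (ctr g b) (3 * side g) \<le> 3 * 2 powr of_int j"
            using good_T[OF Q(2)] lm by linarith
          show "2 powr of_int j / 8 \<le> jet_norm n D 1 (ctr g a) (ctr g b) (7 * side g)"
            using Q(4) lm by simp
        qed
        then show "vertical_family n C0 D {Q \<in> GV. lev Q = j} \<or> vertical_family n C0 (flip D) (swp ` {Q \<in> GV. lev Q = j})" ..
      qed (auto simp: GV_def)
      have sumGH: "sum v GH \<le> K * W * (2 / (1 - q)) * L powr (- \<nu>) * M"
      proof (rule level_sum)
        fix j
        have "vertical_family n C0 (flip D) (swp ` {Q \<in> GH. lev Q = j})"
          unfolding C0_def
        proof (rule vertical_family_level)
          show "finite (swp ` {Q \<in> GH. lev Q = j})" using finX unfolding GH_def by simp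
          show "0 < (2::real) powr of_int j" by simp
          fix g a b assume "(g, a, b) \<in> swp ` {Q \<in> GH. lev Q = j}"
          then have Q': "(g, b, a) \<in> {Q \<in> GH. lev Q = j}" by (auto simp: swp_def)
          then have Q: "(g, b, a) \<in> X" "good n D g b a" "lev (g, b, a) = j" "\<not> m (g, b, a) / 8 \<le> ?V (g, b, a) 7" "g \<noteq> 0"
            unfolding GH_def by auto
          note lm = lev_m[OF Q(1,2), unfolded Q(3)]
          show "jet_norm n (flip D) 0 (ctr g a) (ctr g b) (3 * side g) \<le> 3 * 2 powr of_int j"
            unfolding jet_norm_flip_0 using good_T[OF Q(2)] lm by linarith
          have g1: "1 \<le> g" using Q(5) by simp
          \<comment> \<open>The parent is bad by the stopping rule, so the oscillation is at least
            m/4; its y-part is below m/8 by the choice of \<open>GH\<close>, and the x-part must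
            supply the rest.\<close>
          have "\<forall>g'<g. \<not> good n D g' (b div 2 ^ (g - g')) (a div 2 ^ (g - g'))"
            using Q(1) unfolding X_def stopping_def by simp
          then have "\<not> good n D (g - 1) (b div 2 ^ (g - (g - 1))) (a div 2 ^ (g - (g - 1)))"
            using g1 by (metis diff_less less_le_trans zero_less_one)
          moreover have "g - (g - 1) = 1" using g1 by simp
          ultimately have "\<not> good n D (g - 1) (b div 2) (a div 2)" by simp
          from osc_norm_of_bad_parent[OF D Q(2) g1 this]
          have "m (g, b, a) / 4 \<le> ?V (g, b, a) 7 + ?U (g, b, a) 7" by (simp add: m_def osc_norm_def)
          then show "2 powr of_int j / 8 \<le> jet_norm n (flip D) 1 (ctr g a) (ctr g b) (7 * side g)"
            using Q(4) lm by simp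
        qed
        then show "vertical_family n C0 D {Q \<in> GH. lev Q = j} \<or> vertical_family n C0 (flip D) (swp ` {Q \<in> GH. lev Q = j})" ..
      qed (auto simp: GH_def)
      have "tform l (P 0 0) f1 f2 f3
          = (\<Sum>(g, a, b)\<in>X. tform l (P 0 0) (restr (ival g a) f1) (restr (ival g b) f2) (restr (band g a b) f3))"
        unfolding X_def by (rule tform_decompose[OF P f]) (use s1 s2 in auto)
      then have "cmod (tform l (P 0 0) f1 f2 f3) \<le> sum v X"
        unfolding v_def case_prod_unfold by (simp add: norm_sum)
      also have "\<dots> \<le> sum v R + sum v TV + sum v TH + sum v GV + sum v GH"
        by (rule sum_cover_le[OF finX v0]) (auto simp: R_def TV_def TH_def GV_def GH_def)
      also have "\<dots> \<le> W * L powr (- \<nu>) * M + K * L powr (- \<nu>) * M + K * L powr (- \<nu>) * M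
          + K * W * (2 / (1 - q)) * L powr (- \<nu>) * M + K * W * (2 / (1 - q)) * L powr (- \<nu>) * M"
        by (intro add_mono sumR sumTV sumTH sumGV sumGH)
      also have "\<dots> = (Ctot - 1) * (L powr (- \<nu>) * M)" unfolding Ctot_def by (simp add: algebra_simps)
      also have "\<dots> \<le> Ctot * (L powr (- \<nu>) * M)" using M0 by (intro mult_right_mono) auto
      finally show ?thesis by (simp add: L_def M_def mult.assoc)
    qed
  qed
  show ?thesis
    using main Ct0(1) unfolding uniform_const_def \<nu>_def by (intro exI[of _ Ctot]) blast
qed

subsection \<open>Derivatives of bivariate polynomials\<close>

lemma coeff_dx: "coeff (dx S) j = pderiv (coeff S j)"
  by (simp add: dx_def coeff_map_poly)

lemma pderiv_of_nat_mult: "pderiv (of_nat k * p) = of_nat k * pderiv (p :: real poly)"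
  by (simp add: pderiv_mult)

lemma dx_dy_commute: "dx (dy S) = dy (dx S)"
  by (rule poly_eqI) (simp add: coeff_dx dy_def coeff_pderiv pderiv_of_nat_mult del: of_nat_Suc)

lemma dy_dx_pow: "dy ((dx ^^ a) S) = (dx ^^ a) (dy S)"
  by (induction a) (simp_all add: dx_dy_commute[symmetric])

lemma dx_dy_pow: "(dy ^^ b) (dx S) = dx ((dy ^^ b) S)"
  by (induction b) (simp_all add: dx_dy_commute)

lemma dx_diff: "dx (S - T) = dx S - dx T"
  by (rule poly_eqI) (simp add: coeff_dx pderiv_diff)

lemma dy_diff: "dy (S - T) = dy S - dy T"
  by (simp add: dy_def pderiv_diff)

lemma dx_pow_diff: "(dx ^^ a) (S - T) = (dx ^^ a) S - (dx ^^ a) T"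
  by (induction a) (simp_all add: dx_diff)

lemma dy_pow_diff: "(dy ^^ b) (S - T) = (dy ^^ b) S - (dy ^^ b) T"
  by (induction b) (simp_all add: dy_diff)

lemma eval2_diff: "eval2 (S - T) x y = eval2 S x y - eval2 T x y"
  by (simp add: eval2_def)

lemma dx_pow_0: "(dx ^^ a) 0 = 0"
  by (induction a) (simp_all add: dx_def)

lemma degree_pderiv_le: "degree (pderiv p) \<le> degree p - 1"
  by (rule degree_le) (auto simp: coeff_pderiv coeff_eq_0)

lemma higher_pderiv_eq_0: "degree p < a \<Longrightarrow> (pderiv ^^ a) p = 0"
proof (induction a arbitrary: p)
  case (Suc a)
  have z: "(pderiv ^^ a) 0 = 0" by (induction a) simp_all
  show ?case
  proof (cases "degree p = 0")
    case True
    then have "pderiv p = 0" by (metis pderiv_singleton degree_eq_zeroE pderiv_pCons pderiv_0 mult_zero_right add.left_neutral pCons_0_0)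
    then show ?thesis using z by (simp add: funpow_Suc_right del: funpow.simps)
  next
    case False
    then have "degree (pderiv p) < a" using Suc.prems degree_pderiv_le[of p] by linarith
    then show ?thesis using Suc.IH by (simp add: funpow_Suc_right del: funpow.simps)
  qed
qed simp

lemma coeff_dx_pow: "coeff ((dx ^^ a) S) j = (pderiv ^^ a) (coeff S j)"
  by (induction a) (simp_all add: coeff_dx)

text \<open>The set under \<open>Max\<close> has to be shown finite before its elements can be
  compared with the maximum.\<close>

lemma total_degree_bounds:
  "degree S \<le> total_degree S" "degree (coeff S j) \<le> total_degree S"
proof -
  let ?A = "{i + j | i j. coeff (coeff S j) i \<noteq> 0}"
  have "?A \<subseteq> (\<lambda>(i, j). i + j) ` (\<Union>j\<in>{..degree S}. {..degree (coeff S j)} \<times> {j})"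
  proof
    fix k assume "k \<in> ?A"
    then obtain i j where k: "k = i + j" "coeff (coeff S j) i \<noteq> 0" by blast
    have "i \<le> degree (coeff S j)" "j \<le> degree S" using k(2) by (auto intro: le_degree)
    then show "k \<in> (\<lambda>(i, j). i + j) ` (\<Union>j\<in>{..degree S}. {..degree (coeff S j)} \<times> {j})" using k(1) by force
  qed
  then have fin: "finite ?A" by (rule finite_subset) auto
  have le: "i + j \<le> total_degree S" if "coeff (coeff S j) i \<noteq> 0" for i j
    unfolding total_degree_def using fin that by (intro Max_ge) auto
  show "degree (coeff S j) \<le> total_degree S"
  proof (cases "coeff S j = 0")
    case False
    then have "coeff (coeff S j) (degree (coeff S j)) \<noteq> 0" by simp
    then show ?thesis using le by fastforce
  qed simp
  show "degree S \<le> total_degree S"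
  proof (cases "S = 0")
    case False
    then have "coeff S (degree S) \<noteq> 0" by simp
    then have "coeff (coeff S (degree S)) (degree (coeff S (degree S))) \<noteq> 0" by simp
    then show ?thesis using le by fastforce
  qed simp
qed

definition poly_jets :: "bipoly \<Rightarrow> nat \<Rightarrow> nat \<Rightarrow> real \<Rightarrow> real \<Rightarrow> real" where
  "poly_jets S a b x y = eval2 ((dx ^^ a) ((dy ^^ b) S)) x y"

lemma jet_family_poly_jets: "jet_family (total_degree S) (poly_jets S)"
  unfolding jet_family_def
proof (intro conjI allI impI)
  fix a b x y
  show "((\<lambda>t. poly_jets S a b t y) has_field_derivative poly_jets S (Suc a) b x y) (at x)"
    unfolding poly_jets_def using eval2_dx[of "(dx ^^ a) ((dy ^^ b) S)" y x] by simp
  show "((\<lambda>t. poly_jets S a b x t) has_field_derivative poly_jets S a (Suc b) x y) (at y)"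
    unfolding poly_jets_def using eval2_dy[of "(dx ^^ a) ((dy ^^ b) S)" x y] by (simp add: dy_dx_pow)
  assume "a > total_degree S \<or> b > total_degree S"
  then show "poly_jets S a b x y = 0"
  proof
    assume "b > total_degree S"
    then have "(dy ^^ b) S = 0"
      unfolding dy_def using total_degree_bounds(1)[of S] by (intro higher_pderiv_eq_0) linarith
    then show ?thesis by (simp add: poly_jets_def dx_pow_0 eval2_def)
  next
    assume a: "a > total_degree S"
    have "(dx ^^ a) S = 0"
    proof (rule poly_eqI)
      fix j
      have "degree (coeff S j) < a" using a total_degree_bounds(2)[of S j] by linarith
      then show "coeff ((dx ^^ a) S) j = coeff 0 j" by (simp add: coeff_dx_pow higher_pderiv_eq_0)
    qed
    moreover have "(dx ^^ a) ((dy ^^ b) S) = (dy ^^ b) ((dx ^^ a) S)"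
      by (induction b) (simp_all flip: dy_dx_pow)
    moreover have "(dy ^^ b) 0 = 0" by (induction b) (simp_all add: dy_def)
    ultimately show ?thesis by (simp add: poly_jets_def eval2_def)
  qed
qed

text \<open>The formal derivatives commute, which identifies the derivatives of H in the statement
  with the jets used throughout.\<close>

lemma curv_poly_jets: "curv (poly_jets S) a b x y = eval2 (multi_deriv (a, b) (H_of S)) x y"
proof -
  have "multi_deriv (a, b) (H_of S)
      = (dx ^^ a) ((dy ^^ b) (dx (dx (dy S)))) - (dx ^^ a) ((dy ^^ b) (dx (dy (dy S))))"
    by (simp add: multi_deriv_def H_of_def dx_diff dy_diff dx_pow_diff dy_pow_diff dx_dy_commute[symmetric])
  also have "(dx ^^ a) ((dy ^^ b) (dx (dx (dy S)))) = (dx ^^ (a + 2)) ((dy ^^ (b + 1)) S)"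
    by (simp add: dx_dy_pow funpow_swap1 numeral_2_eq_2)
  also have "(dx ^^ a) ((dy ^^ b) (dx (dy (dy S)))) = (dx ^^ (a + 1)) ((dy ^^ (b + 2)) S)"
    by (simp add: dx_dy_pow funpow_swap1 numeral_2_eq_2)
  finally show ?thesis by (simp add: curv_def poly_jets_def eval2_diff)
qed

lemma eval2_poly_jets: "poly_jets S 0 0 = eval2 S"
  by (simp add: fun_eq_iff poly_jets_def)

subsection \<open>The smooth amplitude\<close>

lemma frechet_derivative_zero_on_open:
  assumes "open U" "z \<in> U" "\<And>w. w \<in> U \<Longrightarrow> f w = 0"
  shows "frechet_derivative f (at z) = (\<lambda>_. 0)"
proof -
  have "(f has_derivative (\<lambda>_. 0)) (at z)"
    by (rule has_derivative_transform_within_open[of "\<lambda>_. 0" _ z UNIV U]) (use assms in \<open>auto\<close>)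
  then show ?thesis by (rule frechet_derivative_at[symmetric])
qed

lemma integral_of_derivative:
  fixes u u' :: "real \<Rightarrow> complex"
  assumes d: "\<And>s. (u has_vector_derivative u' s) (at s)" and c: "continuous_on UNIV u'"
    and z: "\<And>s. s < 0 \<Longrightarrow> u s = 0 \<and> u' s = 0"
  shows "u x = (LINT s|lborel. (if s \<le> x then u' s else 0))"
proof (cases "x < 0")
  case True
  then have "(\<lambda>s. if s \<le> x then u' s else 0) = (\<lambda>_. 0)" using z by auto
  then show ?thesis using z True by simp
next
  case False
  have "(LINT s|lborel. indicator {-1..x} s *\<^sub>R u' s) = u x - u (-1)"
    by (rule integral_FTC_atLeastAtMost)
      (use False d c in \<open>auto intro: has_vector_derivative_at_within continuous_on_subset\<close>)
  moreover have "(\<lambda>s. indicator {-1..x} s *\<^sub>R u' s) = (\<lambda>s. if s \<le> x then u' s else 0)"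
    using z by (auto simp: fun_eq_iff indicator_def)
  ultimately show ?thesis using z by simp
qed

lemma slice_derivative:
  fixes \<phi> :: "real \<times> real \<Rightarrow> complex"
  assumes "\<phi> differentiable (at (x, y))"
  shows "((\<lambda>s. \<phi> (s, y)) has_vector_derivative frechet_derivative \<phi> (at (x, y)) (1, 0)) (at x)"
    and "((\<lambda>t. \<phi> (x, t)) has_vector_derivative frechet_derivative \<phi> (at (x, y)) (0, 1)) (at y)"
proof -
  have D: "(\<phi> has_derivative frechet_derivative \<phi> (at (x, y))) (at (x, y))"
    using assms frechet_derivative_works by blast
  have "((\<lambda>s. (s, y)) has_derivative (\<lambda>h. (h, 0))) (at x)"
    by (intro has_derivative_Pair has_derivative_ident has_derivative_const)
  from diff_chain_at[OF this D]
  have "((\<lambda>s. \<phi> (s, y)) has_derivative (\<lambda>h. frechet_derivative \<phi> (at (x, y)) (h, 0))) (at x)" unfolding o_def .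
  moreover have "(\<lambda>h. frechet_derivative \<phi> (at (x, y)) (h, 0)) = (\<lambda>h. h *\<^sub>R frechet_derivative \<phi> (at (x, y)) (1, 0))"
  proof
    fix h :: real
    have "frechet_derivative \<phi> (at (x, y)) (h *\<^sub>R (1, 0)) = h *\<^sub>R frechet_derivative \<phi> (at (x, y)) (1, 0)"
      by (rule linear_scale[OF linear_frechet_derivative[OF assms]])
    moreover have "h *\<^sub>R ((1, 0) :: real \<times> real) = (h, 0)" by simp
    ultimately show "frechet_derivative \<phi> (at (x, y)) (h, 0) = h *\<^sub>R frechet_derivative \<phi> (at (x, y)) (1, 0)"
      by (simp only:)
  qed
  ultimately show "((\<lambda>s. \<phi> (s, y)) has_vector_derivative frechet_derivative \<phi> (at (x, y)) (1, 0)) (at x)"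
    by (simp only: has_vector_derivative_def)
  have "((\<lambda>t. (x, t)) has_derivative (\<lambda>h. (0, h))) (at y)"
    by (intro has_derivative_Pair has_derivative_ident has_derivative_const)
  from diff_chain_at[OF this D]
  have "((\<lambda>t. \<phi> (x, t)) has_derivative (\<lambda>h. frechet_derivative \<phi> (at (x, y)) (0, h))) (at y)" unfolding o_def .
  moreover have "(\<lambda>h. frechet_derivative \<phi> (at (x, y)) (0, h)) = (\<lambda>h. h *\<^sub>R frechet_derivative \<phi> (at (x, y)) (0, 1))"
  proof
    fix h :: real
    have "frechet_derivative \<phi> (at (x, y)) (h *\<^sub>R (0, 1)) = h *\<^sub>R frechet_derivative \<phi> (at (x, y)) (0, 1)"
      by (rule linear_scale[OF linear_frechet_derivative[OF assms]])
    moreover have "h *\<^sub>R ((0, 1) :: real \<times> real) = (0, h)" by simp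
    ultimately show "frechet_derivative \<phi> (at (x, y)) (0, h) = h *\<^sub>R frechet_derivative \<phi> (at (x, y)) (0, 1)"
      by (simp only:)
  qed
  ultimately show "((\<lambda>t. \<phi> (x, t)) has_vector_derivative frechet_derivative \<phi> (at (x, y)) (0, 1)) (at y)"
    by (simp only: has_vector_derivative_def)
qed

text \<open>\<open>h\<close> is the mixed second derivative of \<phi>; integrating it in both
  variables from outside the support recovers \<phi>.\<close>

lemma amplitude_representation:
  fixes \<phi> :: "real \<times> real \<Rightarrow> complex"
  assumes smooth: "smooth_compactly_supported \<phi>" and supp: "supp \<phi> \<subseteq> {0..1} \<times> {0..1}"
  obtains h :: "real \<times> real \<Rightarrow> complex" where
    "continuous_on UNIV h" "\<And>z. h z \<noteq> 0 \<Longrightarrow> z \<in> {0..1} \<times> {0..1}"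
    "\<And>x y. \<phi> (x, y) = (LINT (s, t)|lborel. (if s \<le> x \<and> t \<le> y then h (s, t) else 0))"
    "continuous_on UNIV \<phi>" "\<And>x y. \<phi> (x, y) \<noteq> 0 \<Longrightarrow> 0 \<le> x \<and> x < 1 \<and> 0 \<le> y \<and> y < 1"
proof -
  have "C_k (Suc (Suc 0)) \<phi>" using smooth by (simp add: smooth_compactly_supported_def)
  then have d0: "\<And>z. \<phi> differentiable (at z)"
    and d1: "\<And>v z. (\<lambda>z. frechet_derivative \<phi> (at z) v) differentiable (at z)"
    and c2: "\<And>v w. continuous_on UNIV (\<lambda>z. frechet_derivative (\<lambda>z. frechet_derivative \<phi> (at z) v) (at z) w)"
    unfolding C_k.simps by blast+
  define g where "g = (\<lambda>z. frechet_derivative \<phi> (at z) (1, 0))"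
  define h where "h = (\<lambda>z. frechet_derivative g (at z) (0, 1))"
  have dg: "\<And>z. g differentiable (at z)" unfolding g_def by (rule d1)
  have ch: "continuous_on UNIV h" unfolding h_def g_def by (rule c2)
  have cphi: "continuous_on UNIV \<phi>"
    using d0 by (intro continuous_at_imp_continuous_on ballI differentiable_imp_continuous_within)
  have cg: "continuous_on UNIV g"
    using dg by (intro continuous_at_imp_continuous_on ballI differentiable_imp_continuous_within)
  define K :: "(real \<times> real) set" where "K = {0..1} \<times> {0..1}"
  have K: "closed K" unfolding K_def by (intro closed_Times) auto
  have phi0: "\<phi> z = 0" if "z \<notin> K" for z
  proof (rule ccontr)
    assume "\<phi> z \<noteq> 0"
    then have "z \<in> support_on UNIV \<phi>" by (simp add: support_on_def)
    then have "z \<in> Defs.supp \<phi>" unfolding Defs.supp_def using closure_subset by blast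
    then show False using supp that unfolding K_def by blast
  qed
  have g0: "g z = 0" if "z \<notin> K" for z
    unfolding g_def by (subst frechet_derivative_zero_on_open[of "- K"]) (use K that phi0 in \<open>auto simp: open_Compl\<close>)
  have h0: "h z = 0" if "z \<notin> K" for z
    unfolding h_def by (subst frechet_derivative_zero_on_open[of "- K"]) (use K that g0 in \<open>auto simp: open_Compl\<close>)
  have gx: "\<phi> (x, y) = (LINT s|lborel. (if s \<le> x then g (s, y) else 0))" for x y
  proof (rule integral_of_derivative)
    show "((\<lambda>s. \<phi> (s, y)) has_vector_derivative g (s, y)) (at s)" for s
      unfolding g_def by (rule slice_derivative(1)[OF d0])
    show "continuous_on UNIV (\<lambda>s. g (s, y))"
      by (rule continuous_on_compose2[OF cg]) (auto intro!: continuous_intros)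
    show "\<phi> (s, y) = 0 \<and> g (s, y) = 0" if "s < 0" for s
      using that by (auto intro!: phi0 g0 simp: K_def)
  qed
  have hy: "g (s, y) = (LINT t|lborel. (if t \<le> y then h (s, t) else 0))" for s y
  proof (rule integral_of_derivative)
    show "((\<lambda>t. g (s, t)) has_vector_derivative h (s, t)) (at t)" for t
      unfolding h_def by (rule slice_derivative(2)[OF dg])
    show "continuous_on UNIV (\<lambda>t. h (s, t))"
      by (rule continuous_on_compose2[OF ch]) (auto intro!: continuous_intros)
    show "g (s, t) = 0 \<and> h (s, t) = 0" if "t < 0" for t
      using that by (auto intro!: h0 g0 simp: K_def)
  qed
  have hm: "h \<in> borel_measurable borel" by (rule borel_measurable_continuous_onI[OF ch])
  obtain B where B: "\<And>z. cmod (h z) \<le> B"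
  proof -
    have "compact K" unfolding K_def by (intro compact_Times) auto
    then have "compact (h ` K)" using ch by (intro compact_continuous_image) (auto intro: continuous_on_subset)
    then obtain B where "\<forall>w\<in>h ` K. norm w \<le> B" using compact_imp_bounded bounded_iff by metis
    then have "cmod (h z) \<le> max B 0" for z using h0[of z] by (cases "z \<in> K") (auto simp: le_max_iff_disj)
    then show thesis by (rule that)
  qed
  have rep: "\<phi> (x, y) = (LINT (s, t)|lborel. (if s \<le> x \<and> t \<le> y then h (s, t) else 0))" for x y
  proof -
    let ?f = "\<lambda>(s, t). if s \<le> x \<and> t \<le> y then h (s, t) else 0"
    have i: "integrable lborel ?f"
    proof (rule integrable_2_bounded)
      note [measurable] = hm[folded borel_prod]
      show "?f \<in> borel_measurable borel" unfolding case_prod_unfold borel_prod[symmetric] by measurable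
      have "0 \<le> B" using B[of "(0, 0)"] norm_ge_zero order_trans by blast
      then show "norm (if s \<le> x \<and> t \<le> y then h (s, t) else 0) \<le> B" for s t using B by auto
      show "\<bar>s\<bar> \<le> 1 \<and> \<bar>t\<bar> \<le> 1" if "(if s \<le> x \<and> t \<le> y then h (s, t) else 0) \<noteq> 0" for s t
      proof -
        have "h (s, t) \<noteq> 0" using that by (auto split: if_splits)
        then have "(s, t) \<in> K" using h0 by blast
        then show ?thesis by (simp add: K_def)
      qed
    qed
    have "(LINT (s, t)|lborel. (if s \<le> x \<and> t \<le> y then h (s, t) else 0))
        = (LINT s|lborel. LINT t|lborel. (if s \<le> x \<and> t \<le> y then h (s, t) else 0))"
      using lborel_fubini(1)[OF i] by simp
    also have "\<dots> = (LINT s|lborel. (if s \<le> x then g (s, y) else 0))"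
      unfolding hy by (intro Bochner_Integration.integral_cong) auto
    finally show ?thesis using gx by simp
  qed
  \<comment> \<open>The set where \<phi> \<noteq> 0 is open and therefore lies in the interior of
    the square; this yields the strict upper bounds that half-open dyadic intervals require.\<close>
  have strict: "0 \<le> x \<and> x < 1 \<and> 0 \<le> y \<and> y < 1" if "\<phi> (x, y) \<noteq> 0" for x y
  proof -
    have "open (\<phi> -` (- {0}))"
      by (rule open_vimage[OF _ cphi]) auto
    moreover have "\<phi> -` (- {0}) \<subseteq> K" using phi0 by auto
    ultimately have "\<phi> -` (- {0}) \<subseteq> interior K" by (simp add: interior_maximal)
    moreover have "interior K = {0<..<1} \<times> {0<..<1}" unfolding K_def by (simp add: interior_Times)
    ultimately show ?thesis using that by auto
  qed
  show thesis
    by (rule that[OF ch _ rep cphi strict]) (use h0 in \<open>auto simp: K_def\<close>)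
qed

subsection \<open>Passage to square-integrable functions\<close>

text \<open>Lets the three functions be changed on null sets: each of x, y and x + y pulls a null
  set of the line back to a null set of the plane, almost every slice of the preimage being
  null.\<close>

lemma AE_pair_transfer:
  fixes P :: "real \<Rightarrow> bool"
  assumes ae: "AE x in lborel. P x"
  shows "AE z in (lborel :: (real \<times> real) measure). P (fst z)"
    and "AE z in (lborel :: (real \<times> real) measure). P (snd z)"
    and "AE z in (lborel :: (real \<times> real) measure). P (fst z + snd z)"
proof -
  obtain N where N: "N \<in> null_sets lborel" "{x. \<not> P x} \<subseteq> N" using ae by (auto elim!: AE_E simp: null_sets_def)
  have aeN: "AE x in lborel. x \<notin> N" using N(1) by (rule AE_not_in)
  have Nm[measurable]: "N \<in> sets borel" using N(1) by auto
  have gen: "AE z in (lborel :: (real \<times> real) measure). P (T z)"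
    if [measurable]: "T \<in> borel_measurable (borel \<Otimes>\<^sub>M borel)" and "AE x in lborel. AE y in lborel. T (x, y) \<notin> N" for T
  proof -
    have "{z. T z \<notin> N} \<in> sets (borel \<Otimes>\<^sub>M borel)"
      using measurable_sets[OF that(1), of "- N"] Nm by (simp add: vimage_def space_pair_measure)
    then have "AE z in lborel \<Otimes>\<^sub>M lborel. T z \<notin> N"
      using that(2) by (intro lborel_pair.AE_pair_measure) (simp_all add: space_pair_measure)
    then have "AE z in (lborel :: (real \<times> real) measure). T z \<notin> N" unfolding lborel_prod .
    then show ?thesis by eventually_elim (use N(2) in auto)
  qed
  show "AE z in (lborel :: (real \<times> real) measure). P (fst z)"
    by (rule gen) (use aeN in \<open>auto elim!: eventually_mono\<close>)
  show "AE z in (lborel :: (real \<times> real) measure). P (snd z)"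
    by (rule gen) (use aeN in auto)
  have "AE y in lborel. x + y \<notin> N" for x
    using AE_borel_affine[of 1 "\<lambda>y. y \<notin> N" x] aeN by simp
  then show "AE z in (lborel :: (real \<times> real) measure). P (fst z + snd z)"
    by (intro gen[of "\<lambda>z. fst z + snd z"]) auto
qed

lemma borel_version:
  fixes f :: "real \<Rightarrow> complex"
  assumes "f \<in> borel_measurable lebesgue"
  obtains g where "g \<in> borel_measurable borel" "AE x in lborel. f x = g x"
proof -
  have "(\<lambda>x. Re (f x)) \<in> borel_measurable lebesgue" "(\<lambda>x. Im (f x)) \<in> borel_measurable lebesgue"
    using assms by (auto intro: borel_measurable_Re borel_measurable_Im)
  then obtain gr gi where g: "gr \<in> borel_measurable lborel" "AE x in lborel. Re (f x) = gr x"
    "gi \<in> borel_measurable lborel" "AE x in lborel. Im (f x) = gi x"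
    using completion_ex_borel_measurable_real by metis
  have [measurable]: "gr \<in> borel_measurable borel" "gi \<in> borel_measurable borel" using g by simp_all
  show thesis
  proof (rule that[of "\<lambda>x. Complex (gr x) (gi x)"])
    show "(\<lambda>x. Complex (gr x) (gi x)) \<in> borel_measurable borel"
      unfolding Complex_eq by measurable
    show "AE x in lborel. f x = Complex (gr x) (gi x)"
      using g(2,4) by eventually_elim (simp add: complex_eq_iff)
  qed
qed

lemma integral_lebesgue_AE:
  fixes f g :: "'a::euclidean_space \<Rightarrow> 'b::{banach, second_countable_topology}"
  assumes ae: "AE x in lborel. f x = g x" and g: "g \<in> borel_measurable borel"
  shows "integral\<^sup>L lebesgue f = integral\<^sup>L lborel g" and "f \<in> borel_measurable lebesgue"
proof -
  have gl: "g \<in> borel_measurable lebesgue" using g by (intro measurable_completion) simp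
  have ae': "AE x in lebesgue. f x = g x" using ae by (rule AE_completion)
  show f: "f \<in> borel_measurable lebesgue"
  proof (rule measurableI)
    fix A :: "'b set" assume A: "A \<in> sets borel"
    show "f -` A \<inter> space lebesgue \<in> sets lebesgue"
    proof (rule completion.in_sets_AE)
      show "g -` A \<inter> space lebesgue \<in> sets lebesgue" using gl A by (rule measurable_sets)
      show "AE x in lebesgue. x \<in> g -` A \<inter> space lebesgue \<longleftrightarrow> x \<in> f -` A \<inter> space lebesgue"
        using ae' by eventually_elim auto
    qed auto
  qed simp
  have "integral\<^sup>L lebesgue f = integral\<^sup>L lebesgue g" by (rule integral_cong_AE[OF f gl ae'])
  also have "\<dots> = integral\<^sup>L lborel g" by (rule integral_completion) (use g in simp)
  finally show "integral\<^sup>L lebesgue f = integral\<^sup>L lborel g" .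
qed

text \<open>Supplies the dominating function for the limit in \<open>form_L2_bound\<close>; the
  second integrand differs from a tensor product by a measure-preserving shear.\<close>

lemma integrable_tensor:
  fixes a b :: "real \<Rightarrow> real"
  assumes a: "integrable lborel a" and b: "integrable lborel b"
  shows "integrable lborel (\<lambda>z::real \<times> real. a (fst z) * b (snd z))"
    and "integrable lborel (\<lambda>z::real \<times> real. a (snd z) * b (fst z + snd z))"
proof -
  have [measurable]: "a \<in> borel_measurable borel" "b \<in> borel_measurable borel"
    using borel_measurable_integrable[OF a] borel_measurable_integrable[OF b] by simp_all
  have fin: "(\<integral>\<^sup>+x. ennreal \<bar>a x\<bar> \<partial>lborel) * (\<integral>\<^sup>+x. ennreal \<bar>b x\<bar> \<partial>lborel) < \<infinity>"
    using a b unfolding integrable_iff_bounded by (simp add: ennreal_mult_less_top)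
  show "integrable lborel (\<lambda>z::real \<times> real. a (fst z) * b (snd z))"
  proof (rule integrableI_bounded)
    have "(\<integral>\<^sup>+z. ennreal (norm (a (fst z) * b (snd z))) \<partial>(lborel \<Otimes>\<^sub>M lborel))
        = (\<integral>\<^sup>+x. \<integral>\<^sup>+y. ennreal \<bar>a x\<bar> * ennreal \<bar>b y\<bar> \<partial>lborel \<partial>lborel)"
      by (subst lborel.nn_integral_fst[symmetric]) (auto simp: abs_mult ennreal_mult)
    also have "\<dots> = (\<integral>\<^sup>+x. ennreal \<bar>a x\<bar> \<partial>lborel) * (\<integral>\<^sup>+x. ennreal \<bar>b x\<bar> \<partial>lborel)"
      by (simp add: nn_integral_cmult nn_integral_multc)
    finally show "(\<integral>\<^sup>+z. ennreal (norm (a (fst z) * b (snd z))) \<partial>(lborel :: (real \<times> real) measure)) < \<infinity>"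
      using fin by (simp add: lborel_prod)
  qed (simp add: borel_prod[symmetric])
  show "integrable lborel (\<lambda>z::real \<times> real. a (snd z) * b (fst z + snd z))"
  proof (rule integrableI_bounded)
    have "(\<integral>\<^sup>+z. ennreal (norm (a (snd z) * b (fst z + snd z))) \<partial>(lborel \<Otimes>\<^sub>M lborel))
        = (\<integral>\<^sup>+y. \<integral>\<^sup>+x. ennreal \<bar>a y\<bar> * ennreal \<bar>b (x + y)\<bar> \<partial>lborel \<partial>lborel)"
      by (subst lborel_pair.nn_integral_snd[symmetric]) (auto simp: abs_mult ennreal_mult)
    also have "\<dots> = (\<integral>\<^sup>+y. ennreal \<bar>a y\<bar> * (\<integral>\<^sup>+x. ennreal \<bar>b x\<bar> \<partial>lborel) \<partial>lborel)"
    proof (rule nn_integral_cong)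
      fix y
      have "(\<integral>\<^sup>+x. ennreal \<bar>b (x + y)\<bar> \<partial>lborel) = (\<integral>\<^sup>+x. ennreal \<bar>b x\<bar> \<partial>lborel)"
        using nn_integral_real_affine[of "\<lambda>x. ennreal \<bar>b x\<bar>" 1 y] by (simp add: add.commute)
      then show "(\<integral>\<^sup>+x. ennreal \<bar>a y\<bar> * ennreal \<bar>b (x + y)\<bar> \<partial>lborel) = ennreal \<bar>a y\<bar> * (\<integral>\<^sup>+x. ennreal \<bar>b x\<bar> \<partial>lborel)"
        by (simp add: nn_integral_cmult)
    qed
    also have "\<dots> = (\<integral>\<^sup>+x. ennreal \<bar>a x\<bar> \<partial>lborel) * (\<integral>\<^sup>+x. ennreal \<bar>b x\<bar> \<partial>lborel)"
      by (simp add: nn_integral_multc)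
    finally show "(\<integral>\<^sup>+z. ennreal (norm (a (snd z) * b (fst z + snd z))) \<partial>(lborel :: (real \<times> real) measure)) < \<infinity>"
      using fin by (simp add: lborel_prod)
  qed (simp add: borel_prod[symmetric])
qed

text \<open>Inserting the representation and exchanging integrals turns the half-line conditions
  into restrictions of f1 and f2; the superposition costs the L1 norm of h. Cutting to [0, 1) is
  free because \<phi> vanishes elsewhere.\<close>

lemma amplitude_bound:
  assumes P: "jet_family n P" and f: "nice f1" "nice f2" "nice f3"
    and h: "continuous_on UNIV h" "\<And>z. h z \<noteq> 0 \<Longrightarrow> z \<in> {0..1} \<times> {0..1}"
    and rep: "\<And>x y. \<phi> (x, y) = (LINT (s, t)|lborel. (if s \<le> x \<and> t \<le> y then h (s, t) else 0))"
    and supp: "\<And>x y. \<phi> (x, y) \<noteq> 0 \<Longrightarrow> 0 \<le> x \<and> x < 1 \<and> 0 \<le> y \<and> y < 1"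
    and B: "\<And>s t. cmod (tform l (P 0 0) (restr {s..} (restr {0..<1} f1)) (restr {t..} (restr {0..<1} f2)) f3) \<le> B"
  shows "cmod (LINT z|lborel. cis (l * P 0 0 (fst z) (snd z)) * f1 (fst z) * f2 (snd z) * f3 (fst z + snd z) * \<phi> z)
    \<le> B * (LINT w|lborel. cmod (h w))"
proof -
  note [measurable] = nice_meas[OF f(1)] nice_meas[OF f(2)] nice_meas[OF f(3)] jet_measurable[OF P]
  define F1 where "F1 = restr {0..<1} f1"
  define F2 where "F2 = restr {0..<1} f2"
  have nF: "nice F1" "nice F2" unfolding F1_def F2_def by (auto intro: nice_restr f)
  have [measurable]: "F1 \<in> borel_measurable borel" "F2 \<in> borel_measurable borel" using nF by (auto intro: nice_meas)
  have hm: "h \<in> borel_measurable borel" by (rule borel_measurable_continuous_onI[OF h(1)])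
  note [measurable] = hm[folded borel_prod]
  obtain Bh where Bh: "\<And>z. cmod (h z) \<le> Bh"
  proof -
    have "compact ({0..1} \<times> {0..1} :: (real \<times> real) set)" by (intro compact_Times) auto
    then have "compact (h ` ({0..1} \<times> {0..1}))" using h(1) by (intro compact_continuous_image) (auto intro: continuous_on_subset)
    then obtain b where "\<forall>w\<in>h ` ({0..1} \<times> {0..1}). norm w \<le> b" using compact_imp_bounded bounded_iff by metis
    then have "cmod (h z) \<le> max b 0" for z using h(2)[of z] by (cases "h z = 0") (auto simp: le_max_iff_disj)
    then show thesis by (rule that)
  qed
  obtain B1 where B1: "\<And>x. cmod (F1 x) \<le> B1" "0 < B1" using nice_bound[OF nF(1)] by auto
  obtain B2 where B2: "\<And>x. cmod (F2 x) \<le> B2" "0 < B2" using nice_bound[OF nF(2)] by auto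
  obtain B3 where B3: "\<And>x. cmod (f3 x) \<le> B3" "0 < B3" using nice_bound[OF f(3)] by auto
  have Bh0: "0 \<le> Bh" using Bh[of "(0, 0)"] norm_ge_zero order_trans by blast
  define E where "E z = cis (l * P 0 0 (fst z) (snd z)) * F1 (fst z) * F2 (snd z) * f3 (fst z + snd z)" for z :: "real \<times> real"
  define J where "J = (\<lambda>q::(real \<times> real) \<times> (real \<times> real). E (fst q) *
      (if fst (snd q) \<le> fst (fst q) \<and> snd (snd q) \<le> snd (fst q) then h (snd q) else 0))"
  have hint: "integrable lborel h"
    by (rule integrable_bounded_support[OF hm Bh]) (rule bounded_subset[of "{0..1} \<times> {0..1}"], use h(2) in \<open>auto intro!: bounded_Times\<close>)
  have intJ: "integrable lborel J"
  proof (rule integrable_bounded_support)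
    show "J \<in> borel_measurable borel"
      unfolding J_def E_def borel_prod[symmetric] by measurable
    have E_le: "cmod (E z) \<le> B1 * B2 * B3" for z
      unfolding E_def using B1 B2 B3 by (auto simp: norm_mult intro!: mult_mono)
    show "norm (J q) \<le> B1 * B2 * B3 * Bh" for q
      unfolding J_def norm_mult using E_le Bh Bh0 B1 B2 B3 by (intro mult_mono) auto
    have "{q. J q \<noteq> 0} \<subseteq> ({0..1} \<times> {0..1}) \<times> ({0..1} \<times> {0..1})"
    proof
      fix q assume "q \<in> {q. J q \<noteq> 0}"
      then have 1: "F1 (fst (fst q)) \<noteq> 0" "F2 (snd (fst q)) \<noteq> 0" "h (snd q) \<noteq> 0"
        by (auto simp: J_def E_def split: if_splits)
      have "fst (fst q) \<in> {0..<1}" "snd (fst q) \<in> {0..<1}"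
        using 1 restr_supp unfolding F1_def F2_def by blast+
      moreover have "snd q \<in> {0..1} \<times> {0..1}" using 1 h(2) by blast
      ultimately show "q \<in> ({0..1} \<times> {0..1}) \<times> ({0..1} \<times> {0..1})" by (auto simp: mem_Times_iff)
    qed
    then show "bounded {q. J q \<noteq> 0}"
      by (rule bounded_subset[rotated]) (auto intro!: bounded_Times)
  qed
  have in_z: "(LINT w|lborel. J (z, w)) = cis (l * P 0 0 (fst z) (snd z)) * f1 (fst z) * f2 (snd z) * f3 (fst z + snd z) * \<phi> z" for z
  proof -
    obtain x y where z: "z = (x, y)" by (cases z)
    have "(LINT w|lborel. J (z, w)) = E z * \<phi> z"
      unfolding z rep J_def by (simp add: case_prod_unfold cong: if_cong)
    also have "\<dots> = cis (l * P 0 0 (fst z) (snd z)) * f1 (fst z) * f2 (snd z) * f3 (fst z + snd z) * \<phi> z"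
      using supp[of x y] by (cases "\<phi> z = 0") (auto simp: z E_def F1_def F2_def restr_def)
    finally show ?thesis .
  qed
  have in_w: "(LINT z|lborel. J (z, w)) = h w * tform l (P 0 0) (restr {fst w..} F1) (restr {snd w..} F2) f3" for w
  proof -
    have "J (z, w) = h w * (cis (l * P 0 0 (fst z) (snd z)) * restr {fst w..} F1 (fst z) * restr {snd w..} F2 (snd z) * f3 (fst z + snd z))" for z
      by (auto simp: J_def E_def restr_def)
    then show ?thesis by (simp add: tform_def case_prod_unfold)
  qed
  have "(LINT z|lborel. cis (l * P 0 0 (fst z) (snd z)) * f1 (fst z) * f2 (snd z) * f3 (fst z + snd z) * \<phi> z)
      = (LINT z|lborel. LINT w|lborel. J (z, w))"
    unfolding in_z ..
  also have "\<dots> = (LINT w|lborel. LINT z|lborel. J (z, w))"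
    using lborel_fubini(1,2)[OF intJ] by simp
  finally have "cmod (LINT z|lborel. cis (l * P 0 0 (fst z) (snd z)) * f1 (fst z) * f2 (snd z) * f3 (fst z + snd z) * \<phi> z)
      = cmod (LINT w|lborel. LINT z|lborel. J (z, w))" by simp
  also have "\<dots> \<le> (LINT w|lborel. cmod (h w) * B)"
  proof (rule Bochner_Integration.integral_norm_bound_integral)
    show "integrable lborel (\<lambda>w. LINT z|lborel. J (z, w))" by (rule lborel_fubini(4)[OF intJ])
    show "integrable lborel (\<lambda>w. cmod (h w) * B)" using hint by simp
    show "norm (LINT z|lborel. J (z, w)) \<le> cmod (h w) * B" for w
      unfolding in_w norm_mult using B[of "fst w" "snd w"] by (intro mult_left_mono) (auto simp: F1_def F2_def)
  qed
  also have "\<dots> = B * (LINT w|lborel. cmod (h w))" by simp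
  finally show ?thesis .
qed

lemma nrm_restr_le_L2:
  assumes g: "g \<in> borel_measurable borel" "integrable lborel (\<lambda>x. (cmod (g x))\<^sup>2)" and [measurable]: "A \<in> sets borel"
  shows "nrm (restr A g) \<le> sqrt (LINT x|lborel. (cmod (g x))\<^sup>2)"
  unfolding nrm_def
proof (rule real_sqrt_le_mono, rule integral_mono_AE')
  show "AE x in lborel. (cmod (restr A g x))\<^sup>2 \<le> (cmod (g x))\<^sup>2" by (auto simp: restr_def)
qed (use g in auto)

lemma nice_truncation:
  assumes [measurable]: "g \<in> borel_measurable borel"
  shows "nice (restr {x. cmod (g x) \<le> real k \<and> \<bar>x\<bar> \<le> real k} g)" (is "nice ?g")
  unfolding nice_def
proof (intro conjI exI allI impI)
  show "?g \<in> borel_measurable borel" unfolding restr_def by measurable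
  show "cmod (?g x) \<le> real k" for x by (simp add: restr_def)
  show "\<bar>x\<bar> \<le> real k" if "?g x \<noteq> 0" for x using that by (auto simp: restr_def split: if_splits)
qed

lemma truncation_eventually:
  "eventually (\<lambda>k. restr {x. cmod (g x) \<le> real k \<and> \<bar>x\<bar> \<le> real k} g x = g x) sequentially"
proof -
  obtain N where "max (cmod (g x)) \<bar>x\<bar> \<le> real N" using real_arch_simple by blast
  then show ?thesis unfolding eventually_sequentially by (intro exI[of _ N]) (auto simp: restr_def)
qed

lemma form_L2_bound:
  assumes P: "jet_family n P"
    and g: "g1 \<in> borel_measurable borel" "g2 \<in> borel_measurable borel" "g3 \<in> borel_measurable borel"
    and i: "integrable lborel (\<lambda>x. (cmod (g1 x))\<^sup>2)" "integrable lborel (\<lambda>x. (cmod (g2 x))\<^sup>2)" "integrable lborel (\<lambda>x. (cmod (g3 x))\<^sup>2)"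
    and phi: "continuous_on UNIV \<phi>" "\<And>x y. \<phi> (x, y) \<noteq> 0 \<Longrightarrow> 0 \<le> x \<and> x < 1 \<and> 0 \<le> y \<and> y < 1"
    and B0: "0 \<le> B"
    and B: "\<And>f1 f2 f3. nice f1 \<Longrightarrow> nice f2 \<Longrightarrow> nice f3 \<Longrightarrow>
       cmod (LINT z|lborel. cis (l * P 0 0 (fst z) (snd z)) * f1 (fst z) * f2 (snd z) * f3 (fst z + snd z) * \<phi> z) \<le> B * (nrm f1 * nrm f2 * nrm f3)"
  shows "cmod (LINT z|lborel. cis (l * P 0 0 (fst z) (snd z)) * g1 (fst z) * g2 (snd z) * g3 (fst z + snd z) * \<phi> z)
     \<le> B * (sqrt (LINT x|lborel. (cmod (g1 x))\<^sup>2) * sqrt (LINT x|lborel. (cmod (g2 x))\<^sup>2) * sqrt (LINT x|lborel. (cmod (g3 x))\<^sup>2))"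
proof -
  note [measurable] = g jet_measurable[OF P]
  have phim: "\<phi> \<in> borel_measurable borel" by (rule borel_measurable_continuous_onI[OF phi(1)])
  note [measurable] = phim[folded borel_prod]
  obtain b where b: "\<And>z. cmod (\<phi> z) \<le> b"
  proof -
    have "compact ({0..1} \<times> {0..1} :: (real \<times> real) set)" by (intro compact_Times) auto
    then have "compact (\<phi> ` ({0..1} \<times> {0..1}))" using phi(1) by (intro compact_continuous_image) (auto intro: continuous_on_subset)
    then obtain c where c: "\<forall>w\<in>\<phi> ` ({0..1} \<times> {0..1}). norm w \<le> c" using compact_imp_bounded bounded_iff by metis
    have "cmod (\<phi> z) \<le> max c 0" for z
    proof (cases "\<phi> z = 0")
      case False
      then have "z \<in> {0..1} \<times> {0..1}" using phi(2)[of "fst z" "snd z"] by (auto simp: mem_Times_iff)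
      then show ?thesis using c by (auto simp: le_max_iff_disj)
    qed simp
    then show thesis by (rule that)
  qed
  have b0: "0 \<le> b" using b[of "(0, 0)"] norm_ge_zero order_trans by blast
  define tr where "tr k g = restr {x. cmod (g x) \<le> real k \<and> \<bar>x\<bar> \<le> real k} g" for k and g :: "real \<Rightarrow> complex"
  let ?s = "\<lambda>f1 f2 f3 z. cis (l * P 0 0 (fst z) (snd z)) * f1 (fst z) * f2 (snd z) * f3 (fst z + snd z) * \<phi> z"
  \<comment> \<open>Dominates by p q \<le> p^2 + q^2 with p = |g1| and q = |g2 g3|. The cutoff in y,
    allowed by the support of \<phi>, makes the first term integrable.\<close>
  define w where "w z = b * ((cmod (g1 (fst z)))\<^sup>2 * indicator {0..1} (snd z) + (cmod (g2 (snd z)))\<^sup>2 * (cmod (g3 (fst z + snd z)))\<^sup>2)"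
    for z :: "real \<times> real"
  have ntr: "nice (tr k g1)" "nice (tr k g2)" "nice (tr k g3)" for k
    unfolding tr_def by (intro nice_truncation g)+
  have [measurable]: "tr k g1 \<in> borel_measurable borel" "tr k g2 \<in> borel_measurable borel" "tr k g3 \<in> borel_measurable borel" for k
    using ntr by (auto intro: nice_meas)
  have lim: "(\<lambda>k. LINT z|lborel. ?s (tr k g1) (tr k g2) (tr k g3) z) \<longlonglongrightarrow> (LINT z|lborel. ?s g1 g2 g3 z)"
  proof (rule integral_dominated_convergence[where w = w])
    show "(\<lambda>z. ?s g1 g2 g3 z) \<in> borel_measurable lborel" "(\<lambda>z. ?s (tr k g1) (tr k g2) (tr k g3) z) \<in> borel_measurable lborel" for k
      by (simp_all add: borel_prod[symmetric])
    have "integrable lborel (indicator {0..1} :: real \<Rightarrow> real)" by (intro integrable_real_indicator) auto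
    from integrable_tensor(1)[OF i(1) this] integrable_tensor(2)[OF i(2,3)]
    show "integrable lborel w" unfolding w_def by (intro integrable_mult_right Bochner_Integration.integrable_add)
    show "AE z in lborel. (\<lambda>k. ?s (tr k g1) (tr k g2) (tr k g3) z) \<longlonglongrightarrow> ?s g1 g2 g3 z"
    proof (rule AE_I2)
      fix z :: "real \<times> real"
      have "eventually (\<lambda>k. ?s (tr k g1) (tr k g2) (tr k g3) z = ?s g1 g2 g3 z) sequentially"
        using truncation_eventually[of g1 "fst z"] truncation_eventually[of g2 "snd z"] truncation_eventually[of g3 "fst z + snd z"]
        unfolding tr_def by eventually_elim simp
      then show "(\<lambda>k. ?s (tr k g1) (tr k g2) (tr k g3) z) \<longlonglongrightarrow> ?s g1 g2 g3 z" by (rule tendsto_eventually)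
    qed
    show "AE z in lborel. norm (?s (tr k g1) (tr k g2) (tr k g3) z) \<le> w z" for k
    proof (rule AE_I2)
      fix z :: "real \<times> real"
      have le: "cmod (tr k g x) \<le> cmod (g x)" for g x by (simp add: tr_def restr_def)
      show "norm (?s (tr k g1) (tr k g2) (tr k g3) z) \<le> w z"
      proof (cases "\<phi> z = 0")
        case True
        then show ?thesis using b0 by (simp add: w_def)
      next
        case False
        then have "indicator {0..1} (snd z) = (1::real)" using phi(2)[of "fst z" "snd z"] by auto
        then have wz: "w z = b * ((cmod (g1 (fst z)))\<^sup>2 + (cmod (g2 (snd z)) * cmod (g3 (fst z + snd z)))\<^sup>2)"
          by (simp add: w_def power_mult_distrib)
        have amgm: "p * q \<le> p\<^sup>2 + q\<^sup>2" if "0 \<le> p" "0 \<le> q" for p q :: real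
        proof -
          have "2 * (p * q) \<le> p\<^sup>2 + q\<^sup>2" using sum_squares_bound[of p q] by simp
          moreover have "0 \<le> p * q" using that by simp
          ultimately show ?thesis by linarith
        qed
        have "norm (?s (tr k g1) (tr k g2) (tr k g3) z)
            \<le> (cmod (g1 (fst z)) * (cmod (g2 (snd z)) * cmod (g3 (fst z + snd z)))) * b"
          unfolding norm_mult norm_cis mult.assoc mult_1_left using le b b0 by (intro mult_mono) auto
        also have "\<dots> \<le> ((cmod (g1 (fst z)))\<^sup>2 + (cmod (g2 (snd z)) * cmod (g3 (fst z + snd z)))\<^sup>2) * b"
          using b0 by (intro mult_right_mono amgm) auto
        finally show ?thesis unfolding wz by (simp add: mult.commute)
      qed
    qed
  qed
  have tr_le: "nrm (tr k g) \<le> sqrt (LINT x|lborel. (cmod (g x))\<^sup>2)"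
    if "g \<in> borel_measurable borel" "integrable lborel (\<lambda>x. (cmod (g x))\<^sup>2)" for k g
  proof -
    note [measurable] = that(1)
    have "{x. cmod (g x) \<le> real k \<and> \<bar>x\<bar> \<le> real k} \<in> sets borel" by measurable
    then show ?thesis unfolding tr_def by (rule nrm_restr_le_L2[OF that])
  qed
  show ?thesis
  proof (rule LIMSEQ_le_const2[OF tendsto_norm[OF lim]], intro exI[of _ 0] allI impI)
    fix k :: nat
    have "cmod (LINT z|lborel. ?s (tr k g1) (tr k g2) (tr k g3) z) \<le> B * (nrm (tr k g1) * nrm (tr k g2) * nrm (tr k g3))"
      by (rule B[OF ntr])
    also have "\<dots> \<le> B * (sqrt (LINT x|lborel. (cmod (g1 x))\<^sup>2) * sqrt (LINT x|lborel. (cmod (g2 x))\<^sup>2) * sqrt (LINT x|lborel. (cmod (g3 x))\<^sup>2))"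
      using B0 g i by (intro mult_left_mono mult_mono tr_le) auto
    finally show "norm (LINT z|lborel. ?s (tr k g1) (tr k g2) (tr k g3) z)
      \<le> B * (sqrt (LINT x|lborel. (cmod (g1 x))\<^sup>2) * sqrt (LINT x|lborel. (cmod (g2 x))\<^sup>2) * sqrt (LINT x|lborel. (cmod (g3 x))\<^sup>2))" .
  qed
qed

theorem theorem1p5:
  fixes \<phi> :: "real \<times> real \<Rightarrow> complex" and n :: nat
  assumes "smooth_compactly_supported \<phi>"
    and "supp \<phi> \<subseteq> {0..1} \<times> {0..1}"
  shows "\<exists>C::real.
    \<forall>(S::bipoly) (N::nat) (\<alpha>::nat \<Rightarrow> nat \<times> nat).
      total_degree S = n \<longrightarrow> 1 \<le> N \<longrightarrow>
      (\<forall>i\<in>{1..N}. \<forall>x\<in>{0..1}. \<forall>y\<in>{0..1}. 1 \<le> \<bar>eval2 (multi_deriv (\<alpha> i) (H_of S)) x y\<bar>) \<longrightarrow>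
      (let d = Min ((\<lambda>i. multi_order (\<alpha> i)) ` {1..N}) in
        \<forall>l::real. l \<noteq> 0 \<longrightarrow>
          (\<forall>f\<^sub>1 f\<^sub>2 f\<^sub>3. in_L2 f\<^sub>1 \<longrightarrow> in_L2 f\<^sub>2 \<longrightarrow> in_L2 f\<^sub>3 \<longrightarrow>
            cmod (trilinear_form S \<phi> l f\<^sub>1 f\<^sub>2 f\<^sub>3)
              \<le> C * \<bar>l\<bar> powr (- (1 / (2 * (3 + real d)))) * L2_norm f\<^sub>1 * L2_norm f\<^sub>2 * L2_norm f\<^sub>3))"
proof -
  obtain h where h: "continuous_on UNIV h" "\<And>z. h z \<noteq> 0 \<Longrightarrow> z \<in> {0..1} \<times> {0..1}"
    and rep: "\<And>x y. \<phi> (x, y) = (LINT (s, t)|lborel. (if s \<le> x \<and> t \<le> y then h (s, t) else 0))"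
    and phi: "continuous_on UNIV \<phi>" "\<And>x y. \<phi> (x, y) \<noteq> 0 \<Longrightarrow> 0 \<le> x \<and> x < 1 \<and> 0 \<le> y \<and> y < 1"
    using amplitude_representation[OF assms] by blast
  obtain Cd where Cd_const: "\<And>d. uniform_const n d (Cd d)" using tform_bound by metis
  have Cd: "0 \<le> Cd d" for d using Cd_const[of d] by (simp add: uniform_const_def)
  define Ih where "Ih = (LINT w|lborel. cmod (h w))"
  have Ih0: "0 \<le> Ih" unfolding Ih_def by simp
  define Call where "Call = (\<Sum>d\<le>2 * n. Cd d) * Ih"
  have bound: "cmod (trilinear_form S \<phi> l f1 f2 f3)
      \<le> Call * \<bar>l\<bar> powr (- (1 / (2 * (3 + real d)))) * L2_norm f1 * L2_norm f2 * L2_norm f3"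
    if S: "total_degree S = n" and d: "multi_order a = d"
      and low: "\<forall>x\<in>{0..1}. \<forall>y\<in>{0..1}. 1 \<le> \<bar>eval2 (multi_deriv a (H_of S)) x y\<bar>" and l: "l \<noteq> 0"
      and f: "in_L2 f1" "in_L2 f2" "in_L2 f3" for S l f1 f2 f3 a d
  proof -
    define P where "P = poly_jets S"
    define \<Lambda> where "\<Lambda> = \<bar>l\<bar> powr (- (1 / (2 * (3 + real d))))"
    have P: "jet_family n P" using jet_family_poly_jets[of S] S by (simp add: P_def)
    obtain a1 a2 where a: "a = (a1, a2)" by (cases a)
    have dsum: "a1 + a2 = d" using d by (simp add: a multi_order_def)
    have low': "\<forall>x\<in>{0..1}. \<forall>y\<in>{0..1}. 1 \<le> \<bar>curv P a1 a2 x y\<bar>"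
      using low by (simp add: P_def curv_poly_jets a)
    \<comment> \<open>A nonvanishing derivative has both orders at most n, so finitely many d occur,
      and summing their constants leaves one that depends on n and \<phi> only.\<close>
    have "d \<le> 2 * n"
    proof -
      have "curv P a1 a2 0 0 \<noteq> 0" using low' by force
      then have "a1 \<le> n" "a2 \<le> n" using jet_family_curv[OF P] unfolding jet_family_def by (meson not_le)+
      then show ?thesis using dsum by simp
    qed
    then have Cd_le: "Cd d \<le> (\<Sum>d\<le>2 * n. Cd d)"
      using Cd by (intro member_le_sum) auto
    have nice_bound: "cmod (LINT z|lborel. cis (l * P 0 0 (fst z) (snd z)) * e1 (fst z) * e2 (snd z) * e3 (fst z + snd z) * \<phi> z)
        \<le> (Cd d * \<Lambda> * Ih) * (nrm e1 * nrm e2 * nrm e3)"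
      if e: "nice e1" "nice e2" "nice e3" for e1 e2 e3
    proof -
      have "cmod (LINT z|lborel. cis (l * P 0 0 (fst z) (snd z)) * e1 (fst z) * e2 (snd z) * e3 (fst z + snd z) * \<phi> z)
        \<le> (Cd d * \<Lambda> * (nrm e1 * nrm e2 * nrm e3)) * (LINT w|lborel. cmod (h w))"
      proof (rule amplitude_bound[OF P e h rep phi(2)])
        fix s t
        let ?e1 = "restr {s..} (restr {0..<1} e1)" and ?e2 = "restr {t..} (restr {0..<1} e2)"
        have n1: "nice (restr {0..<1} e1)" "nice (restr {0..<1} e2)" using e by (auto intro: nice_restr)
        have n2: "nice ?e1" "nice ?e2" using n1 by (auto intro: nice_restr)
        have "cmod (tform l (P 0 0) ?e1 ?e2 e3) \<le> Cd d * \<Lambda> * (nrm ?e1 * nrm ?e2 * nrm e3)"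
          using Cd_const[of d] P dsum low' l n2 e(3) unfolding \<Lambda>_def uniform_const_def by (auto simp: restr_def split: if_splits)
        also have "\<dots> \<le> Cd d * \<Lambda> * (nrm e1 * nrm e2 * nrm e3)"
          using Cd[of d] e n1
          by (intro mult_left_mono mult_mono order_trans[OF nrm_restr_le nrm_restr_le]) (auto simp: \<Lambda>_def)
        finally show "cmod (tform l (P 0 0) ?e1 ?e2 e3) \<le> Cd d * \<Lambda> * (nrm e1 * nrm e2 * nrm e3)" .
      qed
      then show ?thesis by (simp add: Ih_def ac_simps)
    qed
    \<comment> \<open>The given functions are only Lebesgue measurable; Borel representatives make
      the composition with x + y and the product measurable in the plane.\<close>
    obtain g1 where g1: "g1 \<in> borel_measurable borel" "AE x in lborel. f1 x = g1 x"
      using f(1) borel_version unfolding in_L2_def by blast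
    obtain g2 where g2: "g2 \<in> borel_measurable borel" "AE x in lborel. f2 x = g2 x"
      using f(2) borel_version unfolding in_L2_def by blast
    obtain g3 where g3: "g3 \<in> borel_measurable borel" "AE x in lborel. f3 x = g3 x"
      using f(3) borel_version unfolding in_L2_def by blast
    have norm_eq: "integrable lborel (\<lambda>x. (cmod (g x))\<^sup>2) \<and> L2_norm f = sqrt (LINT x|lborel. (cmod (g x))\<^sup>2)"
      if g: "g \<in> borel_measurable borel" "AE x in lborel. f x = g x" and f: "in_L2 f" for f g
    proof
      note [measurable] = g(1)
      have ae: "AE x in lborel. (cmod (f x))\<^sup>2 = (cmod (g x))\<^sup>2" using g(2) by eventually_elim simp
      show "L2_norm f = sqrt (LINT x|lborel. (cmod (g x))\<^sup>2)"
        unfolding L2_norm_def by (subst integral_lebesgue_AE(1)[OF ae]) auto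
      have "integrable lebesgue (\<lambda>x. (cmod (g x))\<^sup>2)"
        using f AE_completion[OF ae] unfolding in_L2_def
        by (subst integrable_cong_AE[of _ _ "\<lambda>x. (cmod (f x))\<^sup>2"]) (auto intro: measurable_completion)
      then show "integrable lborel (\<lambda>x. (cmod (g x))\<^sup>2)"
        by (subst (asm) integrable_completion) auto
    qed
    have tri: "trilinear_form S \<phi> l f1 f2 f3
        = (LINT z|lborel. cis (l * P 0 0 (fst z) (snd z)) * g1 (fst z) * g2 (snd z) * g3 (fst z + snd z) * \<phi> z)"
      unfolding trilinear_form_def case_prod_unfold
    proof (rule integral_lebesgue_AE(1))
      show "AE z in lborel. exp (\<i> * complex_of_real (l * eval2 S (fst z) (snd z))) * f1 (fst z) * f2 (snd z) * f3 (fst z + snd z) * \<phi> (fst z, snd z)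
        = cis (l * P 0 0 (fst z) (snd z)) * g1 (fst z) * g2 (snd z) * g3 (fst z + snd z) * \<phi> z"
        using AE_pair_transfer(1)[OF g1(2)] AE_pair_transfer(2)[OF g2(2)] AE_pair_transfer(3)[OF g3(2)]
        by eventually_elim (simp add: P_def eval2_poly_jets cis_conv_exp)
      note [measurable] = g1(1) g2(1) g3(1) jet_measurable[OF P]
      have phim: "\<phi> \<in> borel_measurable borel" by (rule borel_measurable_continuous_onI[OF phi(1)])
      note [measurable] = phim[folded borel_prod]
      show "(\<lambda>z. cis (l * P 0 0 (fst z) (snd z)) * g1 (fst z) * g2 (snd z) * g3 (fst z + snd z) * \<phi> z) \<in> borel_measurable borel"
        by (simp add: borel_prod[symmetric])
    qed
    note ne = norm_eq[OF g1 f(1)] norm_eq[OF g2 f(2)] norm_eq[OF g3 f(3)]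
    have "cmod (trilinear_form S \<phi> l f1 f2 f3) \<le> (Cd d * \<Lambda> * Ih) *
        (sqrt (LINT x|lborel. (cmod (g1 x))\<^sup>2) * sqrt (LINT x|lborel. (cmod (g2 x))\<^sup>2) * sqrt (LINT x|lborel. (cmod (g3 x))\<^sup>2))"
      unfolding tri
    proof (rule form_L2_bound[OF P g1(1) g2(1) g3(1)])
      show "0 \<le> Cd d * \<Lambda> * Ih" using Cd[of d] Ih0 by (intro mult_nonneg_nonneg) (auto simp: \<Lambda>_def)
    qed (use ne phi nice_bound in blast)+
    also have "\<dots> = (Cd d * \<Lambda> * Ih) * (L2_norm f1 * L2_norm f2 * L2_norm f3)" using ne by simp
    also have "\<dots> \<le> ((\<Sum>d\<le>2 * n. Cd d) * \<Lambda> * Ih) * (L2_norm f1 * L2_norm f2 * L2_norm f3)"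
      using Cd_le Ih0 by (intro mult_right_mono) (auto simp: \<Lambda>_def L2_norm_def)
    finally show ?thesis by (simp add: Call_def \<Lambda>_def ac_simps)
  qed
  show ?thesis
  proof (intro exI[of _ Call] allI impI, unfold Let_def, intro allI impI)
    fix S :: bipoly and N :: nat and \<alpha> :: "nat \<Rightarrow> nat \<times> nat" and l :: real and f1 f2 f3
    assume S: "total_degree S = n" and N: "1 \<le> N"
      and low: "\<forall>i\<in>{1..N}. \<forall>x\<in>{0..1}. \<forall>y\<in>{0..1}. 1 \<le> \<bar>eval2 (multi_deriv (\<alpha> i) (H_of S)) x y\<bar>"
      and l: "l \<noteq> 0" and f: "in_L2 f1" "in_L2 f2" "in_L2 f3"
    let ?d = "Min ((\<lambda>i. multi_order (\<alpha> i)) ` {1..N})"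
    have "?d \<in> (\<lambda>i. multi_order (\<alpha> i)) ` {1..N}" using N by (intro Min_in) auto
    then obtain i where i: "i \<in> {1..N}" "multi_order (\<alpha> i) = ?d" by auto
    show "cmod (trilinear_form S \<phi> l f1 f2 f3)
        \<le> Call * \<bar>l\<bar> powr (- (1 / (2 * (3 + real ?d)))) * L2_norm f1 * L2_norm f2 * L2_norm f3"
      by (rule bound[OF S i(2) bspec[OF low i(1)] l f])
  qed
qed

end
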